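(* Let $R$ be a noetherian ring satisfying (G$_1$) and (S$_2$), and $M$ a finitely generated $R$-module. Then for any $R$-submodule $N$ of $M$, $\mathrm{char}_R(M)\subseteq\mathrm{char}_R(N)$.
   Context: $R$ satisfies (G$_1$) if $R_\mathfrak{r}$ is Gorenstein for every prime $\mathfrak{r}$ with $\mathrm{ht}(\mathfrak{r})\le1$; $R$ satisfies (S$_2$) if $\mathrm{depth}(R_\mathfrak{r})\ge\min\{2,\dim R_\mathfrak{r}\}$ for all primes $\mathfrak{r}$. For an $R$-module $M$, $M^*=\mathrm{Hom}_R(M,R)$ and $\bigcap^n_RM=(\bigwedge^n_R(M^* ))^*$. For a finitely generated $R$-module $M$, choose $n>0$ and an exact sequence $0\to N'\to R^n\to M\to0$; then $\mathrm{char}_R(M)=\mathrm{im}(\bigcap^n_RN'\to\bigcap^n_RR^n=R)$, which is independent of the choice. *)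

theory Defs
  imports Main "HOL-Library.Extended_Nat"
begin

definition is_ideal :: "'a::comm_ring_1 set \<Rightarrow> bool" where
  "is_ideal I \<longleftrightarrow> 0 \<in> I \<and> (\<forall>x\<in>I. \<forall>y\<in>I. x + y \<in> I) \<and> (\<forall>r. \<forall>x\<in>I. r * x \<in> I)"

definition noetherian_ring :: "'a::comm_ring_1 itself \<Rightarrow> bool" where
  "noetherian_ring _ \<longleftrightarrow>
     \<not> (\<exists>I :: nat \<Rightarrow> 'a set. (\<forall>k. is_ideal (I k)) \<and> (\<forall>k. I k \<subset> I (Suc k)))"

definition is_prime_ideal :: "'a::comm_ring_1 set \<Rightarrow> bool" where
  "is_prime_ideal P \<longleftrightarrow> is_ideal P \<and> P \<noteq> UNIV \<and> (\<forall>a b. a * b \<in> P \<longrightarrow> a \<in> P \<or> b \<in> P)"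

definition height :: "'a::comm_ring_1 set \<Rightarrow> enat" where
  "height P = Sup {enat k | k. \<exists>c :: nat \<Rightarrow> 'a set.
      (\<forall>i\<le>k. is_prime_ideal (c i)) \<and> (\<forall>i<k. c i \<subset> c (Suc i)) \<and> c k = P}"

(* a/1 \<in> I R_P  iff  s a \<in> I for some s \<notin> P *)
definition loc_mem :: "'a::comm_ring_1 set \<Rightarrow> 'a set \<Rightarrow> 'a \<Rightarrow> bool" where
  "loc_mem P I a \<longleftrightarrow> (\<exists>s. s \<notin> P \<and> s * a \<in> I)"

definition ideal_gen :: "(nat \<Rightarrow> 'a::comm_ring_1) \<Rightarrow> nat \<Rightarrow> 'a set" where
  "ideal_gen x i = {(\<Sum>j<i. r j * x j) | r. True}"

(* x 0, ..., x (k-1) in P form an R_P-regular sequence (the images x_j/1 in P R_P) *)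
definition loc_regular_seq :: "'a::comm_ring_1 set \<Rightarrow> (nat \<Rightarrow> 'a) \<Rightarrow> nat \<Rightarrow> bool" where
  "loc_regular_seq P x k \<longleftrightarrow> (\<forall>i<k. x i \<in> P) \<and>
     (\<forall>i<k. \<forall>a. loc_mem P (ideal_gen x i) (x i * a) \<longrightarrow> loc_mem P (ideal_gen x i) a)"

definition depth_loc :: "'a::comm_ring_1 set \<Rightarrow> enat" where
  "depth_loc P = Sup {enat k | k. \<exists>x. loc_regular_seq P x k}"

definition vecs :: "nat \<Rightarrow> (nat \<Rightarrow> 'a::comm_ring_1) set" where
  "vecs m = {x. \<forall>j\<ge>m. x j = 0}"

definition mat_app :: "nat \<Rightarrow> nat \<Rightarrow> (nat \<Rightarrow> nat \<Rightarrow> 'a) \<Rightarrow> (nat \<Rightarrow> 'a) \<Rightarrow> nat \<Rightarrow> 'a::comm_ring_1" where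
  "mat_app m n A x = (\<lambda>j. if j < m then (\<Sum>k<n. A j k * x k) else 0)"

definition mat_tapp :: "nat \<Rightarrow> nat \<Rightarrow> (nat \<Rightarrow> nat \<Rightarrow> 'a) \<Rightarrow> (nat \<Rightarrow> 'a) \<Rightarrow> nat \<Rightarrow> 'a::comm_ring_1" where
  "mat_tapp m n A y = (\<lambda>k. if k < n then (\<Sum>j<m. A j k * y j) else 0)"

(* ... \<rightarrow> R^(b 2) --d 2--> R^(b 1) --d 1--> R^(b 0) = R \<rightarrow> R/P \<rightarrow> 0 exact:
   a resolution of R/P by finitely generated free R-modules *)
definition free_res :: "'a::comm_ring_1 set \<Rightarrow> (nat \<Rightarrow> nat) \<Rightarrow> (nat \<Rightarrow> nat \<Rightarrow> nat \<Rightarrow> 'a) \<Rightarrow> bool" where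
  "free_res P b d \<longleftrightarrow> b 0 = 1 \<and>
     mat_app (b 0) (b 1) (d 1) ` vecs (b 1) = {x \<in> vecs 1. x 0 \<in> P} \<and>
     (\<forall>i\<ge>1. {x \<in> vecs (b i). mat_app (b (i - 1)) (b i) (d i) x = (\<lambda>_. 0)}
              = mat_app (b i) (b (Suc i)) (d (Suc i)) ` vecs (b (Suc i)))"

(* (Ext^i_R(R/P, R))_P = 0, computed as H^i(Hom_R(F,R)) localized at P;
   this is Ext^i_{R_P}(k(P), R_P) *)
definition ext_loc_zero :: "'a::comm_ring_1 set \<Rightarrow> (nat \<Rightarrow> nat) \<Rightarrow> (nat \<Rightarrow> nat \<Rightarrow> nat \<Rightarrow> 'a) \<Rightarrow> nat \<Rightarrow> bool" where
  "ext_loc_zero P b d i \<longleftrightarrow>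
     (\<forall>y \<in> vecs (b i). mat_tapp (b i) (b (Suc i)) (d (Suc i)) y = (\<lambda>_. 0) \<longrightarrow>
        (\<exists>s. s \<notin> P \<and> (\<lambda>j. s * y j) \<in>
            (if i = 0 then {\<lambda>_. 0} else mat_tapp (b (i - 1)) (b i) (d i) ` vecs (b (i - 1)))))"

(* R_P is Gorenstein: injdim R_P < \<infinity>, i.e. Ext^i_{R_P}(k(P),R_P) = 0 for i \<gg> 0 *)
definition gorenstein_at :: "'a::comm_ring_1 set \<Rightarrow> bool" where
  "gorenstein_at P \<longleftrightarrow> (\<exists>b d. free_res P b d \<and> (\<exists>n. \<forall>i>n. ext_loc_zero P b d i))"

definition cond_G1 :: "'a::comm_ring_1 itself \<Rightarrow> bool" where
  "cond_G1 _ \<longleftrightarrow> (\<forall>P :: 'a set. is_prime_ideal P \<and> height P \<le> 1 \<longrightarrow> gorenstein_at P)"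

definition cond_S2 :: "'a::comm_ring_1 itself \<Rightarrow> bool" where
  "cond_S2 _ \<longleftrightarrow> (\<forall>P :: 'a set. is_prime_ideal P \<longrightarrow> depth_loc P \<ge> min 2 (height P))"

definition fin_gen :: "('a::comm_ring_1 \<Rightarrow> 'm::ab_group_add \<Rightarrow> 'm) \<Rightarrow> 'm set \<Rightarrow> bool" where
  "fin_gen scale S \<longleftrightarrow> (\<exists>F. finite F \<and> F \<subseteq> S \<and> module.span scale F = S)"

definition presentation :: "('a::comm_ring_1 \<Rightarrow> 'm::ab_group_add \<Rightarrow> 'm) \<Rightarrow> 'm set \<Rightarrow> nat \<Rightarrow> (nat \<Rightarrow> 'm) \<Rightarrow> bool" where
  "presentation scale S n g \<longleftrightarrow> n > 0 \<and> (\<forall>i<n. g i \<in> S) \<and> module.span scale (g ` {..<n}) = S"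

definition relmod :: "('a::comm_ring_1 \<Rightarrow> 'm::ab_group_add \<Rightarrow> 'm) \<Rightarrow> nat \<Rightarrow> (nat \<Rightarrow> 'm) \<Rightarrow> (nat \<Rightarrow> 'a) set" where
  "relmod scale n g = {x \<in> vecs n. (\<Sum>i<n. scale (x i) (g i)) = 0}"

(* K-dual = Hom_R(K, R), functionals taken extensionally (0 outside K) *)
definition dual_on :: "(nat \<Rightarrow> 'a::comm_ring_1) set \<Rightarrow> ((nat \<Rightarrow> 'a) \<Rightarrow> 'a) set" where
  "dual_on K = {f. (\<forall>x\<in>K. \<forall>y\<in>K. f (\<lambda>j. x j + y j) = f x + f y) \<and>
                   (\<forall>r. \<forall>x\<in>K. f (\<lambda>j. r * x j) = r * f x) \<and> (\<forall>x. x \<notin> K \<longrightarrow> f x = 0)}"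

(* Hom_R(\<And>^n (K-dual), R) = alternating n-linear forms on K-dual (arguments in slots 0..n-1) *)
definition alt_forms :: "(nat \<Rightarrow> 'a::comm_ring_1) set \<Rightarrow> nat \<Rightarrow> ((nat \<Rightarrow> ((nat \<Rightarrow> 'a) \<Rightarrow> 'a)) \<Rightarrow> 'a) set" where
  "alt_forms K n = {\<Phi>.
     (\<forall>f g. (\<forall>i<n. f i = g i) \<longrightarrow> \<Phi> f = \<Phi> g) \<and>
     (\<forall>f i u v. (\<forall>j<n. f j \<in> dual_on K) \<and> i < n \<and> u \<in> dual_on K \<and> v \<in> dual_on K \<longrightarrow>
         \<Phi> (f(i := (\<lambda>x. u x + v x))) = \<Phi> (f(i := u)) + \<Phi> (f(i := v))) \<and>
     (\<forall>f i u r. (\<forall>j<n. f j \<in> dual_on K) \<and> i < n \<and> u \<in> dual_on K \<longrightarrow>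
         \<Phi> (f(i := (\<lambda>x. r * u x))) = r * \<Phi> (f(i := u))) \<and>
     (\<forall>f i j. (\<forall>k<n. f k \<in> dual_on K) \<and> i < n \<and> j < n \<and> i \<noteq> j \<and> f i = f j \<longrightarrow> \<Phi> f = 0)}"

(* image of \<Inter>^n N' \<rightarrow> \<Inter>^n R^n = R, the identification (\<And>^n dual of ext power of dual of R^n = R being
   evaluation at e_0^* \<and> ... \<and> e_(n-1)^*; restricting e_i^* to N' gives this formula *)
definition char_of_pres :: "('a::comm_ring_1 \<Rightarrow> 'm::ab_group_add \<Rightarrow> 'm) \<Rightarrow> nat \<Rightarrow> (nat \<Rightarrow> 'm) \<Rightarrow> 'a set" where
  "char_of_pres scale n g =
     (let K = relmod scale n g in
      {\<Phi> (\<lambda>i x. if x \<in> K then x i else 0) | \<Phi>. \<Phi> \<in> alt_forms K n})"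

(* char_R(S); independent of the chosen presentation *)
definition char_mod :: "('a::comm_ring_1 \<Rightarrow> 'm::ab_group_add \<Rightarrow> 'm) \<Rightarrow> 'm set \<Rightarrow> 'a set" where
  "char_mod scale S = (SOME I. \<exists>n g. presentation scale S n g \<and> I = char_of_pres scale n g)"

end

(* Adding the generators of M to those of N, it suffices to compare presentations that differ by one
   generator. A redundant generator is added by expanding along a relation that expresses it. For a new
   last generator with relation module K and K' = K \<inter> R^n, an alternating form \<Phi> on the dual of K is
   pushed to the dual of K' by f |-> \<Phi>(F, e_n), where F lifts a multiple r f to K: modulo K' the module K
   is an ideal L, so lifts exist for enough r because Ext^1(L, R) = Ext^2(R/L, R) vanishes at primes of
   height at most 1 (G1), they are unique up to multiples of e_n at minimal primes, and (S2) glues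
   the local values. At a height-one prime P the vanishing of Ext^i(R/I, R) is propagated from
   I = P and large i down to i = 2 using the embedding of R/P into R/xR, x regular. *)

theory Submission
  imports Defs
begin

section \<open>Submodules of finite free modules\<close>

text \<open>Restriction of functionals from K to K' need not be surjective, so \<Phi> cannot simply
  be evaluated on lifts. Only multiples r f lift, and since all n slots carry the same r, the value
  found is r^n times the wanted one. The form on K' is thus a compatible family of fractions
  \<Phi>(F)/r^n, and gluing is needed because no single r need be a unit. The failure of
  surjectivity sits in Ext^1(L, R); this is why R_P must behave like a ring of injective dimension
  at most 1. But \<open>gorenstein_at\<close> gives only the vanishing of Ext^i(R/P, R) at P for
  large i, so the bound has to be earned by dimension shifting. Localizations and quotient modules
  are not formed. A module is R^A modulo a submodule of functions supported in A, with A any finite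
  set of numbers, so that direct sums are disjoint unions. An assertion over R_P is one that holds
  after multiplication by some s outside P. Ext becomes an extension property of functionals on
  iterated relation modules, and its independence of the chosen generators is proved together with
  its long exact sequence.\<close>

definition vec_on :: "nat set \<Rightarrow> (nat \<Rightarrow> 'a::comm_ring_1) set" where
  "vec_on A = {x. \<forall>j. j \<notin> A \<longrightarrow> x j = 0}"

definition submod :: "(nat \<Rightarrow> 'a::comm_ring_1) set \<Rightarrow> bool" where
  "submod K \<longleftrightarrow> (\<lambda>_. 0) \<in> K \<and> (\<forall>r. \<forall>x\<in>K. \<forall>y\<in>K. (\<lambda>j. r * x j + y j) \<in> K)"

text \<open>Only values on K are constrained, unlike \<open>dual_on\<close>, which also demands 0
  outside K; functionals given by formulas then need no case distinction.\<close>

definition lin_on :: "(nat \<Rightarrow> 'a::comm_ring_1) set \<Rightarrow> ((nat \<Rightarrow> 'a) \<Rightarrow> 'a) \<Rightarrow> bool" where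
  "lin_on K f \<longleftrightarrow> (\<forall>r. \<forall>x\<in>K. \<forall>y\<in>K. f (\<lambda>j. r * x j + y j) = r * f x + f y)"

definition lc :: "nat set \<Rightarrow> (nat \<Rightarrow> 'a::comm_ring_1) \<Rightarrow> (nat \<Rightarrow> nat \<Rightarrow> 'a) \<Rightarrow> nat \<Rightarrow> 'a" where
  "lc C y h = (\<lambda>j. \<Sum>c\<in>C. y c * h c j)"

definition restr :: "nat set \<Rightarrow> (nat \<Rightarrow> 'a::comm_ring_1) \<Rightarrow> nat \<Rightarrow> 'a" where
  "restr B v = (\<lambda>j. if j \<in> B then v j else 0)"

definition gens :: "nat set \<Rightarrow> (nat \<Rightarrow> nat \<Rightarrow> 'a::comm_ring_1) \<Rightarrow> (nat \<Rightarrow> 'a) set \<Rightarrow> bool" where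
  "gens C h K \<longleftrightarrow> finite C \<and> (\<forall>c\<in>C. h c \<in> K) \<and> (\<forall>v\<in>K. \<exists>y. v = lc C y h)"

text \<open>The syzygy module: R^C modulo \<open>rel C h\<close> is isomorphic to the submodule
  generated by h.\<close>

definition rel :: "nat set \<Rightarrow> (nat \<Rightarrow> nat \<Rightarrow> 'a::comm_ring_1) \<Rightarrow> (nat \<Rightarrow> 'a) set" where
  "rel C h = {y \<in> vec_on C. lc C y h = (\<lambda>_. 0)}"

section \<open>Elementary rules for submodules, functionals and linear combinations\<close>

lemma submod_zero: "submod K \<Longrightarrow> (\<lambda>_. 0) \<in> K"
  by (simp add: submod_def)

lemma submod_comb: "submod K \<Longrightarrow> x \<in> K \<Longrightarrow> y \<in> K \<Longrightarrow> (\<lambda>j. r * x j + y j) \<in> K"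
  by (simp add: submod_def)

lemma submod_add: "submod K \<Longrightarrow> x \<in> K \<Longrightarrow> y \<in> K \<Longrightarrow> (\<lambda>j. x j + y j) \<in> K"
  using submod_comb[of K x y 1] by simp

lemma submod_diff: "submod K \<Longrightarrow> x \<in> K \<Longrightarrow> y \<in> K \<Longrightarrow> (\<lambda>j. x j - y j) \<in> K"
  using submod_comb[of K y x "-1"] by simp

lemma submod_scale: "submod K \<Longrightarrow> x \<in> K \<Longrightarrow> (\<lambda>j. r * x j) \<in> K"
  using submod_comb[of K x "\<lambda>_. 0" r] by (simp add: submod_zero)

lemma lin_comb: "lin_on K f \<Longrightarrow> x \<in> K \<Longrightarrow> y \<in> K \<Longrightarrow> f (\<lambda>j. r * x j + y j) = r * f x + f y"
  by (simp add: lin_on_def)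

lemma lin_add: "lin_on K f \<Longrightarrow> x \<in> K \<Longrightarrow> y \<in> K \<Longrightarrow> f (\<lambda>j. x j + y j) = f x + f y"
  using lin_comb[of K f x y 1] by simp

lemma lin_diff: "lin_on K f \<Longrightarrow> x \<in> K \<Longrightarrow> y \<in> K \<Longrightarrow> f (\<lambda>j. x j - y j) = f x - f y"
  using lin_comb[of K f y x "-1"] by simp

lemma lin_zero: "submod K \<Longrightarrow> lin_on K f \<Longrightarrow> f (\<lambda>_. 0) = 0"
  using lin_comb[of K f "\<lambda>_. 0" "\<lambda>_. 0" 1] by (simp add: submod_zero)

lemma lin_scale: "submod K \<Longrightarrow> lin_on K f \<Longrightarrow> x \<in> K \<Longrightarrow> f (\<lambda>j. r * x j) = r * f x"
  using lin_comb[of K f x "\<lambda>_. 0" r] by (simp add: submod_zero lin_zero)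

lemma lin_on_subset: "lin_on K f \<Longrightarrow> K' \<subseteq> K \<Longrightarrow> lin_on K' f"
  unfolding lin_on_def by blast

lemma submod_lc:
  assumes "submod K" "\<And>c. c \<in> C \<Longrightarrow> h c \<in> K"
  shows "lc C y h \<in> K"
proof (cases "finite C")
  case True
  then show ?thesis using assms(2)
  proof (induction C)
    case (insert c C)
    then have "lc (insert c C) y h = (\<lambda>j. y c * h c j + lc C y h j)"
      by (simp add: lc_def)
    then show ?case using insert assms(1) by (auto intro: submod_comb)
  qed (use assms(1) in \<open>simp add: lc_def submod_zero\<close>)
qed (use assms(1) in \<open>simp add: lc_def submod_zero\<close>)

lemma lin_lc:
  assumes "submod K" "lin_on K f" "\<And>c. c \<in> C \<Longrightarrow> h c \<in> K"
  shows "f (lc C y h) = (\<Sum>c\<in>C. y c * f (h c))"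
proof (cases "finite C")
  case True
  then show ?thesis using assms(3)
  proof (induction C)
    case (insert c C)
    then have "lc (insert c C) y h = (\<lambda>j. y c * h c j + lc C y h j)"
      by (simp add: lc_def)
    moreover have "lc C y h \<in> K"
      using insert by (intro submod_lc[OF assms(1)]) auto
    ultimately show ?case using insert by (simp add: lin_comb[OF assms(2)])
  qed (use assms in \<open>simp add: lc_def lin_zero\<close>)
qed (use assms in \<open>simp add: lc_def lin_zero\<close>)

lemma lc_restr: "finite C \<Longrightarrow> lc C (restr C y) h = lc C y h"
  by (auto simp: lc_def restr_def intro!: sum.cong)

lemma restr_vec: "restr B v \<in> vec_on B"
  by (simp add: restr_def vec_on_def)

lemma restr_id: "v \<in> vec_on B \<Longrightarrow> restr B v = v"
  by (auto simp: restr_def vec_on_def)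

lemma restr_comb: "restr B (\<lambda>j. r * x j + y j) = (\<lambda>j. r * restr B x j + restr B y j)"
  by (auto simp: restr_def)

lemma restr_lc: "restr B (lc C y h) = lc C y (\<lambda>c. restr B (h c))"
  by (auto simp: restr_def lc_def fun_eq_iff)

lemma lc_comb: "lc C (\<lambda>j. r * x j + y j) h = (\<lambda>j. r * lc C x h j + lc C y h j)"
  by (simp add: lc_def sum_distrib_left sum.distrib algebra_simps)

lemma lc_cong: "(\<And>c. c \<in> C \<Longrightarrow> y c = y' c) \<Longrightarrow> (\<And>c. c \<in> C \<Longrightarrow> h c = h' c) \<Longrightarrow> lc C y h = lc C y' h'"
  by (auto simp: lc_def intro!: sum.cong)

lemma lc_Un: "finite A \<Longrightarrow> finite B \<Longrightarrow> A \<inter> B = {} \<Longrightarrow>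
    lc (A \<union> B) y h = (\<lambda>j. lc A y h j + lc B y h j)"
  by (simp add: lc_def sum.union_disjoint)

lemma submod_vec: "submod (vec_on A)"
  by (simp add: submod_def vec_on_def)

lemma submod_Int: "submod K \<Longrightarrow> submod K' \<Longrightarrow> submod (K \<inter> K')"
  by (simp add: submod_def)

lemma submod_rel: "submod (rel C h)"
proof -
  have "lc C (\<lambda>_. 0) h = (\<lambda>_. 0)"
    by (simp add: lc_def)
  then show ?thesis
    by (simp add: rel_def submod_def lc_comb) (simp add: vec_on_def)
qed

lemma submod_restr_image: "submod K \<Longrightarrow> submod (restr B ` K)"
  unfolding submod_def
proof safe
  assume "(\<lambda>_. 0) \<in> K"
  moreover have "(\<lambda>_. 0) = restr B (\<lambda>_. 0)"
    by (simp add: restr_def)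
  ultimately show "(\<lambda>_. 0) \<in> restr B ` K"
    by blast
qed (simp add: restr_comb[symmetric])

lemma gens_vec:
  assumes "gens C h K" "v \<in> K"
  obtains y where "y \<in> vec_on C" "v = lc C y h"
  using assms lc_restr restr_vec unfolding gens_def by metis

lemma gens_in: "gens C h K \<Longrightarrow> c \<in> C \<Longrightarrow> h c \<in> K"
  by (simp add: gens_def)

lemma gens_finite: "gens C h K \<Longrightarrow> finite C"
  by (simp add: gens_def)

text \<open>Translating the index set beyond a bound of D makes two generating families disjoint, so
  that the sum of their free modules is again some R^E.\<close>

lemma gens_copy:
  assumes "gens C h K" "finite D"
  obtains C' h' where "gens C' h' K" "C' \<inter> D = {}"
proof -
  obtain m where m: "\<forall>d\<in>D. d < m"
    using assms(2) finite_nat_set_iff_bounded by blast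
  have "lc ((+) m ` C) (\<lambda>i. y (i - m)) (\<lambda>i. h (i - m)) = lc C y h" for y
    by (simp add: lc_def sum.reindex)
  then have "gens ((+) m ` C) (\<lambda>i. h (i - m)) K"
    using assms(1) unfolding gens_def by (auto; metis)
  moreover have "(+) m ` C \<inter> D = {}"
    using m by fastforce
  ultimately show ?thesis using that by blast
qed

text \<open>For \<open>Y \<subseteq> R\<^sup>A \<oplus> R\<^sup>B\<close> the modules \<open>Y \<inter> R\<^sup>A\<close> and \<open>restr B ` Y\<close> are the kernels of the
  presentations in an exact sequence of quotients \<open>0 \<rightarrow> R\<^sup>A/(Y \<inter> R\<^sup>A) \<rightarrow> R\<^sup>A\<^sup>\<union>\<^sup>B/Y \<rightarrow> R\<^sup>B/restr B ` Y \<rightarrow> 0\<close>;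
  this shape is stable under passing to syzygies.\<close>
locale split_pres =
  fixes A B :: "nat set" and Y :: "(nat \<Rightarrow> 'a::comm_ring_1) set"
  assumes finA: "finite A" and finB: "finite B" and disj: "A \<inter> B = {}"
    and subY: "submod Y" and Yvec: "Y \<subseteq> vec_on (A \<union> B)"
begin

lemma subX: "submod (Y \<inter> vec_on A)"
  by (simp add: subY submod_Int submod_vec)

lemma restr_eq_imp_diff:
  assumes "v \<in> Y" "w \<in> Y" "restr B v = restr B w"
  shows "(\<lambda>j. v j - w j) \<in> Y \<inter> vec_on A"
proof -
  have "v j - w j = 0" if "j \<notin> A" for j
  proof (cases "j \<in> B")
    case True
    then show ?thesis using fun_cong[OF assms(3), of j] by (simp add: restr_def)
  next
    case False
    then have "u j = 0" if "u \<in> Y" for u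
      using that \<open>j \<notin> A\<close> Yvec by (force simp: vec_on_def)
    from this[OF assms(1)] this[OF assms(2)] show ?thesis by simp
  qed
  then show ?thesis using submod_diff[OF subY assms(1,2)] by (simp add: vec_on_def)
qed

lemma restr_X: "v \<in> Y \<inter> vec_on A \<Longrightarrow> restr B v = (\<lambda>_. 0)"
  using disj by (auto simp: restr_def vec_on_def fun_eq_iff)

text \<open>The kernel of \<open>restr B\<close> on Y is Y \<inter> R^A, so the value of F at any
  chosen preimage is well defined on the image.\<close>

lemma lin_factor:
  assumes F: "lin_on Y F" and zero: "\<And>v. v \<in> Y \<inter> vec_on A \<Longrightarrow> F v = 0"
  shows "\<exists>G. lin_on (restr B ` Y) G \<and> (\<forall>v\<in>Y. G (restr B v) = F v)"
proof -
  have F_eq: "F v = F w" if "v \<in> Y" "w \<in> Y" "restr B v = restr B w" for v w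
    using zero[OF restr_eq_imp_diff[OF that]] lin_diff[OF F that(1,2)] by simp
  define pre where "pre w = (SOME v. v \<in> Y \<and> restr B v = w)" for w
  have pre: "F (pre (restr B v)) = F v" if "v \<in> Y" for v
  proof -
    have "pre (restr B v) \<in> Y \<and> restr B (pre (restr B v)) = restr B v"
      unfolding pre_def by (rule someI[of _ v]) (use that in simp)
    then show ?thesis using F_eq that by blast
  qed
  have "lin_on (restr B ` Y) (\<lambda>w. F (pre w))"
    unfolding lin_on_def
  proof (intro allI ballI)
    fix r x z assume "x \<in> restr B ` Y" "z \<in> restr B ` Y"
    then obtain v w where v: "v \<in> Y" "x = restr B v" and w: "w \<in> Y" "z = restr B w"
      by blast
    have "F (pre (restr B (\<lambda>j. r * v j + w j))) = r * F v + F w"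
      using pre[OF submod_comb[OF subY v(1) w(1)]] lin_comb[OF F v(1) w(1)] by simp
    then show "F (pre (\<lambda>j. r * x j + z j)) = r * F (pre x) + F (pre z)"
      using v w by (simp add: restr_comb pre)
  qed
  then show ?thesis using pre by (intro exI[of _ "\<lambda>w. F (pre w)"]) simp
qed

text \<open>Generators of the quotient part are lifted to Y and joined with those of the sub part.
  Their relation modules are again in the position of \<open>split_pres\<close>, which permits
  induction on the degree of Ext.\<close>

lemma horseshoe:
  assumes g1: "gens C h (Y \<inter> vec_on A)" and g2: "gens D k (restr B ` Y)" and cd: "C \<inter> D = {}"
  obtains hh where "gens (C \<union> D) hh Y" "split_pres C D (rel (C \<union> D) hh)"
    "rel (C \<union> D) hh \<inter> vec_on C = rel C h" "restr D ` rel (C \<union> D) hh = rel D k"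
proof -
  have "\<forall>c\<in>D. \<exists>v. v \<in> Y \<and> k c = restr B v"
    using g2 unfolding gens_def by blast
  then obtain k' where k': "\<And>c. c \<in> D \<Longrightarrow> k' c \<in> Y" "\<And>c. c \<in> D \<Longrightarrow> restr B (k' c) = k c"
    by metis
  define hh where "hh c = (if c \<in> C then h c else k' c)" for c
  have fin: "finite C" "finite D" using g1 g2 by (auto simp: gens_def)
  have lcC: "lc C y hh = lc C y h" for y
    by (auto simp: hh_def intro: lc_cong)
  have lcD: "lc D y hh = lc D y k'" for y
    using cd by (auto simp: hh_def intro!: lc_cong)
  have lcCD: "lc (C \<union> D) y hh = (\<lambda>j. lc C y h j + lc D y k' j)" for y
    using lc_Un[OF fin cd, of y hh] by (simp add: lcC lcD)
  have hX: "lc C y h \<in> Y \<inter> vec_on A" for y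
    using g1 by (intro submod_lc[OF subX]) (auto simp: gens_def)
  have kY: "lc D y k' \<in> Y" for y
    using k' by (intro submod_lc[OF subY]) auto
  have rk: "restr B (lc D y k') = lc D y k" for y
    using k' by (auto simp: restr_lc intro: lc_cong)
  have g: "gens (C \<union> D) hh Y"
    unfolding gens_def
  proof (intro conjI ballI)
    fix v assume v: "v \<in> Y"
    then obtain y where y: "restr B v = lc D y k"
      using g2 unfolding gens_def by blast
    then have "(\<lambda>j. v j - lc D y k' j) \<in> Y \<inter> vec_on A"
      using v kY rk by (intro restr_eq_imp_diff) auto
    then obtain z where z: "(\<lambda>j. v j - lc D y k' j) = lc C z h"
      using g1 unfolding gens_def by blast
    define w where "w c = (if c \<in> C then z c else y c)" for c
    have "lc C w h = lc C z h"
      by (auto simp: w_def intro: lc_cong)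
    moreover have "lc D w k' = lc D y k'"
      using cd by (auto simp: w_def intro!: lc_cong)
    ultimately have "lc (C \<union> D) w hh = v"
      using z by (simp add: lcCD fun_eq_iff) (metis diff_add_cancel)
    then show "\<exists>y. v = lc (C \<union> D) y hh" by blast
  next
    fix c assume "c \<in> C \<union> D"
    then show "hh c \<in> Y" using g1 k' by (auto simp: hh_def gens_def)
  qed (use fin in auto)
  have sp: "split_pres C D (rel (C \<union> D) hh)"
  proof
    show "rel (C \<union> D) hh \<subseteq> vec_on (C \<union> D)" unfolding rel_def by blast
  qed (use fin cd submod_rel in simp_all)
  have lc0: "lc D y k' = (\<lambda>_. 0)" if "y \<in> vec_on C" for y
    using that cd by (auto simp: lc_def vec_on_def fun_eq_iff intro!: sum.neutral)
  have "rel (C \<union> D) hh \<inter> vec_on C = rel C h"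
    using lc0 by (auto simp: rel_def lcCD vec_on_def)
  moreover have "restr D ` rel (C \<union> D) hh = rel D k"
  proof
    show "restr D ` rel (C \<union> D) hh \<subseteq> rel D k"
    proof
      fix u assume "u \<in> restr D ` rel (C \<union> D) hh"
      then obtain y where y: "y \<in> rel (C \<union> D) hh" "u = restr D y" by blast
      then have "(\<lambda>j. lc C y h j + lc D y k' j) = (\<lambda>_. 0)"
        by (simp add: rel_def lcCD)
      then have "lc D y k' = (\<lambda>j. 0 - lc C y h j)"
        by (simp add: fun_eq_iff) (metis add_eq_0_iff)
      then have "lc D y k' \<in> Y \<inter> vec_on A"
        using submod_diff[OF subX submod_zero[OF subX] hX[of y]] by simp
      then have "lc D y k = (\<lambda>_. 0)"
        using restr_X rk by metis
      then show "u \<in> rel D k"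
        using y fin by (simp add: rel_def restr_vec lc_restr)
    qed
  next
    show "rel D k \<subseteq> restr D ` rel (C \<union> D) hh"
    proof
      fix u assume u: "u \<in> rel D k"
      then have "restr B (lc D u k') = restr B (\<lambda>_. 0)"
        by (simp add: rk rel_def) (simp add: restr_def fun_eq_iff)
      then have "(\<lambda>j. 0 - lc D u k' j) \<in> Y \<inter> vec_on A"
        using kY submod_zero[OF subY] by (intro restr_eq_imp_diff) auto
      then obtain z where z: "z \<in> vec_on C" "(\<lambda>j. 0 - lc D u k' j) = lc C z h"
        using gens_vec[OF g1] by metis
      \<comment> \<open>The lifted combination of u lies in the sub part up to sign; z writes its
        negative in the generators h, so z and u together form a relation lifting u.\<close>
      define w where "w c = (if c \<in> C then z c else u c)" for c
      have "lc C w h = lc C z h"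
        by (auto simp: w_def intro: lc_cong)
      moreover have "lc D w k' = lc D u k'"
        using cd by (auto simp: w_def intro!: lc_cong)
      ultimately have "lc (C \<union> D) w hh = (\<lambda>_. 0)"
        using z(2) by (simp add: lcCD fun_eq_iff) (metis add.left_neutral diff_add_cancel minus_add_cancel diff_0)
      moreover have "w \<in> vec_on (C \<union> D)"
        using z u by (auto simp: w_def vec_on_def rel_def)
      moreover have "restr D w = u"
        using u cd by (auto simp: w_def restr_def vec_on_def rel_def fun_eq_iff)
      ultimately show "u \<in> restr D ` rel (C \<union> D) hh"
        by (auto simp: rel_def)
    qed
  qed
  ultimately show ?thesis using that[OF g sp] by blast
qed

end

section \<open>Noetherian rings\<close>

text \<open>A set without maximal member would yield a strictly ascending chain by iterating a
  choice of larger members.\<close>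

lemma ideal_maximal:
  fixes \<C> :: "'a::comm_ring_1 set set"
  assumes noeth: "noetherian_ring TYPE('a)" and I0: "I\<^sub>0 \<in> \<C>" and ideals: "\<And>I. I \<in> \<C> \<Longrightarrow> is_ideal I"
  obtains I where "I \<in> \<C>" "\<And>J. J \<in> \<C> \<Longrightarrow> I \<subseteq> J \<Longrightarrow> J = I"
proof (rule ccontr)
  assume "\<not> thesis"
  then have "\<forall>I\<in>\<C>. \<exists>J. J \<in> \<C> \<and> I \<subset> J"
    using that by blast
  then obtain nx where nx: "\<And>I. I \<in> \<C> \<Longrightarrow> nx I \<in> \<C> \<and> I \<subset> nx I"
    by metis
  define F where "F k = (nx ^^ k) I\<^sub>0" for k
  have F: "F k \<in> \<C>" for k
    by (induction k) (use nx I0 in \<open>auto simp: F_def\<close>)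
  have "F k \<subset> F (Suc k)" for k
    using nx[OF F[of k]] by (simp add: F_def)
  then show False
    using noeth F ideals unfolding noetherian_ring_def by blast
qed

lemma is_ideal_sum:
  "is_ideal I \<Longrightarrow> (\<And>c. c \<in> C \<Longrightarrow> h c \<in> I) \<Longrightarrow> (\<Sum>c\<in>C. y c * h c) \<in> I"
  by (induction C rule: infinite_finite_induct) (auto simp: is_ideal_def)

lemma ideal_diff: "is_ideal I \<Longrightarrow> x \<in> I \<Longrightarrow> y \<in> I \<Longrightarrow> x - y \<in> I"
  unfolding is_ideal_def by (metis add_uminus_conv_diff mult_minus1)

lemma ideal_gen_ideal: "is_ideal (ideal_gen x i)"
  unfolding is_ideal_def
proof (intro conjI ballI allI)
  show "0 \<in> ideal_gen x i"
    unfolding ideal_gen_def by (auto intro!: exI[of _ "\<lambda>_. 0"])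
next
  fix a b assume "a \<in> ideal_gen x i" "b \<in> ideal_gen x i"
  then obtain r s where "a = (\<Sum>j<i. r j * x j)" "b = (\<Sum>j<i. s j * x j)"
    unfolding ideal_gen_def by blast
  then show "a + b \<in> ideal_gen x i"
    unfolding ideal_gen_def
    by (auto intro!: exI[of _ "\<lambda>j. r j + s j"] simp: sum.distrib algebra_simps)
next
  fix c a assume "a \<in> ideal_gen x i"
  then obtain r where "a = (\<Sum>j<i. r j * x j)"
    unfolding ideal_gen_def by blast
  then show "c * a \<in> ideal_gen x i"
    unfolding ideal_gen_def
    by (auto intro!: exI[of _ "\<lambda>j. c * r j"] simp: sum_distrib_left algebra_simps)
qed

text \<open>A maximal member among the ideals generated by finitely many elements of I must be I,
  since any missing element could be adjoined.\<close>

lemma ideal_fin_gen: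
  fixes I :: "'a::comm_ring_1 set"
  assumes noeth: "noetherian_ring TYPE('a)" and I: "is_ideal I"
  obtains n :: nat and h where "I = ideal_gen h n" "\<And>c. c < n \<Longrightarrow> h c \<in> I"
proof -
  define \<C> where "\<C> = {ideal_gen h n | h n. \<forall>c<n. h c \<in> I}"
  have "ideal_gen (\<lambda>_. 0) 0 \<in> \<C>" unfolding \<C>_def by blast
  moreover have "\<And>J. J \<in> \<C> \<Longrightarrow> is_ideal J" unfolding \<C>_def by (auto simp: ideal_gen_ideal)
  ultimately obtain J where J: "J \<in> \<C>" and mx: "\<And>J'. J' \<in> \<C> \<Longrightarrow> J \<subseteq> J' \<Longrightarrow> J' = J"
    using ideal_maximal[OF noeth] by blast
  obtain h n where h: "J = ideal_gen h n" "\<forall>c<n. h c \<in> I" using J unfolding \<C>_def by blast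
  have "J \<subseteq> I" unfolding h ideal_gen_def using h(2) by (auto intro!: is_ideal_sum[OF I])
  moreover have "a \<in> J" if a: "a \<in> I" for a
  proof -
    define h' where "h' = h(n := a)"
    have "ideal_gen h' (Suc n) \<in> \<C>"
      unfolding \<C>_def
      by (rule CollectI, intro exI[of _ h'] exI[of _ "Suc n"]) (use h(2) a in \<open>auto simp: h'_def less_Suc_eq\<close>)
    moreover have "J \<subseteq> ideal_gen h' (Suc n)"
    proof
      fix b assume "b \<in> J"
      then obtain r where r: "b = (\<Sum>j<n. r j * h j)" unfolding h ideal_gen_def by blast
      then have "b = (\<Sum>j<Suc n. (r(n := 0)) j * h' j)"
        by (auto simp: h'_def intro!: sum.cong)
      then show "b \<in> ideal_gen h' (Suc n)" unfolding ideal_gen_def by blast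
    qed
    ultimately have "ideal_gen h' (Suc n) = J" using mx by blast
    moreover define e :: "nat \<Rightarrow> 'a" where "e j = (if j = n then 1 else 0)" for j
    have "a = (\<Sum>j<Suc n. e j * h' j)"
      by (simp add: h'_def e_def)
    then have "a \<in> ideal_gen h' (Suc n)" unfolding ideal_gen_def by blast
    ultimately show ?thesis by simp
  qed
  ultimately have "I = J" by blast
  then show ?thesis using that h by metis
qed

lemma submod_coord_ideal:
  assumes "submod K" shows "is_ideal ((\<lambda>v. v i) ` K)"
  unfolding is_ideal_def
proof (intro conjI ballI allI)
  show "0 \<in> (\<lambda>v. v i) ` K" using submod_zero[OF assms] by force
next
  fix a b assume "a \<in> (\<lambda>v. v i) ` K" "b \<in> (\<lambda>v. v i) ` K"
  then obtain x y where "x \<in> K" "y \<in> K" "a = x i" "b = y i" by blast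
  then show "a + b \<in> (\<lambda>v. v i) ` K" using submod_add[OF assms, of x y] by force
next
  fix r a assume "a \<in> (\<lambda>v. v i) ` K"
  then obtain x where "x \<in> K" "a = x i" by blast
  then show "r * a \<in> (\<lambda>v. v i) ` K" using submod_scale[OF assms, of x r] by force
qed

text \<open>Induction on the rank: the last coordinates of K form an ideal, the rest lies in a
  smaller free module, and \<open>horseshoe\<close> joins the two generating families.\<close>

lemma submod_fin_gen:
  fixes K :: "(nat \<Rightarrow> 'a::comm_ring_1) set"
  assumes noeth: "noetherian_ring TYPE('a)" and "finite A" "submod K" "K \<subseteq> vec_on A"
  shows "\<exists>C h. gens C h K"
  using assms(2-)
proof (induction A arbitrary: K)
  case empty
  then have "K = {\<lambda>_. 0}" by (auto simp: vec_on_def submod_def)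
  then have "gens {} (\<lambda>_ _. 0) K" by (simp add: gens_def lc_def)
  then show ?case by blast
next
  case (insert a A)
  interpret split_pres A "{a}" K
    by unfold_locales (use insert in auto)
  obtain C h where g1: "gens C h (K \<inter> vec_on A)"
    using insert.IH[of "K \<inter> vec_on A"] subX by auto
  obtain n g where g: "(\<lambda>v. v a) ` K = ideal_gen g n" "\<And>c. c < n \<Longrightarrow> g c \<in> (\<lambda>v. v a) ` K"
    using ideal_fin_gen[OF noeth submod_coord_ideal[OF insert.prems(1), of a]] by metis
  have gc: "(\<lambda>j. if j = a then g c else 0) \<in> restr {a} ` K" if c: "c < n" for c
  proof -
    obtain v where "v \<in> K" "g c = v a" using g(2)[OF c] unfolding image_iff by (elim bexE) (rule that)
    then have "(\<lambda>j. if j = a then g c else 0) = restr {a} v" unfolding restr_def by force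
    then show ?thesis using \<open>v \<in> K\<close> by blast
  qed
  have "gens {..<n} (\<lambda>c j. if j = a then g c else 0) (restr {a} ` K)"
    unfolding gens_def
  proof (intro conjI ballI)
    fix w assume "w \<in> restr {a} ` K"
    then obtain v where v: "v \<in> K" "w = restr {a} v" by blast
    then obtain r where "v a = (\<Sum>j<n. r j * g j)" using g(1) unfolding ideal_gen_def by blast
    then have "w = lc {..<n} r (\<lambda>c j. if j = a then g c else 0)"
      using v by (auto simp: restr_def lc_def fun_eq_iff)
    then show "\<exists>y. w = lc {..<n} y (\<lambda>c j. if j = a then g c else 0)" by blast
  qed (use gc in auto)
  then obtain D k where g2: "gens D k (restr {a} ` K)" "D \<inter> C = {}"
    using gens_copy[OF _ gens_finite[OF g1]] by metis
  then have "C \<inter> D = {}" by blast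
  then obtain hh where "gens (C \<union> D) hh K" using horseshoe[OF g1 g2(1)] by metis
  then show ?case by blast
qed

section \<open>Local vanishing of Ext\<close>

text \<open>\<open>ext_van P i A K\<close> says that \<open>Ext\<^sup>i\<^sup>+\<^sup>1(R\<^sup>A/K, R)\<close> vanishes after localization at \<open>P\<close>, computed by
  iterated syzygies.\<close>
fun ext_van :: "'a::comm_ring_1 set \<Rightarrow> nat \<Rightarrow> nat set \<Rightarrow> (nat \<Rightarrow> 'a) set \<Rightarrow> bool" where
  "ext_van P 0 A K \<longleftrightarrow>
     (\<forall>f. lin_on K f \<longrightarrow> (\<exists>s c. s \<notin> P \<and> (\<forall>v\<in>K. s * f v = (\<Sum>a\<in>A. c a * v a))))"
| "ext_van P (Suc i) A K \<longleftrightarrow> (\<exists>C h. gens C h K \<and> ext_van P i C (rel C h))"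

section \<open>Composition of linear maps between finite free modules\<close>

lemma lc_lc: "lc C (lc A x \<beta>) h = lc A x (\<lambda>a. lc C (\<beta> a) h)"
proof
  fix j
  have "lc C (lc A x \<beta>) h j = (\<Sum>c\<in>C. \<Sum>a\<in>A. x a * (\<beta> a c * h c j))"
    by (simp add: lc_def sum_distrib_right mult.assoc)
  also have "\<dots> = lc A x (\<lambda>a. lc C (\<beta> a) h) j"
    by (subst sum.swap) (simp add: lc_def sum_distrib_left)
  finally show "lc C (lc A x \<beta>) h j = lc A x (\<lambda>a. lc C (\<beta> a) h) j" .
qed

definition unit_vec :: "nat \<Rightarrow> nat \<Rightarrow> 'a::comm_ring_1" where
  "unit_vec a = (\<lambda>j. if j = a then 1 else 0)"

lemma lc_unit:
  assumes "finite A" "v \<in> vec_on A"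
  shows "lc A v (\<lambda>a j. s * unit_vec a j) = (\<lambda>j. s * v j)"
proof
  fix j
  have "lc A v (\<lambda>a j. s * unit_vec a j) j = (\<Sum>a\<in>A. if j = a then s * v a else 0)"
    unfolding lc_def by (intro sum.cong) (auto simp: unit_vec_def)
  then show "lc A v (\<lambda>a j. s * unit_vec a j) j = s * v j"
    using assms by (auto simp: vec_on_def)
qed

lemma lc_diff_right: "lc C y (\<lambda>c j. h c j - k c j) = (\<lambda>j. lc C y h j - lc C y k j)"
  by (simp add: lc_def algebra_simps sum_subtractf)

lemma lc_diff_left: "lc C (\<lambda>j. x j - y j) h = (\<lambda>j. lc C x h j - lc C y h j)"
  by (simp add: lc_def algebra_simps sum_subtractf)

lemma lc_scale_left: "lc C (\<lambda>j. r * y j) h = (\<lambda>j. r * lc C y h j)"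
  by (simp add: lc_def sum_distrib_left mult.assoc)

locale prime_loc =
  fixes P :: "'a::comm_ring_1 set"
  assumes noeth: "noetherian_ring TYPE('a)" and prime: "is_prime_ideal P"
begin

lemma P_ideal: "is_ideal P"
  using prime by (simp add: is_prime_ideal_def)

lemma one_notin: "1 \<notin> P"
  using prime unfolding is_prime_ideal_def is_ideal_def
  by (metis UNIV_eq_I mult.right_neutral)

lemma notin_mult: "s \<notin> P \<Longrightarrow> t \<notin> P \<Longrightarrow> s * t \<notin> P"
  using prime unfolding is_prime_ideal_def by blast

lemma in_mult_left: "s \<in> P \<Longrightarrow> r * s \<in> P"
  using P_ideal by (simp add: is_ideal_def)

lemma notin_prod: "finite A \<Longrightarrow> (\<And>a. a \<in> A \<Longrightarrow> s a \<notin> P) \<Longrightarrow> prod s A \<notin> P"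
  by (induction A rule: finite_induct) (auto simp: one_notin notin_mult)

text \<open>The hypotheses say that \<open>s\<close> times the identity of \<open>R\<^sup>A/K\<close> factors through the free module \<open>R\<^sup>A\<close>;
  this passes to the syzygy \<open>K\<close>.\<close>
lemma ext_van_proj:
  assumes "finite A" "submod K" "K \<subseteq> vec_on A" and "s \<notin> P"
    and "\<And>v. v \<in> K \<Longrightarrow> lc A v m = (\<lambda>_. 0)"
    and "\<And>a. a \<in> A \<Longrightarrow> (\<lambda>j. s * unit_vec a j - m a j) \<in> K"
  shows "ext_van P i A K"
  using assms
proof (induction i arbitrary: A K m)
  case (0 A K m)
  define b where "b a = (\<lambda>j. s * unit_vec a j - m a j)" for a
  show ?case
    unfolding ext_van.simps
  proof (intro allI impI exI[of _ s] exI conjI ballI)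
    fix f v assume f: "lin_on K f" and v: "v \<in> K"
    have "lc A v b = (\<lambda>j. s * v j)"
      using 0 v unfolding b_def lc_diff_right by (subst lc_unit) auto
    then have "s * f v = f (lc A v b)"
      using lin_scale[OF \<open>submod K\<close> f v] by simp
    also have "\<dots> = (\<Sum>a\<in>A. v a * f (b a))"
      using 0 by (intro lin_lc[OF \<open>submod K\<close> f]) (auto simp: b_def)
    finally show "s * f v = (\<Sum>a\<in>A. f (b a) * v a)"
      by (simp add: mult.commute)
  qed (use 0 in auto)
next
  case (Suc i A K m)
  obtain C h where g: "gens C h K"
    using submod_fin_gen[OF noeth] Suc.prems by blast
  define b where "b a = (\<lambda>j. s * unit_vec a j - m a j)" for a
  have lcb: "lc A v b = (\<lambda>j. s * v j)" if "v \<in> K" for v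
    using Suc.prems that unfolding b_def lc_diff_right by (subst lc_unit) auto
  have "\<forall>a\<in>A. \<exists>y. y \<in> vec_on C \<and> b a = lc C y h"
    using Suc.prems(6) gens_vec[OF g] unfolding b_def by metis
  then obtain \<beta> where \<beta>: "\<And>a. a \<in> A \<Longrightarrow> \<beta> a \<in> vec_on C" "\<And>a. a \<in> A \<Longrightarrow> b a = lc C (\<beta> a) h"
    by metis
  \<comment> \<open>The endomorphism of R^C that maps to K by h and returns by \<beta>. As b is
    multiplication by s on K, composing it with h gives s h.\<close>
  define m' where "m' c = lc A (h c) \<beta>" for c
  have m': "lc C y m' = lc A (lc C y h) \<beta>" for y
    unfolding m'_def by (rule lc_lc[symmetric])
  have m'': "lc C (lc C y m') h = (\<lambda>j. s * lc C y h j)" for y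
  proof -
    have "lc C (lc C y m') h = lc A (lc C y h) (\<lambda>a. lc C (\<beta> a) h)"
      unfolding m' by (rule lc_lc)
    also have "\<dots> = lc A (lc C y h) b"
      by (rule lc_cong) (simp_all add: \<beta>)
    finally show ?thesis
      using lcb submod_lc[OF \<open>submod K\<close>] gens_in[OF g] by metis
  qed
  have m'vec: "m' c \<in> vec_on C" for c
    unfolding m'_def by (intro submod_lc submod_vec \<beta>)
  have "ext_van P i C (rel C h)"
  proof (rule Suc.IH[OF gens_finite[OF g] submod_rel _ \<open>s \<notin> P\<close>])
    show "rel C h \<subseteq> vec_on C" by (auto simp: rel_def)
    show "lc C v m' = (\<lambda>_. 0)" if "v \<in> rel C h" for v
      using that unfolding m' by (simp add: rel_def) (simp add: lc_def)
    show "(\<lambda>j. s * unit_vec c j - m' c j) \<in> rel C h" if c: "c \<in> C" for c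
    proof -
      have u: "unit_vec c \<in> vec_on C" using c by (simp add: vec_on_def unit_vec_def)
      have "lc C (unit_vec c) m' = m' c"
      proof
        fix j
        have "lc C (unit_vec c) m' j = (\<Sum>a\<in>C. if c = a then m' a j else 0)"
          unfolding lc_def unit_vec_def by (intro sum.cong) auto
        then show "lc C (unit_vec c) m' j = m' c j"
          using c gens_finite[OF g] by simp
      qed
      then have "lc C (\<lambda>j. s * unit_vec c j - m' c j) h = (\<lambda>_. 0)"
        using m''[of "unit_vec c"] by (simp add: lc_diff_left lc_scale_left)
      moreover have "(\<lambda>j. s * unit_vec c j - m' c j) \<in> vec_on C"
        using submod_scale[OF submod_vec u] m'vec by (intro submod_diff[OF submod_vec]) auto
      ultimately show ?thesis by (simp add: rel_def)
    qed
  qed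
  then show ?case using g by auto
qed

text \<open>The quotient is R^A itself, so its identity factors and s = 1 serves.\<close>

lemma ext_van_free: "finite A \<Longrightarrow> ext_van P i A {\<lambda>_. 0}"
  by (rule ext_van_proj[where s = 1 and m = unit_vec])
    (auto simp: submod_def vec_on_def one_notin lc_def)

text \<open>Here s annihilates R^A/K, so s times the identity factors through m = 0.\<close>

lemma ext_van_killed:
  assumes "finite A" "submod K" "K \<subseteq> vec_on A" "s \<notin> P" "\<And>v. v \<in> vec_on A \<Longrightarrow> (\<lambda>j. s * v j) \<in> K"
  shows "ext_van P i A K"
  by (rule ext_van_proj[where s = s and m = "\<lambda>_ _. 0"])
    (use assms in \<open>auto simp: lc_def unit_vec_def vec_on_def\<close>)

lemma ext_van_vec: "finite A \<Longrightarrow> ext_van P i A (vec_on A)"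
  by (rule ext_van_killed[where s = 1]) (auto simp: submod_vec one_notin)

text \<open>Locally K is 0 and R^A/K is free: multiplication by s on R^A kills K, hence factors the
  map s on the quotient.\<close>

lemma ext_van_null:
  assumes "finite A" "submod K" "K \<subseteq> vec_on A" "s \<notin> P" "\<And>v. v \<in> K \<Longrightarrow> (\<lambda>j. s * v j) = (\<lambda>_. 0)"
  shows "ext_van P i A K"
  by (rule ext_van_proj[where s = s and m = "\<lambda>a j. s * unit_vec a j"])
    (use assms in \<open>auto simp: lc_unit subset_iff submod_zero\<close>)

lemma extend_functional:
  assumes sp: "split_pres A B Y" and g: "gens C k (restr B ` Y)"
    and ext: "ext_van P 0 C (rel C k)" and f: "lin_on (Y \<inter> vec_on A) f"
  shows "\<exists>s F. s \<notin> P \<and> lin_on Y F \<and> (\<forall>v\<in>Y \<inter> vec_on A. F v = s * f v)"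
proof -
  interpret split_pres A B Y by (rule sp)
  let ?X = "Y \<inter> vec_on A"
  have "\<forall>c\<in>C. \<exists>v. v \<in> Y \<and> k c = restr B v"
    using g unfolding gens_def by blast
  then obtain k' where k': "\<And>c. c \<in> C \<Longrightarrow> k' c \<in> Y" "\<And>c. c \<in> C \<Longrightarrow> restr B (k' c) = k c"
    by metis
  have kY: "lc C y k' \<in> Y" for y
    using k' by (intro submod_lc[OF subY]) auto
  have rk: "restr B (lc C y k') = lc C y k" for y
    using k' by (auto simp: restr_lc intro: lc_cong)
  have relX: "lc C y k' \<in> ?X" if "y \<in> rel C k" for y
  proof -
    have "restr B (lc C y k') = restr B (\<lambda>_. 0)"
      using that by (simp add: rk rel_def) (simp add: restr_def fun_eq_iff)
    then show ?thesis
      using restr_eq_imp_diff[OF kY submod_zero[OF subY]] by simp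
  qed
  have "lin_on (rel C k) (\<lambda>y. f (lc C y k'))"
    unfolding lin_on_def using relX by (simp add: lc_comb lin_comb[OF f])
  then obtain s c where s: "s \<notin> P"
    and sc: "\<And>y. y \<in> rel C k \<Longrightarrow> s * f (lc C y k') = (\<Sum>a\<in>C. c a * y a)"
    using ext unfolding ext_van.simps by blast
  have "\<forall>v\<in>Y. \<exists>y. y \<in> vec_on C \<and> restr B v = lc C y k"
    using gens_vec[OF g] by (metis imageI)
  then obtain yy where yy: "\<And>v. v \<in> Y \<Longrightarrow> yy v \<in> vec_on C" "\<And>v. v \<in> Y \<Longrightarrow> restr B v = lc C (yy v) k"
    by metis
  \<comment> \<open>Subtracting a lift of the class of v lands in X, where f is defined, and c
    prescribes the value on the lift. Since s f agrees with c on relations, the choice of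
    coefficients for v does not matter.\<close>
  define F where "F v = s * f (\<lambda>j. v j - lc C (yy v) k' j) + (\<Sum>a\<in>C. c a * yy v a)" for v
  have dX: "(\<lambda>j. v j - lc C y k' j) \<in> ?X" if "v \<in> Y" "restr B v = lc C y k" for v y
    using that kY rk by (intro restr_eq_imp_diff) auto
  have F: "F v = s * f (\<lambda>j. v j - lc C y k' j) + (\<Sum>a\<in>C. c a * y a)"
    if v: "v \<in> Y" "restr B v = lc C y k" "y \<in> vec_on C" for v y
  proof -
    define d where "d = (\<lambda>j. y j - yy v j)"
    have d: "d \<in> rel C k"
      using v yy(2)[OF v(1)] submod_diff[OF submod_vec v(3) yy(1)[OF v(1)]]
      by (simp add: rel_def d_def lc_diff_left)
    have "(\<lambda>j. v j - lc C (yy v) k' j) = (\<lambda>j. (v j - lc C y k' j) + lc C d k' j)"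
      by (simp add: d_def lc_diff_left)
    then have "f (\<lambda>j. v j - lc C (yy v) k' j) = f (\<lambda>j. v j - lc C y k' j) + f (lc C d k')"
      using lin_add[OF f dX[OF v(1,2)] relX[OF d]] by simp
    then have "F v = s * f (\<lambda>j. v j - lc C y k' j) + ((\<Sum>a\<in>C. c a * d a) + (\<Sum>a\<in>C. c a * yy v a))"
      by (simp add: F_def distrib_left sc[OF d] add.assoc)
    also have "(\<Sum>a\<in>C. c a * d a) + (\<Sum>a\<in>C. c a * yy v a) = (\<Sum>a\<in>C. c a * y a)"
      by (simp add: d_def sum.distrib[symmetric] algebra_simps)
    finally show ?thesis .
  qed
  have "lin_on Y F"
    unfolding lin_on_def
  proof (intro allI ballI)
    fix r x z assume x: "x \<in> Y" and z: "z \<in> Y"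
    let ?w = "\<lambda>j. r * x j + z j" and ?y = "\<lambda>j. r * yy x j + yy z j"
    have wY: "?w \<in> Y" using submod_comb[OF subY x z] .
    have "restr B ?w = lc C ?y k"
      using yy(2)[OF x] yy(2)[OF z] by (simp add: restr_comb lc_comb)
    moreover have "?y \<in> vec_on C" using yy(1) x z submod_comb[OF submod_vec] by blast
    ultimately have "F ?w = s * f (\<lambda>j. ?w j - lc C ?y k' j) + (\<Sum>a\<in>C. c a * ?y a)"
      by (rule F[OF wY])
    also have "(\<lambda>j. ?w j - lc C ?y k' j) =
        (\<lambda>j. r * (x j - lc C (yy x) k' j) + (z j - lc C (yy z) k' j))"
      by (simp add: lc_comb) (simp add: algebra_simps)
    also have "f \<dots> = r * f (\<lambda>j. x j - lc C (yy x) k' j) + f (\<lambda>j. z j - lc C (yy z) k' j)"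
      by (rule lin_comb[OF f dX[OF x yy(2)[OF x]] dX[OF z yy(2)[OF z]]])
    finally show "F ?w = r * F x + F z"
      by (simp add: F_def algebra_simps sum.distrib sum_distrib_left)
  qed
  moreover have "F v = s * f v" if v: "v \<in> ?X" for v
  proof -
    have "lc C (\<lambda>_. 0) k = (\<lambda>_. 0)" "lc C (\<lambda>_. 0) k' = (\<lambda>_. 0)" by (simp_all add: lc_def)
    then show ?thesis
      using F[of v "\<lambda>_. 0"] v restr_X[OF v] by (simp add: vec_on_def)
  qed
  ultimately show ?thesis using s by blast
qed

text \<open>A multiple of f extends to Y, and a further multiple extends to a linear form on the
  whole free module; the coordinates in B vanish on X.\<close>

lemma ext_van_sub_0:
  assumes sp: "split_pres A B Y" and "ext_van P 0 (A \<union> B) Y" "ext_van P (Suc 0) B (restr B ` Y)"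
  shows "ext_van P 0 A (Y \<inter> vec_on A)"
  unfolding ext_van.simps
proof (intro allI impI)
  interpret split_pres A B Y by (rule sp)
  fix f assume f: "lin_on (Y \<inter> vec_on A) f"
  obtain s F where sF: "s \<notin> P" "lin_on Y F" "\<And>v. v \<in> Y \<inter> vec_on A \<Longrightarrow> F v = s * f v"
    using assms(3) extend_functional[OF sp _ _ f] unfolding ext_van.simps by blast
  obtain t c where t: "t \<notin> P" "\<And>v. v \<in> Y \<Longrightarrow> t * F v = (\<Sum>a\<in>A \<union> B. c a * v a)"
    using assms(2) sF(2) unfolding ext_van.simps by blast
  have "(t * s) * f v = (\<Sum>a\<in>A. c a * v a)" if v: "v \<in> Y \<inter> vec_on A" for v
  proof -
    have "(\<Sum>a\<in>A \<union> B. c a * v a) = (\<Sum>a\<in>A. c a * v a)"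
      using v disj finA finB by (intro sum.mono_neutral_right) (auto simp: vec_on_def)
    then show ?thesis using t(2)[of v] sF(3)[OF v] v by (simp add: mult.assoc)
  qed
  then show "\<exists>s c. s \<notin> P \<and> (\<forall>v\<in>Y \<inter> vec_on A. s * f v = (\<Sum>a\<in>A. c a * v a))"
    using notin_mult[OF t(1) sF(1)] by blast
qed

lemma ext_van_ext_0:
  assumes sp: "split_pres A B Y" and "ext_van P 0 A (Y \<inter> vec_on A)" "ext_van P 0 B (restr B ` Y)"
  shows "ext_van P 0 (A \<union> B) Y"
  unfolding ext_van.simps
proof (intro allI impI)
  interpret split_pres A B Y by (rule sp)
  fix f assume f: "lin_on Y f"
  obtain s c where s: "s \<notin> P" "\<And>v. v \<in> Y \<inter> vec_on A \<Longrightarrow> s * f v = (\<Sum>a\<in>A. c a * v a)"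
    using assms(2) lin_on_subset[OF f] unfolding ext_van.simps by (metis inf_le1)
  define F where "F v = s * f v - (\<Sum>a\<in>A. c a * v a)" for v
  have F: "lin_on Y F"
    unfolding lin_on_def F_def
    by (simp add: lin_comb[OF f]) (simp add: algebra_simps sum.distrib sum_distrib_left)
  have F0: "F v = 0" if "v \<in> Y \<inter> vec_on A" for v
    using s(2)[OF that] by (simp add: F_def)
  obtain G where G: "lin_on (restr B ` Y) G" "\<And>v. v \<in> Y \<Longrightarrow> G (restr B v) = F v"
    using lin_factor[OF F F0] by blast
  have "\<exists>t d. t \<notin> P \<and> (\<forall>w\<in>restr B ` Y. t * G w = (\<Sum>a\<in>B. d a * w a))"
    by (rule assms(3)[unfolded ext_van.simps, rule_format, OF G(1)])
  then obtain t d where t: "t \<notin> P" "\<And>w. w \<in> restr B ` Y \<Longrightarrow> t * G w = (\<Sum>a\<in>B. d a * w a)"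
    by blast
  define e where "e a = (if a \<in> A then t * c a else d a)" for a
  have "(t * s) * f v = (\<Sum>a\<in>A \<union> B. e a * v a)" if v: "v \<in> Y" for v
  proof -
    have "t * F v = (\<Sum>a\<in>B. d a * restr B v a)"
      using t(2)[of "restr B v"] v by (simp add: G)
    also have "\<dots> = (\<Sum>a\<in>B. e a * v a)"
      using disj by (intro sum.cong) (auto simp: restr_def e_def)
    finally have "t * F v = (\<Sum>a\<in>B. e a * v a)" .
    moreover have "t * (\<Sum>a\<in>A. c a * v a) = (\<Sum>a\<in>A. e a * v a)"
      by (simp add: e_def sum_distrib_left mult.assoc)
    moreover have "(\<Sum>a\<in>A \<union> B. e a * v a) = (\<Sum>a\<in>A. e a * v a) + (\<Sum>a\<in>B. e a * v a)"
      using finA finB disj by (rule sum.union_disjoint)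
    ultimately show ?thesis by (simp add: F_def algebra_simps)
  qed
  then show "\<exists>s c. s \<notin> P \<and> (\<forall>v\<in>Y. s * f v = (\<Sum>a\<in>A \<union> B. c a * v a))"
    using notin_mult[OF t(1) s(1)] by blast
qed

text \<open>Two pieces of the long exact sequence around Ext^(i+1). They are packaged per degree
  because independence of generators in degree i enters the induction step to degree i + 1.\<close>

definition les_at :: "nat \<Rightarrow> bool" where
  "les_at i \<longleftrightarrow> (\<forall>A B Y. split_pres A B Y \<longrightarrow>
     (ext_van P i A (Y \<inter> vec_on A) \<longrightarrow> ext_van P i B (restr B ` Y) \<longrightarrow> ext_van P i (A \<union> B) Y) \<and>
     (ext_van P i (A \<union> B) Y \<longrightarrow> ext_van P (Suc i) B (restr B ` Y) \<longrightarrow> ext_van P i A (Y \<inter> vec_on A)))"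

text \<open>With zero right-hand quotient, R^A/X and R^(A \<union> B)/Y are presentations of the
  same module.\<close>

lemma les_at_redundant:
  assumes "les_at i" and sp: "split_pres A B Y" and "restr B ` Y = vec_on B"
  shows "ext_van P i A (Y \<inter> vec_on A) \<longleftrightarrow> ext_van P i (A \<union> B) Y"
proof -
  have "finite B" using sp by (simp add: split_pres_def)
  then show ?thesis using assms ext_van_vec[of B] unfolding les_at_def by metis
qed

text \<open>Both families are compared with their union. The relations of the union contain those of
  either family, with free quotient, because each generator of one family is a combination of the
  other.\<close>

lemma les_at_independent:
  assumes les: "les_at i" and K: "submod K" and g: "gens C h K" "gens D k K"
    and ext: "ext_van P i C (rel C h)"
  shows "ext_van P i D (rel D k)"
proof -
  have *: "ext_van P i D (rel D k)"
    if g: "gens C h K" "gens D k K" and cd: "C \<inter> D = {}" and ext: "ext_van P i C (rel C h)"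
    for C D and h k :: "nat \<Rightarrow> nat \<Rightarrow> 'a"
  proof -
    define hh where "hh c = (if c \<in> C then h c else k c)" for c
    let ?Y = "rel (C \<union> D) hh"
    have fin: "finite C" "finite D" using g by (auto simp: gens_def)
    have lcC: "lc C y hh = lc C y h" for y
      by (auto simp: hh_def intro: lc_cong)
    have lcD: "lc D y hh = lc D y k" for y
      using cd by (auto simp: hh_def intro!: lc_cong)
    have lcCD: "lc (C \<union> D) y hh = (\<lambda>j. lc C y h j + lc D y k j)" for y
      using lc_Un[OF fin cd, of y hh] by (simp add: lcC lcD)
    have inK: "lc C y h \<in> K" "lc D y k \<in> K" for y
      using g by (auto intro!: submod_lc[OF K] simp: gens_def)
    have sp: "split_pres C D ?Y"
    proof
      show "?Y \<subseteq> vec_on (C \<union> D)" unfolding rel_def by blast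
    qed (use fin cd submod_rel in simp_all)
    then have sp': "split_pres D C ?Y"
      by (auto simp: split_pres_def Un_commute Int_commute)
    have z0: "lc D y k = (\<lambda>_. 0)" if "y \<in> vec_on C" for y
      using that cd by (auto simp: lc_def vec_on_def fun_eq_iff intro!: sum.neutral)
    have z0': "lc C y h = (\<lambda>_. 0)" if "y \<in> vec_on D" for y
      using that cd by (auto simp: lc_def vec_on_def fun_eq_iff intro!: sum.neutral)
    have X1: "?Y \<inter> vec_on C = rel C h"
      using z0 by (auto simp: rel_def lcCD vec_on_def)
    have X2: "?Y \<inter> vec_on D = rel D k"
      using z0' by (auto simp: rel_def lcCD vec_on_def)
    have onto: "\<exists>w \<in> ?Y. restr C w = u \<and> restr D w = v"
      if "u \<in> vec_on C" "v \<in> vec_on D" "(\<lambda>j. lc C u h j + lc D v k j) = (\<lambda>_. 0)"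
      for u v :: "nat \<Rightarrow> 'a"
    proof (rule bexI)
      define w where "w c = (if c \<in> C then u c else v c)" for c
      show "restr C w = u \<and> restr D w = v"
        using that cd by (auto simp: w_def restr_def vec_on_def fun_eq_iff)
      have "lc C w h = lc C u h" "lc D w k = lc D v k"
        using cd by (auto simp: w_def intro!: lc_cong)
      then show "w \<in> ?Y"
        using that by (auto simp: rel_def lcCD w_def vec_on_def)
    qed
    \<comment> \<open>Any v in R^D extends to a relation: its combination of k lies in K, so its
      negative can be written in the generators h.\<close>
    have Z1: "restr D ` ?Y = vec_on D"
    proof (intro equalityI subsetI)
      fix v :: "nat \<Rightarrow> 'a" assume v: "v \<in> vec_on D"
      have "(\<lambda>j. 0 - lc D v k j) \<in> K"
        using submod_diff[OF K submod_zero[OF K] inK(2)] .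
      then obtain u where u: "u \<in> vec_on C" "(\<lambda>j. 0 - lc D v k j) = lc C u h"
        using gens_vec[OF g(1)] by metis
      have "lc C u h j = 0 - lc D v k j" for j
        using fun_cong[OF u(2), of j] by simp
      then have "(\<lambda>j. lc C u h j + lc D v k j) = (\<lambda>_. 0)"
        by simp
      then show "v \<in> restr D ` ?Y"
        using onto[OF u(1) v] by blast
    qed (auto simp: restr_vec)
    have Z2: "restr C ` ?Y = vec_on C"
    proof (intro equalityI subsetI)
      fix u :: "nat \<Rightarrow> 'a" assume u: "u \<in> vec_on C"
      have "(\<lambda>j. 0 - lc C u h j) \<in> K"
        using submod_diff[OF K submod_zero[OF K] inK(1)] .
      then obtain v where v: "v \<in> vec_on D" "(\<lambda>j. 0 - lc C u h j) = lc D v k"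
        using gens_vec[OF g(2)] by metis
      have "lc D v k j = 0 - lc C u h j" for j
        using fun_cong[OF v(2), of j] by simp
      then have "(\<lambda>j. lc C u h j + lc D v k j) = (\<lambda>_. 0)"
        by simp
      then show "u \<in> restr C ` ?Y"
        using onto[OF u v(1)] by blast
    qed (auto simp: restr_vec)
    have "ext_van P i (C \<union> D) ?Y"
      using les_at_redundant[OF les sp Z1] ext by (simp add: X1)
    then show ?thesis
      using les_at_redundant[OF les sp' Z2] by (simp add: X2 Un_commute)
  qed
  \<comment> \<open>When C and D overlap, the comparison passes through a copy disjoint from
    both.\<close>
  obtain C' h' where g': "gens C' h' K" "C' \<inter> (C \<union> D) = {}"
    using gens_copy[OF g(1)] gens_finite[OF g(1)] gens_finite[OF g(2)] by (metis finite_UnI)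
  have "ext_van P i C' (rel C' h')"
    using g'(2) by (intro *[OF g(1) g'(1) _ ext]) blast
  then show ?thesis
    using g'(2) by (intro *[OF g'(1) g(2)]) blast
qed

text \<open>Each piece in degree i + 1 is the same piece in degree i for the syzygies given by
  \<open>horseshoe\<close>. The hypotheses speak of other generators than those, which independence
  in degree i repairs.\<close>

lemma les_at_all: "les_at i"
proof (induction i)
  case 0
  show ?case
    unfolding les_at_def using ext_van_sub_0 ext_van_ext_0 by auto
next
  case (Suc i)
  have a: "ext_van P (Suc i) (A \<union> B) Y"
    if sp: "split_pres A B Y" and X: "ext_van P (Suc i) A (Y \<inter> vec_on A)"
      and Z: "ext_van P (Suc i) B (restr B ` Y)"
    for A B Y
  proof -
    interpret split_pres A B Y by (rule sp)
    obtain C h where g1: "gens C h (Y \<inter> vec_on A)" and ext1: "ext_van P i C (rel C h)"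
      using X unfolding ext_van.simps by blast
    obtain D k where g2: "gens D k (restr B ` Y)" and ext2: "ext_van P i D (rel D k)"
      using Z unfolding ext_van.simps by blast
    note g = g1 g2 and ext = ext1 ext2
    obtain C' h' where g': "gens C' h' (Y \<inter> vec_on A)" and cd: "C' \<inter> D = {}"
      using gens_copy[OF g(1) gens_finite[OF g(2)]] by metis
    have ext': "ext_van P i C' (rel C' h')"
      by (rule les_at_independent[OF Suc.IH subX g(1) g' ext(1)])
    obtain hh where hh: "gens (C' \<union> D) hh Y" "split_pres C' D (rel (C' \<union> D) hh)"
      "rel (C' \<union> D) hh \<inter> vec_on C' = rel C' h'" "restr D ` rel (C' \<union> D) hh = rel D k"
      using horseshoe[OF g' g(2) cd] by metis
    have "ext_van P i (C' \<union> D) (rel (C' \<union> D) hh)"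
      using Suc.IH hh ext' ext(2) unfolding les_at_def by metis
    then show ?thesis using hh(1) by auto
  qed
  have b: "ext_van P (Suc i) A (Y \<inter> vec_on A)"
    if sp: "split_pres A B Y" and Y: "ext_van P (Suc i) (A \<union> B) Y"
      and Z: "ext_van P (Suc (Suc i)) B (restr B ` Y)"
    for A B Y
  proof -
    interpret split_pres A B Y by (rule sp)
    obtain D k where g: "gens D k (restr B ` Y)" and ext: "ext_van P (Suc i) D (rel D k)"
      using Z unfolding ext_van.simps(2)[of _ "Suc i"] by blast
    obtain E l where gY: "gens E l Y" and extY: "ext_van P i E (rel E l)"
      using Y unfolding ext_van.simps by blast
    obtain C h where "gens C h (Y \<inter> vec_on A)"
      using submod_fin_gen[OF noeth finA subX] by blast
    then obtain C' h' where g': "gens C' h' (Y \<inter> vec_on A)" and cd: "C' \<inter> D = {}"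
      using gens_copy[OF _ gens_finite[OF g]] by metis
    obtain hh where hh: "gens (C' \<union> D) hh Y" "split_pres C' D (rel (C' \<union> D) hh)"
      "rel (C' \<union> D) hh \<inter> vec_on C' = rel C' h'" "restr D ` rel (C' \<union> D) hh = rel D k"
      using horseshoe[OF g' g cd] by metis
    have "ext_van P i (C' \<union> D) (rel (C' \<union> D) hh)"
      by (rule les_at_independent[OF Suc.IH subY gY hh(1) extY])
    then have "ext_van P i C' (rel C' h')"
      using Suc.IH hh ext unfolding les_at_def by metis
    then show ?thesis using g' by auto
  qed
  show ?case unfolding les_at_def using a b by blast
qed

lemmas ext_van_extension = les_at_all[unfolded les_at_def, rule_format, THEN conjunct1, rule_format]
lemmas ext_van_sub = les_at_all[unfolded les_at_def, rule_format, THEN conjunct2, rule_format]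
lemmas ext_van_redundant = les_at_redundant[OF les_at_all]
lemmas ext_van_independent = les_at_independent[OF les_at_all]

end

section \<open>Cyclic modules\<close>

definition line :: "nat \<Rightarrow> 'a::comm_ring_1 set \<Rightarrow> (nat \<Rightarrow> 'a) set" where
  "line b I = {x \<in> vec_on {b}. x b \<in> I}"

definition colon :: "'a::comm_ring_1 set \<Rightarrow> 'a \<Rightarrow> 'a set" where
  "colon I a = {r. r * a \<in> I}"

definition adjoin :: "'a::comm_ring_1 set \<Rightarrow> 'a \<Rightarrow> 'a set" where
  "adjoin I a = {r. \<exists>t. r - t * a \<in> I}"

lemma ideal_zero: "is_ideal I \<Longrightarrow> 0 \<in> I"
  and ideal_add: "is_ideal I \<Longrightarrow> x \<in> I \<Longrightarrow> y \<in> I \<Longrightarrow> x + y \<in> I"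
  and ideal_mult: "is_ideal I \<Longrightarrow> x \<in> I \<Longrightarrow> r * x \<in> I"
  by (simp_all add: is_ideal_def)

lemma ideal_colon: "is_ideal I \<Longrightarrow> is_ideal (colon I a)"
  by (simp add: is_ideal_def colon_def distrib_right mult.assoc)

lemma ideal_adjoin: "is_ideal I \<Longrightarrow> is_ideal (adjoin I a)"
  unfolding is_ideal_def[of "adjoin I a"]
proof (intro conjI ballI allI)
  assume I: "is_ideal I"
  show "0 \<in> adjoin I a"
    unfolding adjoin_def using ideal_zero[OF I] by (intro CollectI exI[of _ 0]) simp
  fix x y r assume x: "x \<in> adjoin I a"
  then obtain t where t: "x - t * a \<in> I" by (auto simp: adjoin_def)
  have "r * x - (r * t) * a \<in> I"
    using ideal_mult[OF I t, of r] by (simp add: algebra_simps)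
  then show "r * x \<in> adjoin I a" by (auto simp: adjoin_def)
  assume "y \<in> adjoin I a"
  then obtain u where u: "y - u * a \<in> I" by (auto simp: adjoin_def)
  have "x + y - (t + u) * a \<in> I"
    using ideal_add[OF I t u] by (simp add: algebra_simps)
  then show "x + y \<in> adjoin I a" by (auto simp: adjoin_def)
qed

lemma colon_superset: "is_ideal I \<Longrightarrow> I \<subseteq> colon I a"
  unfolding colon_def using ideal_mult[of I _ a] by (auto simp only: mult.commute[of _ a])

lemma adjoin_superset: "I \<subseteq> adjoin I a"
proof
  fix r assume "r \<in> I"
  then have "r - 0 * a \<in> I" by simp
  then show "r \<in> adjoin I a" unfolding adjoin_def by blast
qed

lemma adjoin_self: "is_ideal I \<Longrightarrow> a \<in> adjoin I a"
  unfolding adjoin_def by (intro CollectI exI[of _ 1]) (simp add: ideal_zero)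

lemma ideal_principal: "is_ideal (range ((*) x))" for x :: "'a::comm_ring_1"
  unfolding is_ideal_def
proof (intro conjI ballI allI)
  show "0 \<in> range ((*) x)" by (rule range_eqI[of _ _ 0]) simp
  fix r a b assume "a \<in> range ((*) x)"
  then obtain a' where a: "a = x * a'" by blast
  then show "r * a \<in> range ((*) x)" by (intro range_eqI[of _ _ "r * a'"]) simp
  assume "b \<in> range ((*) x)"
  then obtain b' where "b = x * b'" by blast
  then show "a + b \<in> range ((*) x)"
    using a by (intro range_eqI[of _ _ "a' + b'"]) (simp add: distrib_left)
qed

lemma submod_line: "is_ideal I \<Longrightarrow> submod (line b I)"
  by (auto simp: submod_def line_def vec_on_def is_ideal_def)

lemma line_vec: "line b I \<subseteq> vec_on {b}"
  by (auto simp: line_def)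

lemma is_prime_idealI:
  assumes I: "is_ideal I" "I \<noteq> UNIV"
    and mx: "\<And>a b. a * b \<in> I \<Longrightarrow> a \<notin> I \<Longrightarrow> b \<notin> I \<Longrightarrow> False"
  shows "is_prime_ideal I"
  using assms unfolding is_prime_ideal_def by blast

context prime_loc
begin

text \<open>Vanishing of Ext^(i+1)(R/I, R) at P; the index is lower than the degree by one, as in
  \<open>ext_van\<close>.\<close>

definition cyc_van :: "nat \<Rightarrow> 'a set \<Rightarrow> bool" where
  "cyc_van i I \<longleftrightarrow> ext_van P i {0} (line 0 I)"

text \<open>In R^2 the condition that x_b + x_c lies in I presents R/I, and either coordinate axis
  maps onto this quotient. The coordinate must be changeable since \<open>split_pres\<close> puts
  sub and quotient in different ones.\<close>

lemma cyc_van_index_neq: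
  assumes I: "is_ideal I" and "b \<noteq> c" and ext: "ext_van P i {b} (line b I)"
  shows "ext_van P i {c} (line c I)"
proof -
  let ?Y = "{x \<in> vec_on {b, c}. x b + x c \<in> I}"
  have "submod ?Y"
    unfolding submod_def
  proof (intro conjI allI ballI)
    show "(\<lambda>_. 0) \<in> ?Y" using ideal_zero[OF I] by (simp add: vec_on_def)
    fix r x y assume x: "x \<in> ?Y" and y: "y \<in> ?Y"
    then have "r * (x b + x c) + (y b + y c) \<in> I"
      using I by (auto intro: ideal_add ideal_mult)
    then show "(\<lambda>j. r * x j + y j) \<in> ?Y"
      using x y by (auto simp: vec_on_def algebra_simps)
  qed
  then have sp: "split_pres {b} {c} ?Y" "split_pres {c} {b} ?Y"
    using \<open>b \<noteq> c\<close> by (auto simp: split_pres_def insert_commute)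
  have X: "?Y \<inter> vec_on {b} = line b I" "?Y \<inter> vec_on {c} = line c I"
    using \<open>b \<noteq> c\<close> by (auto simp: line_def vec_on_def)
  have Z: "restr e ` ?Y = vec_on e" if e: "e = {c} \<or> e = {b}" for e
  proof (intro equalityI subsetI)
    fix v :: "nat \<Rightarrow> 'a" assume v: "v \<in> vec_on e"
    \<comment> \<open>The coordinates sum to 0. As v is supported in one of b and c, the matching
      coordinate of w is that of v.\<close>
    define w where "w j = (if j = b then v b - v c else if j = c then v c - v b else 0)" for j :: nat
    have "w \<in> ?Y" using ideal_zero[OF I] \<open>b \<noteq> c\<close> by (simp add: w_def vec_on_def)
    moreover have "v = restr e w"
      using e v \<open>b \<noteq> c\<close> by (auto simp: w_def restr_def vec_on_def fun_eq_iff)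
    ultimately show "v \<in> restr e ` ?Y" by blast
  qed (auto simp: restr_vec)
  have "ext_van P i ({b} \<union> {c}) ?Y"
    using ext_van_redundant[OF sp(1) Z] ext X(1) by simp
  then have "ext_van P i ({c} \<union> {b}) ?Y"
    by (simp only: Un_commute)
  then show ?thesis
    using ext_van_redundant[OF sp(2) Z] X(2) by simp
qed

lemma cyc_van_index:
  assumes "is_ideal I" shows "ext_van P i {b} (line b I) \<longleftrightarrow> cyc_van i I"
  unfolding cyc_van_def using cyc_van_index_neq[OF assms, of b 0 i] cyc_van_index_neq[OF assms, of 0 b i]
  by (cases "b = 0") blast+

text \<open>The exact sequence 0 \<rightarrow> R/(I:a) \<rightarrow> R/I \<rightarrow> R/(I+Ra)
  \<rightarrow> 0, the first map being multiplication by a. The module R/I is presented as R^2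
  modulo the pairs with x_0 a + x_1 in I.\<close>

lemma cyc_van_seq:
  assumes I: "is_ideal I"
  shows "cyc_van i (colon I a) \<Longrightarrow> cyc_van i (adjoin I a) \<Longrightarrow> cyc_van i I"
    and "cyc_van i I \<Longrightarrow> cyc_van (Suc i) (adjoin I a) \<Longrightarrow> cyc_van i (colon I a)"
proof -
  let ?Y = "{x \<in> vec_on {0, 1}. x 0 * a + x 1 \<in> I}"
  have "submod ?Y"
    unfolding submod_def
  proof (intro conjI allI ballI)
    show "(\<lambda>_. 0) \<in> ?Y" using ideal_zero[OF I] by (simp add: vec_on_def)
    fix r x y assume x: "x \<in> ?Y" and y: "y \<in> ?Y"
    then have "r * (x 0 * a + x 1) + (y 0 * a + y 1) \<in> I"
      using I by (auto intro: ideal_add ideal_mult)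
    then show "(\<lambda>j. r * x j + y j) \<in> ?Y"
      using x y by (auto simp: vec_on_def algebra_simps)
  qed
  then have sp: "split_pres {0} {1} ?Y" "split_pres {1} {0} ?Y"
    by (auto simp: split_pres_def insert_commute)
  have X: "?Y \<inter> vec_on {0} = line 0 (colon I a)" "?Y \<inter> vec_on {1} = line 1 I"
    by (auto simp: line_def vec_on_def colon_def)
  have Z1: "restr {0} ` ?Y = vec_on {0}"
  proof (intro equalityI subsetI)
    fix v :: "nat \<Rightarrow> 'a" assume v: "v \<in> vec_on {0}"
    define w where "w j = (if j = 0 then v 0 else if j = 1 then - (v 0 * a) else 0)" for j :: nat
    have "w 0 * a + w 1 = 0" by (simp add: w_def)
    then have "w \<in> ?Y" using ideal_zero[OF I] by (simp add: vec_on_def) (simp add: w_def)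
    moreover have "v = restr {0} w"
    proof
      show "v j = restr {0} w j" for j
        using v by (cases "j = 0") (simp_all add: w_def restr_def vec_on_def)
    qed
    ultimately show "v \<in> restr {0} ` ?Y" by blast
  qed (auto simp: restr_vec)
  have Z2: "restr {1} ` ?Y = line 1 (adjoin I a)"
  proof (intro equalityI subsetI)
    fix v assume "v \<in> restr {1} ` ?Y"
    then obtain w where w: "w \<in> ?Y" "v = restr {1} w" by blast
    then have "v 1 - (- w 0) * a \<in> I" by (simp add: restr_def add.commute)
    then show "v \<in> line 1 (adjoin I a)"
      using w(2) restr_vec unfolding line_def adjoin_def by blast
  next
    fix v assume v: "v \<in> line 1 (adjoin I a)"
    then obtain t where t: "v 1 - t * a \<in> I" by (auto simp: line_def adjoin_def)
    define w where "w j = (if j = 0 then - t else v j)" for j :: nat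
    have "w \<in> ?Y" using t v by (simp add: w_def vec_on_def line_def add.commute)
    moreover have "v = restr {1} w"
    proof
      show "v j = restr {1} w j" for j
        using v by (cases "j = 1") (simp_all add: w_def restr_def vec_on_def line_def)
    qed
    ultimately show "v \<in> restr {1} ` ?Y" by blast
  qed
  \<comment> \<open>Coordinate 1 alone already maps onto the quotient with kernel I, so the
    redundant coordinate 0 may be removed.\<close>
  have Y: "ext_van P i ({0} \<union> {1}) ?Y \<longleftrightarrow> cyc_van i I" for i
    using ext_van_redundant[OF sp(2) Z1] X(2) cyc_van_index[OF I, of i 1] by (simp add: insert_commute)
  show "cyc_van i I" if "cyc_van i (colon I a)" "cyc_van i (adjoin I a)"
    using ext_van_extension[OF sp(1), of i] that X(1) Z2 Y cyc_van_index[OF ideal_adjoin[OF I], of i 1]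
    by (simp add: cyc_van_def)
  show "cyc_van i (colon I a)" if "cyc_van i I" "cyc_van (Suc i) (adjoin I a)"
    using ext_van_sub[OF sp(1), of i] that X(1) Z2 Y cyc_van_index[OF ideal_adjoin[OF I], of "Suc i" 1]
    by (simp add: cyc_van_def del: ext_van.simps)
qed

text \<open>R^A/K has a filtration with cyclic quotients R/I, where I is a coordinate ideal.\<close>

lemma ext_van_from_cyclic:
  assumes cyc: "\<And>I. is_ideal I \<Longrightarrow> cyc_van i I"
    and "finite A" "submod K" "K \<subseteq> vec_on A"
  shows "ext_van P i A K"
  using assms(2-)
proof (induction A arbitrary: K)
  case empty
  then have "K = {\<lambda>_. 0}" by (auto simp: vec_on_def submod_def)
  then show ?case using ext_van_free[of "{}"] by simp
next
  case (insert a A)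
  have sp: "split_pres A {a} K"
    by unfold_locales (use insert in auto)
  interpret split_pres A "{a}" K by (rule sp)
  have "restr {a} ` K = line a ((\<lambda>v. v a) ` K)"
  proof (intro equalityI subsetI)
    fix v assume "v \<in> line a ((\<lambda>v. v a) ` K)"
    then obtain w where "w \<in> K" "v = restr {a} w"
      by (auto simp: line_def restr_def vec_on_def fun_eq_iff)
    then show "v \<in> restr {a} ` K" by blast
  qed (auto simp: line_def restr_vec, auto simp: restr_def)
  then have "ext_van P i {a} (restr {a} ` K)"
    using cyc cyc_van_index submod_coord_ideal[OF insert.prems(1)] by auto
  moreover have "ext_van P i A (K \<inter> vec_on A)"
    using insert.IH subX by auto
  ultimately show ?case
    using ext_van_extension[OF sp, of i] by simp
qed

text \<open>A maximal counterexample I lies in P, since an element outside P would kill R/I. It is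
  prime: if ab is in I with neither factor in I, then I+Ra and I:a are larger, and their vanishing
  gives that of I. The element x restricts attention to primes containing it; x = 0 allows
  all.\<close>

lemma cyc_van_prime_reduction:
  assumes J: "\<And>q. is_prime_ideal q \<Longrightarrow> x \<in> q \<Longrightarrow> q \<subseteq> P \<Longrightarrow> cyc_van i q"
    and "is_ideal I" "x \<in> I"
  shows "cyc_van i I"
proof (rule ccontr)
  assume n: "\<not> cyc_van i I"
  define \<C> where "\<C> = {I. is_ideal I \<and> x \<in> I \<and> \<not> cyc_van i I}"
  have "I \<in> \<C>" using assms n by (simp add: \<C>_def)
  then obtain I where I: "I \<in> \<C>" and mx: "\<And>J. J \<in> \<C> \<Longrightarrow> I \<subseteq> J \<Longrightarrow> J = I"
    using ideal_maximal[OF noeth, of _ \<C>] unfolding \<C>_def by blast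
  have ideal: "is_ideal I" and x: "x \<in> I" and ncyc: "\<not> cyc_van i I"
    using I by (auto simp: \<C>_def)
  have IP: "I \<subseteq> P"
  proof
    fix s assume s: "s \<in> I"
    have "cyc_van i I" if "s \<notin> P"
      unfolding cyc_van_def
    proof (rule ext_van_killed[OF _ submod_line[OF ideal] line_vec that])
      fix v :: "nat \<Rightarrow> 'a" assume "v \<in> vec_on {0}"
      then show "(\<lambda>j. s * v j) \<in> line 0 I"
        using ideal_mult[OF ideal s, of "v 0"] by (simp add: line_def vec_on_def mult.commute)
    qed simp
    then show "s \<in> P" using ncyc by blast
  qed
  have "is_prime_ideal I"
  proof (rule is_prime_idealI[OF ideal])
    show "I \<noteq> UNIV" using IP one_notin by blast
    fix a b assume ab: "a * b \<in> I" "a \<notin> I" "b \<notin> I"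
    have "cyc_van i (adjoin I a)"
      using mx[of "adjoin I a"] adjoin_superset[of I a] adjoin_self[OF ideal, of a] ab x ideal_adjoin[OF ideal]
      unfolding \<C>_def by blast
    moreover have "b \<in> colon I a" using ab by (simp add: colon_def mult.commute)
    then have "cyc_van i (colon I a)"
      using mx[of "colon I a"] colon_superset[OF ideal, of a] ab x ideal_colon[OF ideal]
      unfolding \<C>_def by blast
    ultimately show False using cyc_van_seq(1)[OF ideal] ncyc by blast
  qed
  then show False using J x IP ncyc by blast
qed

text \<open>An associated prime of R/J inside P, so that R/(J:y) embeds in R/J. It is maximal among
  the annihilators contained in P; for a larger annihilator an element outside P must kill the
  multiple of y, and two such elements multiply to a contradiction.\<close>

lemma colon_prime_exists:
  assumes J: "is_ideal J" "J \<subseteq> P"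
  obtains y where "is_prime_ideal (colon J y)" "J \<subseteq> colon J y" "colon J y \<subseteq> P"
proof -
  define \<C> where "\<C> = {colon J y | y. colon J y \<subseteq> P}"
  have "colon J 1 \<in> \<C>" using J unfolding \<C>_def by (auto simp: colon_def intro!: exI[of _ 1])
  moreover have "\<And>I. I \<in> \<C> \<Longrightarrow> is_ideal I" unfolding \<C>_def using ideal_colon[OF J(1)] by blast
  ultimately obtain I where I: "I \<in> \<C>" and mx: "\<And>I'. I' \<in> \<C> \<Longrightarrow> I \<subseteq> I' \<Longrightarrow> I' = I"
    using ideal_maximal[OF noeth] by blast
  obtain y where y: "I = colon J y" "I \<subseteq> P" using I unfolding \<C>_def by blast
  have ideal: "is_ideal I" using y ideal_colon J by blast
  have up: "I \<subseteq> colon J (t * y)" for t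
  proof
    fix r assume "r \<in> I"
    then have "t * (r * y) \<in> J" unfolding y colon_def by (simp add: ideal_mult[OF J(1)])
    then show "r \<in> colon J (t * y)" by (simp add: colon_def mult.left_commute)
  qed
  have "is_prime_ideal I"
  proof (rule is_prime_idealI[OF ideal])
    show "I \<noteq> UNIV" using y one_notin by blast
    fix a b assume ab: "a * b \<in> I" "a \<notin> I" "b \<notin> I"
    have "b \<in> colon J (a * y)" using ab(1) unfolding y colon_def by (simp add: ac_simps)
    then have "\<not> colon J (a * y) \<subseteq> P" using up[of a] mx[of "colon J (a * y)"] ab(3) unfolding \<C>_def by blast
    then obtain s where s: "s * (a * y) \<in> J" "s \<notin> P" unfolding colon_def by blast
    then have "a \<in> colon J (s * y)" by (simp add: colon_def ac_simps)
    then have "\<not> colon J (s * y) \<subseteq> P" using up[of s] mx[of "colon J (s * y)"] ab(2) unfolding \<C>_def by blast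
    then obtain t where t: "t * (s * y) \<in> J" "t \<notin> P" unfolding colon_def by blast
    then have "t * s \<in> I" by (simp add: y colon_def mult.assoc)
    then show False using y(2) notin_mult[OF t(2) s(2)] by blast
  qed
  then show ?thesis using that y colon_superset[OF J(1)] by blast
qed

text \<open>P itself is associated to xR, giving 0 \<rightarrow> R/P \<rightarrow> R/xR
  \<rightarrow> R/(xR+yR) \<rightarrow> 0. The right-hand ideal contains x, so its vanishing reduces
  to that of P one degree higher, and vanishing for R/xR then lowers the degree by one. The bound
  \<open>j0\<close> is 0 for x = 0 and 1 for regular x.\<close>

lemma cyc_van_descent:
  assumes x: "x \<in> P" and only: "\<And>q. is_prime_ideal q \<Longrightarrow> x \<in> q \<Longrightarrow> q \<subseteq> P \<Longrightarrow> q = P"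
    and princ: "\<And>j. j \<ge> j0 \<Longrightarrow> cyc_van j (range ((*) x))"
    and "\<And>i. i \<ge> n \<Longrightarrow> cyc_van i P" and "j \<ge> j0"
  shows "cyc_van j P"
  using assms(4,5)
proof (induction n)
  case (Suc n)
  show ?case
  proof (cases "n \<ge> j0")
    case True
    have xI: "x \<in> range ((*) x)" by (rule range_eqI[of _ _ 1]) simp
    have "range ((*) x) \<subseteq> P" using in_mult_left[OF x] by (auto simp: mult.commute)
    then obtain y where y: "is_prime_ideal (colon (range ((*) x)) y)"
      "range ((*) x) \<subseteq> colon (range ((*) x)) y" "colon (range ((*) x)) y \<subseteq> P"
      using colon_prime_exists[OF ideal_principal] by blast
    then have eq: "colon (range ((*) x)) y = P" using only xI by blast
    have "cyc_van (Suc n) (adjoin (range ((*) x)) y)"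
    proof (rule cyc_van_prime_reduction[where x = x])
      show "x \<in> adjoin (range ((*) x)) y" using xI adjoin_superset by blast
      show "cyc_van (Suc n) q" if "is_prime_ideal q" "x \<in> q" "q \<subseteq> P" for q
        using only[OF that] Suc.prems(1) by simp
    qed (rule ideal_adjoin[OF ideal_principal])
    then have "cyc_van n P"
      using cyc_van_seq(2)[OF ideal_principal princ[OF True]] eq by metis
    then have "cyc_van i P" if "i \<ge> n" for i
      using Suc.prems(1) that by (cases "i = n") auto
    then show ?thesis using Suc.IH Suc.prems(2) by blast
  qed (use Suc.prems in auto)
qed simp

end

section \<open>The Gorenstein condition\<close>

lemma vecs_vec_on: "vecs m = vec_on {..<m}"
  by (auto simp: vecs_def vec_on_def)

lemma mat_app_lc: "mat_app m n A x = lc {..<n} x (\<lambda>k j. if j < m then A j k else 0)"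
  by (auto simp: mat_app_def lc_def fun_eq_iff mult.commute intro!: sum.cong)

context prime_loc
begin

text \<open>In a free resolution the i-th image presents the (i-1)-st syzygy. Exactness of the
  localized dual at place i says that functionals on this image extend locally to the free module
  containing it.\<close>

lemma gorenstein_cyc_van:
  assumes "gorenstein_at P"
  obtains n where "\<And>i. i \<ge> n \<Longrightarrow> cyc_van i P"
proof -
  obtain b d n where res: "free_res P b d" and van: "\<And>i. i > n \<Longrightarrow> ext_loc_zero P b d i"
    using assms unfolding gorenstein_at_def by blast
  \<comment> \<open>Columns of the differentials; rows from b (i - 1) on are cut off because
    \<open>mat_app\<close> ignores them and \<open>lc\<close> does not.\<close>
  define h where "h i = (\<lambda>k j. if j < b (i - 1) then d i j k else 0)" for i
  define im where "im i = mat_app (b (i - 1)) (b i) (d i) ` vecs (b i)" for i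
  have im_lc: "im i = (\<lambda>x. lc {..<b i} x (h i)) ` vec_on {..<b i}" for i
    by (simp add: im_def mat_app_lc h_def vecs_vec_on)
  have hin: "h i k \<in> im i" if "k < b i" for i k
  proof -
    have "lc {..<b i} (unit_vec k) (h i) = h i k"
    proof
      fix j
      have "lc {..<b i} (unit_vec k) (h i) j = (\<Sum>c<b i. if k = c then h i c j else 0)"
        unfolding lc_def unit_vec_def by (intro sum.cong) auto
      then show "lc {..<b i} (unit_vec k) (h i) j = h i k j" using that by simp
    qed
    moreover have "unit_vec k \<in> (vec_on {..<b i} :: (nat \<Rightarrow> 'a) set)"
      using that by (simp add: unit_vec_def vec_on_def)
    ultimately show ?thesis unfolding im_lc by (metis imageI)
  qed
  have g: "gens {..<b i} (h i) (im i)" for i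
    using hin by (auto simp: gens_def im_lc)
  have rel: "rel {..<b i} (h i) = im (Suc i)" if "i \<ge> 1" for i
  proof -
    have "{x \<in> vecs (b i). mat_app (b (i - 1)) (b i) (d i) x = (\<lambda>_. 0)} = im (Suc i)"
      using res that by (simp add: free_res_def im_def)
    then show ?thesis by (simp add: rel_def mat_app_lc h_def vecs_vec_on)
  qed
  have im1: "im 1 = line 0 P" and b0: "b 0 = 1"
    using res by (auto simp: free_res_def im_def vecs_vec_on line_def lessThan_Suc)
  have sub: "submod (im i)" if i: "i \<ge> 1" for i
  proof (cases "i = 1")
    case True
    then show ?thesis using im1 submod_line[OF P_ideal] by simp
  next
    case False
    then have "im i = rel {..<b (i - 1)} (h (i - 1))"
      using rel[of "i - 1"] i by simp
    then show ?thesis using submod_rel by metis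
  qed
  have base: "ext_van P 0 {..<b (i - 1)} (im i)" if i: "i > n" "i \<ge> 1" for i
    unfolding ext_van.simps
  proof (intro allI impI)
    fix f assume f: "lin_on (im i) f"
    \<comment> \<open>The values of f on the columns form a cocycle of the dual complex, since f
      respects the relations between columns.\<close>
    define y where "y k = (if k < b i then f (h i k) else 0)" for k
    have "mat_tapp (b i) (b (Suc i)) (d (Suc i)) y = (\<lambda>_. 0)"
    proof
      fix k
      show "mat_tapp (b i) (b (Suc i)) (d (Suc i)) y k = 0"
      proof (cases "k < b (Suc i)")
        case True
        have "lc {..<b i} (h (Suc i) k) (h i) = (\<lambda>_. 0)"
          using hin[OF True] rel[OF i(2)] by (auto simp: rel_def)
        moreover have "f (lc {..<b i} (h (Suc i) k) (h i)) = (\<Sum>c<b i. h (Suc i) k c * f (h i c))"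
          by (rule lin_lc[OF sub[OF i(2)] f]) (simp add: hin)
        ultimately have "(\<Sum>c<b i. h (Suc i) k c * f (h i c)) = 0"
          using lin_zero[OF sub[OF i(2)] f] by simp
        then show ?thesis using True by (simp add: mat_tapp_def h_def y_def)
      qed (simp add: mat_tapp_def)
    qed
    moreover have "y \<in> vecs (b i)" by (simp add: y_def vecs_def)
    ultimately obtain s where s: "s \<notin> P" "(\<lambda>j. s * y j) \<in> mat_tapp (b (i - 1)) (b i) (d i) ` vecs (b (i - 1))"
      using van[OF i(1)] i(2) unfolding ext_loc_zero_def by (auto split: if_splits)
    \<comment> \<open>A cochain bounding s y is exactly a linear form that agrees with s f on the
      image.\<close>
    then obtain z where z: "(\<lambda>j. s * y j) = mat_tapp (b (i - 1)) (b i) (d i) z" by blast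
    have sy: "s * f (h i k) = (\<Sum>j<b (i - 1). h i k j * z j)" if "k < b i" for k
      using fun_cong[OF z, of k] that by (simp add: y_def mat_tapp_def h_def)
    have "s * f v = (\<Sum>a<b (i - 1). z a * v a)" if "v \<in> im i" for v
    proof -
      have "\<exists>x. v = lc {..<b i} x (h i)" using that unfolding im_lc image_iff by metis
      then obtain x where x: "v = lc {..<b i} x (h i)" ..
      have "f v = (\<Sum>k<b i. x k * f (h i k))"
        unfolding x by (rule lin_lc[OF sub[OF i(2)] f]) (simp add: hin)
      then have "s * f v = (\<Sum>k<b i. x k * (s * f (h i k)))"
        by (simp add: sum_distrib_left mult.left_commute)
      also have "\<dots> = (\<Sum>k<b i. \<Sum>j<b (i - 1). z j * (x k * h i k j))"
        by (intro sum.cong) (simp_all add: sy sum_distrib_left ac_simps)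
      also have "\<dots> = (\<Sum>a<b (i - 1). z a * v a)"
        by (subst sum.swap) (simp add: x lc_def sum_distrib_left)
      finally show ?thesis .
    qed
    then show "\<exists>s c. s \<notin> P \<and> (\<forall>v\<in>im i. s * f v = (\<Sum>a<b (i - 1). c a * v a))"
      using s(1) by blast
  qed
  \<comment> \<open>Each step of \<open>ext_van\<close> passes to the next image, so k steps from P
    reach the image with index k + 1.\<close>
  have shift: "ext_van P 0 {..<b (k + i)} (im (Suc (k + i))) \<Longrightarrow> ext_van P k {..<b i} (im (Suc i))" for k i
  proof (induction k arbitrary: i)
    case (Suc k)
    then have "ext_van P k {..<b (Suc i)} (rel {..<b (Suc i)} (h (Suc i)))"
      using rel[of "Suc i"] by simp
    then show ?case using g[of "Suc i"] by auto
  qed simp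
  have "cyc_van k P" if "k \<ge> n" for k
    using shift[of k 0] base[of "Suc k"] that im1 b0 by (simp add: cyc_van_def lessThan_Suc)
  then show ?thesis using that by blast
qed

text \<open>The product of annihilators of finitely many generators works for all of I and stays
  outside P.\<close>

lemma uniform_annihilator:
  assumes "is_ideal I" "\<And>a. a \<in> I \<Longrightarrow> \<exists>s. s \<notin> P \<and> s * a = 0"
  obtains s where "s \<notin> P" "\<And>a. a \<in> I \<Longrightarrow> s * a = 0"
proof -
  obtain n :: nat and h where h: "I = ideal_gen h n" "\<And>c. c < n \<Longrightarrow> h c \<in> I"
    using ideal_fin_gen[OF noeth assms(1)] by blast
  have "\<forall>c<n. \<exists>s. s \<notin> P \<and> s * h c = 0" using assms(2) h(2) by blast
  then obtain s where s: "\<And>c. c < n \<Longrightarrow> s c \<notin> P \<and> s c * h c = 0" by metis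
  have "prod s {..<n} * a = 0" if "a \<in> I" for a
  proof -
    obtain r where r: "a = (\<Sum>j<n. r j * h j)" using \<open>a \<in> I\<close> h unfolding ideal_gen_def by blast
    have "prod s {..<n} * (r j * h j) = 0" if "j < n" for j
    proof -
      have "prod s {..<n} = s j * prod s ({..<n} - {j})" using that by (simp add: prod.remove)
      then have "prod s {..<n} * (r j * h j) = (s j * h j) * (r j * prod s ({..<n} - {j}))"
        by (simp add: ac_simps)
      then show ?thesis using s[OF that] by simp
    qed
    then show ?thesis unfolding r sum_distrib_left by (intro sum.neutral) auto
  qed
  moreover have "prod s {..<n} \<notin> P" using s by (intro notin_prod) auto
  ultimately show ?thesis using that by blast
qed

text \<open>A zero-dimensional Gorenstein local ring is injective over itself. Descent with x = 0
  reaches Ext^1 because R/0 is free.\<close>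

lemma minimal_ext_van:
  assumes gor: "gorenstein_at P" and min: "\<And>q. is_prime_ideal q \<Longrightarrow> q \<subseteq> P \<Longrightarrow> q = P"
    and "finite A" "submod K" "K \<subseteq> vec_on A"
  shows "ext_van P i A K"
proof (rule ext_van_from_cyclic)
  obtain n where n: "\<And>i. i \<ge> n \<Longrightarrow> cyc_van i P"
    using gorenstein_cyc_van[OF gor] by blast
  have "line 0 (range ((*) 0)) = {\<lambda>_. 0::'a}"
    by (auto simp: line_def vec_on_def fun_eq_iff) (metis gr0I)
  then have "cyc_van j (range ((*) 0))" for j
    using ext_van_free by (simp add: cyc_van_def)
  then have "cyc_van i P"
    using cyc_van_descent[where x = 0 and ?j0.0 = 0] ideal_zero[OF P_ideal] min n by blast
  then show "cyc_van i I" if "is_ideal I" for I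
    using cyc_van_prime_reduction[where x = 0] min that ideal_zero by metis
qed (use assms in auto)

text \<open>Otherwise an ideal above D maximal for avoiding all s x^k is prime; it lies in P (k = 0)
  and misses x (k = 1), so it is a prime strictly below P containing D.\<close>

lemma power_in_ideal:
  assumes only: "\<And>q. is_prime_ideal q \<Longrightarrow> x \<in> q \<Longrightarrow> q \<subseteq> P \<Longrightarrow> q = P"
    and D: "is_ideal D" "\<And>q. is_prime_ideal q \<Longrightarrow> q \<subset> P \<Longrightarrow> \<not> D \<subseteq> q"
    and x: "x \<in> P"
  shows "\<exists>s k. s \<notin> P \<and> s * x ^ k \<in> D"
proof (rule ccontr)
  assume n: "\<not> ?thesis"
  define \<C> where "\<C> = {I. is_ideal I \<and> D \<subseteq> I \<and> (\<forall>s k. s \<notin> P \<longrightarrow> s * x ^ k \<notin> I)}"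
  have "D \<in> \<C>" using D n unfolding \<C>_def by blast
  obtain I where I: "I \<in> \<C>" and mx: "\<And>J. J \<in> \<C> \<Longrightarrow> I \<subseteq> J \<Longrightarrow> J = I"
  proof (rule ideal_maximal[OF noeth \<open>D \<in> \<C>\<close>])
    show "is_ideal J" if "J \<in> \<C>" for J using that by (simp add: \<C>_def)
  qed blast
  have ideal: "is_ideal I" and DI: "D \<subseteq> I" and av: "\<And>s k. s \<notin> P \<Longrightarrow> s * x ^ k \<notin> I"
    using I by (auto simp: \<C>_def)
  have IP: "I \<subseteq> P" using av[where k = 0] by auto
  have hit: "\<exists>s k t. s \<notin> P \<and> s * x ^ k - t * a \<in> I" if "a \<notin> I" for a
  proof -
    have "adjoin I a \<notin> \<C>" using mx[OF _ adjoin_superset] adjoin_self[OF ideal] that by blast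
    then show ?thesis
      using ideal_adjoin[OF ideal] DI adjoin_superset[of I a] unfolding \<C>_def adjoin_def by blast
  qed
  have "is_prime_ideal I"
  proof (rule is_prime_idealI[OF ideal])
    show "I \<noteq> UNIV" using IP one_notin by blast
    fix a b assume ab: "a * b \<in> I" "a \<notin> I" "b \<notin> I"
    obtain s k t where 1: "s \<notin> P" "s * x ^ k - t * a \<in> I" using hit[OF ab(2)] by blast
    obtain s' k' t' where 2: "s' \<notin> P" "s' * x ^ k' - t' * b \<in> I" using hit[OF ab(3)] by blast
    \<comment> \<open>A combination in which the terms with a and b cancel and only the product of
      the two avoided elements remains.\<close>
    have "s' * x ^ k' * (s * x ^ k - t * a) + t * a * (s' * x ^ k' - t' * b) + t * t' * (a * b) \<in> I"
      by (intro ideal_add[OF ideal] ideal_mult[OF ideal 1(2)] ideal_mult[OF ideal 2(2)] ideal_mult[OF ideal ab(1)])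
    moreover have "s' * x ^ k' * (s * x ^ k - t * a) + t * a * (s' * x ^ k' - t' * b) + t * t' * (a * b)
        = (s' * s) * x ^ (k' + k)"
      by (simp add: algebra_simps power_add)
    ultimately show False using av[OF notin_mult[OF 2(1) 1(1)]] by metis
  qed
  moreover have "x \<notin> I" using av[of 1 1] one_notin by auto
  ultimately show False using D(2)[of I] DI IP x by blast
qed

text \<open>\<open>x\<close> acts injectively on \<open>Ext\<^sup>2(R/q, R)\<close> because \<open>Ext\<^sup>2(R/(q + xR), R)\<close> vanishes: a relation
  \<open>y + a x = 0\<close> between the generators of \<open>q\<close> and \<open>x\<close> has \<open>a \<in> q\<close>, and writing \<open>a = \<Sum> b\<^sub>c h\<^sub>c\<close> the value
  \<open>f (y + x b) - F b\<close> with \<open>F = x f\<close> on relations does not depend on \<open>b\<close>.\<close>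
lemma extends_cancel:
  assumes q: "is_prime_ideal q" "x \<notin> q" and van: "cyc_van 1 (adjoin q x)"
    and g: "gens C h (line 0 q)" and f: "lin_on (rel C h) f"
    and xf: "\<And>v. v \<in> rel C h \<Longrightarrow> x * f v = (\<Sum>a\<in>C. c a * v a)"
  shows "\<exists>s c. s \<notin> P \<and> (\<forall>v\<in>rel C h. s * f v = (\<Sum>a\<in>C. c a * v a))"
proof -
  have qi: "is_ideal q" using q by (simp add: is_prime_ideal_def)
  have fin: "finite C" using gens_finite[OF g] .
  obtain c0 where c0: "c0 \<notin> C" using ex_new_if_finite[OF infinite_UNIV_nat fin] by blast
  \<comment> \<open>An element a placed in coordinate 0. The new index c0 carries the additional
    generator x of q + xR.\<close>
  define ex where "ex = (\<lambda>a j. if j = (0::nat) then a else (0::'a))"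
  define hh where "hh e = (if e = c0 then ex x else h e)" for e
  let ?E = "insert c0 C"
  have lcE: "lc ?E y hh = (\<lambda>j. y c0 * ex x j + lc C y h j)" for y
  proof -
    have "lc C y hh = lc C y h" using c0 by (auto simp: hh_def intro!: lc_cong)
    then show ?thesis using fin c0 by (auto simp: lc_def hh_def fun_eq_iff)
  qed
  have lcq: "lc C y h \<in> line 0 q" for y
    by (rule submod_lc[OF submod_line[OF qi]]) (rule gens_in[OF g])
  have exq: "ex a \<in> line 0 q \<longleftrightarrow> a \<in> q" for a
    by (simp add: ex_def line_def vec_on_def)
  have gE: "gens ?E hh (line 0 (adjoin q x))"
    unfolding gens_def
  proof (intro conjI ballI)
    fix e assume "e \<in> ?E"
    then show "hh e \<in> line 0 (adjoin q x)"
      using gens_in[OF g, of e] adjoin_superset[of q x] adjoin_self[OF qi, of x]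
      by (auto simp: hh_def line_def ex_def vec_on_def)
  next
    fix v assume v: "v \<in> line 0 (adjoin q x)"
    then obtain t where t: "v 0 - t * x \<in> q" by (auto simp: line_def adjoin_def)
    have "ex (v 0 - t * x) \<in> line 0 q" using t exq by simp
    then obtain y where y: "y \<in> vec_on C" "ex (v 0 - t * x) = lc C y h" by (rule gens_vec[OF g])
    have "lc C (y(c0 := t)) h = lc C y h" using c0 by (intro lc_cong) auto
    then have "lc ?E (y(c0 := t)) hh = v"
      using v unfolding lcE by (auto simp: y(2)[symmetric] ex_def line_def vec_on_def fun_eq_iff)
    then show "\<exists>y. v = lc ?E y hh" by metis
  qed (use fin in simp)
  have "\<forall>y\<in>rel ?E hh. \<exists>b. b \<in> vec_on C \<and> ex (y c0) = lc C b h"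
  proof
    fix y assume "y \<in> rel ?E hh"
    then have "y c0 * x + lc C y h 0 = 0"
      unfolding rel_def lcE by (auto simp: ex_def dest: fun_cong[of _ _ 0])
    then have "y c0 * x = 0 - lc C y h 0" by (simp add: eq_neg_iff_add_eq_0)
    then have "y c0 * x \<in> q"
      using lcq[of y] ideal_diff[OF qi ideal_zero[OF qi]] by (simp only:) (auto simp: line_def)
    then have "y c0 \<in> q" using q unfolding is_prime_ideal_def by blast
    then show "\<exists>b. b \<in> vec_on C \<and> ex (y c0) = lc C b h"
      using gens_vec[OF g] exq by metis
  qed
  then obtain b where b: "\<And>y. y \<in> rel ?E hh \<Longrightarrow> b y \<in> vec_on C" "\<And>y. y \<in> rel ?E hh \<Longrightarrow> ex (y c0) = lc C (b y) h"
    by metis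
  define F where "F y = (\<Sum>a\<in>C. c a * y a)" for y :: "nat \<Rightarrow> 'a"
  define p where "p y b = (\<lambda>j. restr C y j + x * b j)" for y b :: "nat \<Rightarrow> 'a"
  have prel: "p y b \<in> rel C h" if y: "y \<in> rel ?E hh" and b: "b \<in> vec_on C" "ex (y c0) = lc C b h" for y b
  proof -
    have "p y b = (\<lambda>j. x * b j + restr C y j)" by (simp add: p_def add.commute)
    then have "lc C (p y b) h = (\<lambda>j. x * ex (y c0) j + lc C y h j)"
      using b fin by (simp add: lc_comb lc_restr)
    also have "\<dots> = lc ?E y hh" unfolding lcE by (auto simp: ex_def fun_eq_iff)
    also have "\<dots> = (\<lambda>_. 0)" using y by (simp add: rel_def)
    finally show ?thesis using b restr_vec by (auto simp: rel_def p_def vec_on_def restr_def)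
  qed
  define G where "G y = f (p y (b y)) - F (b y)" for y
  have F_lin: "F (\<lambda>j. r * y j + z j) = r * F y + F z" for r y z
    by (simp add: F_def algebra_simps sum.distrib sum_distrib_left)
  have G: "G y = f (p y e) - F e"
    if y: "y \<in> rel ?E hh" and e: "e \<in> vec_on C" "ex (y c0) = lc C e h" for y e
  proof -
    define d where "d = (\<lambda>j. b y j - e j)"
    have d: "d \<in> rel C h"
      using submod_diff[OF submod_vec b(1)[OF y] e(1)] b(2)[OF y] e(2)
      by (simp add: rel_def d_def lc_diff_left)
    have "p y (b y) = (\<lambda>j. x * d j + p y e j)"
      by (simp add: p_def d_def algebra_simps)
    then have "f (p y (b y)) = x * f d + f (p y e)"
      using lin_comb[OF f d prel[OF y e]] by simp
    moreover have "F (b y) = F d + F e"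
      using F_lin[of 1 d e] by (simp add: d_def)
    ultimately show ?thesis using xf[OF d] by (simp add: G_def F_def)
  qed
  have "lin_on (rel ?E hh) G"
    unfolding lin_on_def
  proof (intro allI ballI)
    fix r y z assume y: "y \<in> rel ?E hh" and z: "z \<in> rel ?E hh"
    let ?w = "\<lambda>j. r * y j + z j" and ?b = "\<lambda>j. r * b y j + b z j"
    have w: "?w \<in> rel ?E hh" by (rule submod_comb[OF submod_rel y z])
    have bw: "?b \<in> vec_on C" using submod_comb[OF submod_vec b(1)[OF y] b(1)[OF z]] .
    have "ex (?w c0) = (\<lambda>j. r * ex (y c0) j + ex (z c0) j)" by (auto simp: ex_def fun_eq_iff)
    then have "ex (?w c0) = lc C ?b h" using b(2)[OF y] b(2)[OF z] by (simp add: lc_comb)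
    then have "G ?w = f (p ?w ?b) - F ?b" by (rule G[OF w bw])
    also have "p ?w ?b = (\<lambda>j. r * p y (b y) j + p z (b z) j)"
      by (simp add: p_def restr_comb) (simp add: algebra_simps)
    also have "f \<dots> = r * f (p y (b y)) + f (p z (b z))"
      by (rule lin_comb[OF f prel[OF y b(1)[OF y] b(2)[OF y]] prel[OF z b(1)[OF z] b(2)[OF z]]])
    finally show "G ?w = r * G y + G z"
      unfolding F_lin G_def[of y] G_def[of z] by (simp add: algebra_simps)
  qed
  moreover have "ext_van P 0 ?E (rel ?E hh)"
  proof -
    obtain D k where "gens D k (line 0 (adjoin q x))" "ext_van P 0 D (rel D k)"
      using van unfolding cyc_van_def One_nat_def ext_van.simps(2) by blast
    then show ?thesis
      using ext_van_independent[OF submod_line[OF ideal_adjoin[OF qi]] _ gE] by metis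
  qed
  ultimately have "\<exists>s c. s \<notin> P \<and> (\<forall>v\<in>rel ?E hh. s * G v = (\<Sum>a\<in>?E. c a * v a))"
    unfolding ext_van.simps by blast
  then obtain s c' where s: "s \<notin> P" "\<And>v. v \<in> rel ?E hh \<Longrightarrow> s * G v = (\<Sum>a\<in>?E. c' a * v a)"
    by blast
  have "s * f v = (\<Sum>a\<in>C. c' a * v a)" if v: "v \<in> rel C h" for v
  proof -
    \<comment> \<open>A relation of h is a relation of the larger family with coefficient 0 at x, so
      b = 0 is allowed and G agrees with f there.\<close>
    have v0: "v c0 = 0" and vC: "v \<in> vec_on C" using v c0 by (auto simp: rel_def vec_on_def)
    then have vE: "v \<in> rel ?E hh"
      using v by (auto simp: rel_def lcE vec_on_def)
    have e0: "ex (v c0) = lc C (\<lambda>_. 0) h" using v0 by (simp add: ex_def lc_def fun_eq_iff)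
    have "G v = f (p v (\<lambda>_. 0)) - F (\<lambda>_. 0)"
      by (rule G[OF vE submod_zero[OF submod_vec] e0])
    then have "G v = f v" using restr_id[OF vC] by (simp add: p_def F_def)
    then show ?thesis using s(2)[OF vE] fin c0 v0 by simp
  qed
  then show ?thesis using s(1) by blast
qed

end

text \<open>By filtration it suffices to treat R/q for primes q in P. If x lies in q, then q = P and
  descent applies. Otherwise a class in Ext^2(R/q, R) dies at every smaller prime, hence locally at
  P is killed by a power of x, and x acts injectively.\<close>

lemma height_one_ext_van:
  fixes P :: "'a::comm_ring_1 set"
  assumes "prime_loc P" and gor: "gorenstein_at P" and x: "x \<in> P"
    and nzd: "\<And>a. x * a = 0 \<Longrightarrow> \<exists>s. s \<notin> P \<and> s * a = 0"
    and only: "\<And>q. is_prime_ideal q \<Longrightarrow> x \<in> q \<Longrightarrow> q \<subseteq> P \<Longrightarrow> q = P"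
    and gen: "\<And>q B (K :: (nat \<Rightarrow> 'a) set). is_prime_ideal q \<Longrightarrow> q \<subset> P \<Longrightarrow> finite B \<Longrightarrow> submod K \<Longrightarrow>
      K \<subseteq> vec_on B \<Longrightarrow> ext_van q 0 B K"
    and A: "finite A" "submod K" "K \<subseteq> vec_on A"
  shows "ext_van P 1 A K"
proof -
  interpret prime_loc P by fact
  obtain n where n: "\<And>i. i \<ge> n \<Longrightarrow> cyc_van i P"
    using gorenstein_cyc_van[OF gor] by blast
  have annx: "is_ideal {a. x * a = 0}"
    by (simp add: is_ideal_def distrib_left mult.left_commute)
  obtain s where s: "s \<notin> P" "\<And>a. x * a = 0 \<Longrightarrow> s * a = 0"
    using uniform_annihilator[OF annx] nzd by auto
  \<comment> \<open>The syzygy of R/xR is the annihilator of x, which some s outside P kills; so Ext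
    vanishes from degree 2 on.\<close>
  have princ: "cyc_van j (range ((*) x))" if j: "j \<ge> 1" for j
  proof -
    obtain i where i: "j = Suc i" using j by (cases j) auto
    define h where "h = (\<lambda>(c::nat) j. if j = (0::nat) then x else 0)"
    have lch: "lc {0} y h = (\<lambda>j. if j = 0 then x * y 0 else 0)" for y
      by (auto simp: lc_def h_def fun_eq_iff mult.commute)
    have "gens {0} h (line 0 (range ((*) x)))"
      unfolding gens_def
    proof (intro conjI ballI)
      fix v assume "v \<in> line 0 (range ((*) x))"
      then obtain a where a: "v 0 = x * a" "v \<in> vec_on {0}" by (auto simp: line_def)
      then have "v = lc {0} (\<lambda>_. a) h" unfolding lch by (auto simp: vec_on_def fun_eq_iff)
      then show "\<exists>y. v = lc {0} y h" by blast
    qed (auto simp: h_def line_def vec_on_def intro!: range_eqI[of _ _ 1])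
    moreover have "ext_van P i {0} (rel {0} h)"
    proof (rule ext_van_null[OF _ submod_rel _ s(1)])
      fix v assume "v \<in> rel {0} h"
      then have "x * v 0 = 0" "v \<in> vec_on {0}"
        by (auto simp: rel_def lch dest: fun_cong[of _ _ 0])
      then show "(\<lambda>j. s * v j) = (\<lambda>_. 0)" using s(2) by (auto simp: vec_on_def fun_eq_iff) (metis gr0I mult_zero_right)
    qed (auto simp: rel_def)
    ultimately show ?thesis unfolding cyc_van_def i by auto
  qed
  have P1: "cyc_van 1 P"
    using cyc_van_descent[OF x only princ n] by simp
  have xI: "cyc_van 1 I" if "is_ideal I" "x \<in> I" for I
    using cyc_van_prime_reduction[OF _ that] only P1 by metis
  have "cyc_van 1 q" if q: "is_prime_ideal q" "q \<subseteq> P" for q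
  proof (cases "x \<in> q")
    case True
    then show ?thesis using only q P1 by blast
  next
    case False
    have qi: "is_ideal q" using q by (simp add: is_prime_ideal_def)
    obtain C h where g: "gens C h (line 0 q)"
      using submod_fin_gen[OF noeth _ submod_line[OF qi] line_vec] by blast
    have van: "cyc_van 1 (adjoin q x)"
      by (rule xI[OF ideal_adjoin[OF qi] adjoin_self[OF qi]])
    have "ext_van P 0 C (rel C h)"
      unfolding ext_van.simps
    proof (intro allI impI)
      fix f assume f: "lin_on (rel C h) f"
      \<comment> \<open>The annihilator of the class of f in Ext^1 of the ideal q.\<close>
      define D where "D = {r. \<exists>c. \<forall>v\<in>rel C h. r * f v = (\<Sum>a\<in>C. c a * v a)}"
      have Di: "is_ideal D"
        unfolding is_ideal_def
      proof (intro conjI ballI allI)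
        show "0 \<in> D" by (auto simp: D_def intro!: exI[of _ "\<lambda>_. 0"])
        fix r a b assume "a \<in> D"
        then obtain c where c: "\<And>v. v \<in> rel C h \<Longrightarrow> a * f v = (\<Sum>a\<in>C. c a * v a)" by (auto simp: D_def)
        then have "\<forall>v\<in>rel C h. r * a * f v = (\<Sum>a\<in>C. (r * c a) * v a)"
          by (simp add: mult.assoc sum_distrib_left[symmetric])
        then show "r * a \<in> D" unfolding D_def by (intro CollectI exI)
        assume "b \<in> D"
        then obtain e where e: "\<And>v. v \<in> rel C h \<Longrightarrow> b * f v = (\<Sum>a\<in>C. e a * v a)" by (auto simp: D_def)
        then have "\<forall>v\<in>rel C h. (a + b) * f v = (\<Sum>a\<in>C. (c a + e a) * v a)"
          using c by (simp add: distrib_right sum.distrib)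
        then show "a + b \<in> D" unfolding D_def by (intro CollectI exI)
      qed
      have Dq: "\<not> D \<subseteq> q'" if "is_prime_ideal q'" "q' \<subset> P" for q'
      proof -
        have "rel C h \<subseteq> vec_on C" by (auto simp: rel_def)
        then have "ext_van q' 0 C (rel C h)" using gen[OF that gens_finite[OF g] submod_rel] by blast
        then show ?thesis using f unfolding ext_van.simps D_def by blast
      qed
      have "\<exists>s k. s \<notin> P \<and> s * x ^ k \<in> D"
      proof (rule power_in_ideal[OF _ Di _ x])
        show "q = P" if "is_prime_ideal q" "x \<in> q" "q \<subseteq> P" for q using only[OF that] .
        show "\<not> D \<subseteq> q" if "is_prime_ideal q" "q \<subset> P" for q using Dq[OF that] .
      qed
      then obtain s k where s: "s \<notin> P" "s * x ^ k \<in> D" by blast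
      then obtain c where "\<And>v. v \<in> rel C h \<Longrightarrow> s * x ^ k * f v = (\<Sum>a\<in>C. c a * v a)"
        unfolding D_def by blast
      then show "\<exists>s c. s \<notin> P \<and> (\<forall>v\<in>rel C h. s * f v = (\<Sum>a\<in>C. c a * v a))"
        using s(1)
      proof (induction k arbitrary: s c)
        case 0
        then show ?case by auto
      next
        case (Suc k)
        \<comment> \<open>The functional s x^k f becomes extendable after one more factor x, so
          \<open>extends_cancel\<close> removes that factor at the price of some t outside
          P.\<close>
        have lin: "lin_on (rel C h) (\<lambda>v. s * x ^ k * f v)"
          using f unfolding lin_on_def by (simp add: algebra_simps)
        have ext: "x * (s * x ^ k * f v) = (\<Sum>a\<in>C. c a * v a)" if "v \<in> rel C h" for v
          using Suc.prems(1)[OF that] by (simp add: algebra_simps)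
        obtain t e where t: "t \<notin> P"
          and e: "\<And>v. v \<in> rel C h \<Longrightarrow> t * (s * x ^ k * f v) = (\<Sum>a\<in>C. e a * v a)"
          using extends_cancel[OF q(1) False van g lin ext] by blast
        show ?case
          by (rule Suc.IH[of "t * s" e]) (use e notin_mult[OF t Suc.prems(2)] in \<open>simp_all add: mult.assoc\<close>)
      qed
    qed
    then show ?thesis unfolding cyc_van_def One_nat_def ext_van.simps(2) using g by blast
  qed
  then have "cyc_van 1 I" if "is_ideal I" for I
    using cyc_van_prime_reduction[where x = 0] that ideal_zero by blast
  then show ?thesis using ext_van_from_cyclic A by blast
qed

section \<open>Heights, depths and gluing\<close>

definition minimal_prime :: "'a::comm_ring_1 set \<Rightarrow> bool" where
  "minimal_prime P \<longleftrightarrow> is_prime_ideal P \<and> (\<forall>q. is_prime_ideal q \<and> q \<subseteq> P \<longrightarrow> q = P)"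

section \<open>Primes of height zero and one, and regular sequences from (S2)\<close>

lemma height_ge:
  assumes "\<And>i. i \<le> k \<Longrightarrow> is_prime_ideal (c i)" "\<And>i. i < k \<Longrightarrow> c i \<subset> c (Suc i)" "c k = P"
  shows "enat k \<le> height P"
  unfolding height_def by (rule Sup_upper) (use assms in blast)

lemma height_minimal:
  assumes "minimal_prime P" shows "height P = 0"
proof -
  have "height P \<le> 0"
    unfolding height_def
  proof (rule Sup_least, clarify)
    fix k c assume c: "\<forall>i\<le>k. is_prime_ideal (c i)" "\<forall>i<k. c i \<subset> c (Suc i)" "P = c k"
    show "enat k \<le> 0"
    proof (cases k)
      case (Suc j)
      then have "is_prime_ideal (c j)" "c j \<subset> P" using c by auto
      then show ?thesis using assms unfolding minimal_prime_def by blast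
    qed (simp add: zero_enat_def)
  qed
  then show ?thesis by simp
qed

lemma height_not_minimal:
  assumes "is_prime_ideal P" "\<not> minimal_prime P" shows "enat 1 \<le> height P"
proof -
  obtain q where "is_prime_ideal q" "q \<subset> P"
    using assms unfolding minimal_prime_def by blast
  then show ?thesis
    using assms by (intro height_ge[where c = "\<lambda>i. if i = 0 then q else P"]) auto
qed

lemma minimal_below_height_one:
  assumes "is_prime_ideal P" "height P \<le> 1" "is_prime_ideal q" "q \<subset> P"
  shows "minimal_prime q"
proof (rule ccontr)
  assume "\<not> minimal_prime q"
  then obtain q' where "is_prime_ideal q'" "q' \<subset> q"
    using assms unfolding minimal_prime_def by blast
  then have "enat 2 \<le> height P"
    using assms
    by (intro height_ge[where c = "\<lambda>i. if i = 0 then q' else if i = 1 then q else P"])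
      (auto simp: numeral_2_eq_2 less_Suc_eq)
  then have "enat 2 \<le> 1" using assms(2) by (rule order_trans)
  then show False by (simp add: one_enat_def)
qed

text \<open>Initial segments of regular sequences are regular, so the absence of one of length k
  bounds the supremum \<open>depth_loc\<close> by k - 1.\<close>

lemma S2_regular_seq:
  assumes S2: "cond_S2 TYPE('a)" and P: "is_prime_ideal (P :: 'a::comm_ring_1 set)"
    and k: "enat k \<le> height P" "k \<le> 2"
  obtains x where "loc_regular_seq P x k"
proof (rule ccontr)
  assume "\<not> thesis"
  then have no: "\<not> loc_regular_seq P x k" for x using that by blast
  then have k0: "k > 0" by (cases k) (auto simp: loc_regular_seq_def)
  have "depth_loc P \<le> enat (k - 1)"
    unfolding depth_loc_def
  proof (rule Sup_least, clarify)
    fix k' x assume x: "loc_regular_seq P x k'"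
    have "loc_regular_seq P x k" if "k \<le> k'"
      using x that unfolding loc_regular_seq_def by auto
    then show "enat k' \<le> enat (k - 1)" using no by fastforce
  qed
  moreover have "min 2 (height P) \<le> depth_loc P"
    using S2 P unfolding cond_S2_def by blast
  moreover have "enat k \<le> min 2 (height P)"
    using k by (simp add: numeral_eq_enat)
  ultimately have "enat k \<le> enat (k - 1)" by (meson order_trans)
  then show False using k0 by simp
qed

lemma prime_power: "is_prime_ideal P \<Longrightarrow> r ^ m \<in> P \<Longrightarrow> r \<in> P"
proof (induction m)
  case 0
  then have "r * 1 \<in> P" unfolding is_prime_ideal_def by (intro ideal_mult) simp_all
  then show ?case by simp
qed (auto simp: is_prime_ideal_def)

lemma ideal_trivial: "is_ideal {0}"
  by (simp add: is_ideal_def)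

text \<open>A maximal annihilator of a nonzero multiple of z is an associated prime of R. Were it
  not minimal, (S2) would give a local nonzerodivisor in it, yet all its elements kill that
  multiple.\<close>

lemma S2_annihilator_minimal:
  fixes z :: "'a::comm_ring_1"
  assumes noeth: "noetherian_ring TYPE('a)" and S2: "cond_S2 TYPE('a)" and "z \<noteq> 0"
  obtains t where "minimal_prime (colon {0} (t * z))"
proof -
  define \<C> where "\<C> = {colon {0} (t * z) | t. t * z \<noteq> 0}"
  have C0: "colon {0} (1 * z) \<in> \<C>" unfolding \<C>_def using \<open>z \<noteq> 0\<close> by (intro CollectI exI[of _ 1]) simp
  obtain I where I: "I \<in> \<C>" and mx: "\<And>J. J \<in> \<C> \<Longrightarrow> I \<subseteq> J \<Longrightarrow> J = I"
  proof (rule ideal_maximal[OF noeth C0])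
    show "is_ideal J" if "J \<in> \<C>" for J using that ideal_colon[OF ideal_trivial] by (auto simp: \<C>_def)
  qed blast
  obtain t where t: "I = colon {0} (t * z)" "t * z \<noteq> 0" using I unfolding \<C>_def by blast
  have prime: "is_prime_ideal I"
  proof (rule is_prime_idealI)
    show "is_ideal I" using t ideal_colon[OF ideal_trivial] by simp
    have "1 \<notin> I" using t by (simp add: colon_def)
    then show "I \<noteq> UNIV" by blast
    fix a b assume ab: "a * b \<in> I" "a \<notin> I" "b \<notin> I"
    have "(a * t) * z \<noteq> 0" using ab t by (simp add: colon_def mult.assoc)
    then have "colon {0} ((a * t) * z) \<in> \<C>" unfolding \<C>_def by blast
    moreover have "I \<subseteq> colon {0} ((a * t) * z)"
      unfolding t colon_def by (auto simp: mult.assoc mult.left_commute[of _ a])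
    ultimately have "colon {0} ((a * t) * z) = I" by (rule mx)
    moreover have "b \<in> colon {0} ((a * t) * z)"
      using ab(1) unfolding t colon_def by (simp add: ac_simps)
    ultimately show False using ab by simp
  qed
  have "minimal_prime I"
  proof (rule ccontr)
    assume "\<not> minimal_prime I"
    then obtain x where x: "loc_regular_seq I x 1"
      using S2_regular_seq[OF S2 prime height_not_minimal[OF prime]] by auto
    then have "x 0 * (t * z) = 0" using t by (simp add: loc_regular_seq_def colon_def)
    moreover have "1 \<notin> I" using t by (simp add: colon_def)
    ultimately have "loc_mem I (ideal_gen x 0) (x 0 * (t * z))"
      unfolding loc_mem_def ideal_gen_def by (intro exI[of _ 1]) simp
    then have "loc_mem I (ideal_gen x 0) (t * z)" using x by (simp add: loc_regular_seq_def)
    then obtain s where "s \<notin> I" "s * (t * z) = 0" by (auto simp: loc_mem_def ideal_gen_def)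
    then show False using t by (simp add: colon_def)
  qed
  then show ?thesis using that t by blast
qed

text \<open>There are no embedded primes, so an element that vanishes at all minimal primes is
  0.\<close>

lemma S2_zero:
  fixes z :: "'a::comm_ring_1"
  assumes noeth: "noetherian_ring TYPE('a)" and S2: "cond_S2 TYPE('a)"
    and loc: "\<And>q. minimal_prime q \<Longrightarrow> \<exists>s. s \<notin> q \<and> s * z = 0"
  shows "z = 0"
proof (rule ccontr)
  assume "z \<noteq> 0"
  then obtain t where t: "minimal_prime (colon {0} (t * z))"
    using S2_annihilator_minimal[OF noeth S2] by blast
  then obtain s where s: "s \<notin> colon {0} (t * z)" "s * z = 0" using loc by blast
  have "s * (t * z) = t * (s * z)" by (rule mult.left_commute)
  then show False using s by (simp add: colon_def)
qed

text \<open>The \<phi> r / r^m are one fraction, defined wherever some r in I is invertible, hence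
  at all primes of height at most 1. Its obstruction to lying in R would have an associated prime
  containing I, of height at least 2, where depth 2 removes it.\<close>

lemma S2_glue:
  fixes \<phi> :: "'a::comm_ring_1 \<Rightarrow> 'a"
  assumes noeth: "noetherian_ring TYPE('a)" and S2: "cond_S2 TYPE('a)"
    and I: "\<And>P. is_prime_ideal P \<Longrightarrow> height P \<le> 1 \<Longrightarrow> \<exists>r\<in>I. r \<notin> P"
    and compat: "\<And>r r'. r \<in> I \<Longrightarrow> r' \<in> I \<Longrightarrow> r ^ m * \<phi> r' = r' ^ m * \<phi> r"
  obtains c where "\<And>r. r \<in> I \<Longrightarrow> \<phi> r = r ^ m * c"
proof -
  \<comment> \<open>The denominators of t times the common fraction, that is, the annihilator of its
    class modulo R.\<close>
  define D where "D t = {d. \<exists>c. \<forall>r\<in>I. d * t * \<phi> r = r ^ m * c}" for t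
  have D_ideal: "is_ideal (D t)" for t
    unfolding is_ideal_def
  proof (intro conjI ballI allI)
    show "0 \<in> D t" by (auto simp: D_def intro!: exI[of _ 0])
    fix a b r assume "a \<in> D t"
    then obtain c where c: "\<And>r. r \<in> I \<Longrightarrow> a * t * \<phi> r = r ^ m * c" by (auto simp: D_def)
    have "\<forall>u\<in>I. r * a * t * \<phi> u = u ^ m * (r * c)"
      using c by (metis mult.assoc mult.left_commute)
    then show "r * a \<in> D t" unfolding D_def by blast
    assume "b \<in> D t"
    then obtain e where e: "\<And>r. r \<in> I \<Longrightarrow> b * t * \<phi> r = r ^ m * e" by (auto simp: D_def)
    have "\<forall>u\<in>I. (a + b) * t * \<phi> u = u ^ m * (c + e)"
      using c e by (simp add: distrib_left distrib_right)
    then show "a + b \<in> D t" unfolding D_def by blast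
  qed
  have "1 \<in> D 1"
  proof (rule ccontr)
    assume n: "1 \<notin> D 1"
    define \<C> where "\<C> = {D t | t. 1 \<notin> D t}"
    have C0: "D 1 \<in> \<C>" using n unfolding \<C>_def by blast
    obtain P where P: "P \<in> \<C>" and mx: "\<And>J. J \<in> \<C> \<Longrightarrow> P \<subseteq> J \<Longrightarrow> J = P"
    proof (rule ideal_maximal[OF noeth C0])
      show "is_ideal J" if "J \<in> \<C>" for J using that D_ideal by (auto simp: \<C>_def)
    qed blast
    obtain t where t: "P = D t" "1 \<notin> D t" using P unfolding \<C>_def by blast
    have prime: "is_prime_ideal P"
    proof (rule is_prime_idealI)
      show "is_ideal P" using t D_ideal by simp
      show "P \<noteq> UNIV" using t by blast
      fix a b assume ab: "a * b \<in> P" "a \<notin> P" "b \<notin> P"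
      have D_mult: "d \<in> D (a * t) \<longleftrightarrow> a * d \<in> D t" for d
        unfolding D_def by (simp add: ac_simps)
      have "1 \<notin> D (a * t)" using ab t by (simp add: D_mult)
      then have "D (a * t) \<in> \<C>" unfolding \<C>_def by blast
      moreover have "P \<subseteq> D (a * t)" using t ideal_mult[OF D_ideal] by (auto simp: D_mult)
      ultimately have "D (a * t) = P" by (rule mx)
      then show False using ab t D_mult by blast
    qed
    have IP: "r \<in> P" if "r \<in> I" for r
    proof -
      \<comment> \<open>Compatibility makes t \<phi>(r) the numerator belonging to the denominator
        r^m.\<close>
      have "\<forall>u\<in>I. r ^ m * t * \<phi> u = u ^ m * (t * \<phi> r)"
        using compat[OF that] by (metis mult.assoc mult.left_commute)
      then have "r ^ m \<in> P" unfolding t D_def by blast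
      then show ?thesis by (rule prime_power[OF prime])
    qed
    interpret prime_loc P using noeth prime by unfold_locales
    have "\<not> height P \<le> 1" using I[OF prime] IP by blast
    then have "enat 2 \<le> height P"
      by (metis ileI1 linorder_not_le eSuc_enat one_enat_def Suc_1)
    then obtain x where x: "loc_regular_seq P x 2"
      using S2_regular_seq[OF S2 prime] by blast
    have xP: "x 0 \<in> P" "x 1 \<in> P"
      and reg: "\<And>i a. i < 2 \<Longrightarrow> loc_mem P (ideal_gen x i) (x i * a) \<Longrightarrow> loc_mem P (ideal_gen x i) a"
      using x by (auto simp: loc_regular_seq_def)
    obtain c0 where c0: "\<And>r. r \<in> I \<Longrightarrow> x 0 * t * \<phi> r = r ^ m * c0" using xP(1) unfolding t D_def by blast
    obtain c1 where c1: "\<And>r. r \<in> I \<Longrightarrow> x 1 * t * \<phi> r = r ^ m * c1" using xP(2) unfolding t D_def by blast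
    \<comment> \<open>Both products represent x_0 x_1 t times the fraction, so r^m kills their
      difference; r is a unit at a minimal prime for suitable r.\<close>
    have kill: "r ^ m * (x 1 * c0 - x 0 * c1) = 0" if "r \<in> I" for r
    proof -
      have "r ^ m * (x 1 * c0 - x 0 * c1) = x 1 * (r ^ m * c0) - x 0 * (r ^ m * c1)"
        by (simp add: algebra_simps)
      also have "\<dots> = 0" unfolding c0[OF that, symmetric] c1[OF that, symmetric]
        by (simp add: algebra_simps)
      finally show ?thesis .
    qed
    have "x 1 * c0 - x 0 * c1 = 0"
    proof (rule S2_zero[OF noeth S2])
      fix q :: "'a set" assume q: "minimal_prime q"
      then have "is_prime_ideal q" by (simp add: minimal_prime_def)
      moreover have "height q \<le> 1" using height_minimal[OF q] by simp
      ultimately obtain r where "r \<in> I" "r \<notin> q" using I by blast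
      then show "\<exists>s. s \<notin> q \<and> s * (x 1 * c0 - x 0 * c1) = 0"
        using kill prime_power[OF \<open>is_prime_ideal q\<close>] by blast
    qed
    \<comment> \<open>Now x_1 c_0 is a multiple of x_0; regularity of x_1 modulo x_0 makes c_0
      locally a multiple e x_0, and e is the value sought.\<close>
    then have "1 * (x 1 * c0) = (\<Sum>j<1. c1 * x j)" by (simp add: mult.commute)
    then have "1 * (x 1 * c0) \<in> ideal_gen x 1"
      unfolding ideal_gen_def by (intro CollectI exI[of _ "\<lambda>_. c1"]) simp
    then have "loc_mem P (ideal_gen x 1) (x 1 * c0)" using one_notin unfolding loc_mem_def by blast
    then have "loc_mem P (ideal_gen x 1) c0" using reg[of 1] by simp
    then obtain s e where s: "s \<notin> P" "s * c0 = e * x 0"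
      by (auto simp: loc_mem_def ideal_gen_def)
    have K: "is_ideal {a. x 0 * a = 0}" by (simp add: is_ideal_def distrib_left mult.left_commute)
    have "\<exists>u. u \<notin> P \<and> u * a = 0" if "x 0 * a = 0" for a
    proof -
      have "loc_mem P (ideal_gen x 0) (x 0 * a)"
        using that one_notin unfolding loc_mem_def ideal_gen_def by (intro exI[of _ 1]) simp
      then have "loc_mem P (ideal_gen x 0) a" using reg[of 0] by simp
      then show ?thesis by (auto simp: loc_mem_def ideal_gen_def)
    qed
    then obtain u where u: "u \<notin> P" "\<And>a. x 0 * a = 0 \<Longrightarrow> u * a = 0"
      using uniform_annihilator[OF K] by auto
    \<comment> \<open>Cancelling x_0 costs the factor u, which serves for all r at once. Then u s is
      a denominator outside P, although P consists of all denominators.\<close>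
    have "u * s * t * \<phi> r = r ^ m * (u * e)" if "r \<in> I" for r
    proof -
      have "x 0 * (s * t * \<phi> r - r ^ m * e) = s * (x 0 * t * \<phi> r) - r ^ m * (e * x 0)"
        by (simp add: algebra_simps)
      also have "\<dots> = r ^ m * (s * c0) - r ^ m * (e * x 0)"
        unfolding c0[OF that] by (simp add: algebra_simps)
      finally have "x 0 * (s * t * \<phi> r - r ^ m * e) = 0" using s by simp
      then have "u * (s * t * \<phi> r - r ^ m * e) = 0" by (rule u(2))
      then show ?thesis by (simp add: algebra_simps)
    qed
    then have "u * s \<in> P" unfolding t D_def by blast
    then show False using notin_mult[OF u(1) s(1)] by blast
  qed
  then obtain c where "\<forall>r\<in>I. 1 * 1 * \<phi> r = r ^ m * c" unfolding D_def by blast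
  then show ?thesis using that[of c] by simp
qed

section \<open>Vanishing of Ext at primes of height at most one\<close>

lemma G1_ext_van_minimal:
  fixes P :: "'a::comm_ring_1 set"
  assumes noeth: "noetherian_ring TYPE('a)" and G1: "cond_G1 TYPE('a)" and P: "minimal_prime P"
    and "finite A" "submod K" "K \<subseteq> vec_on A"
  shows "ext_van P i A K"
proof -
  have prime: "is_prime_ideal P" using P by (simp add: minimal_prime_def)
  interpret prime_loc P using noeth prime by unfold_locales
  have "gorenstein_at P" using G1 prime height_minimal[OF P] unfolding cond_G1_def by simp
  then show ?thesis
    by (rule minimal_ext_van) (use P assms in \<open>auto simp: minimal_prime_def\<close>)
qed

text \<open>If P is not minimal, (S2) supplies an element of P regular on R_P, and smaller primes
  are minimal, where all Ext vanish.\<close>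

lemma G1_S2_ext_van:
  fixes P :: "'a::comm_ring_1 set"
  assumes noeth: "noetherian_ring TYPE('a)" and G1: "cond_G1 TYPE('a)" and S2: "cond_S2 TYPE('a)"
    and prime: "is_prime_ideal P" and ht: "height P \<le> 1"
    and A: "finite A" "submod K" "K \<subseteq> vec_on A"
  shows "ext_van P 1 A K"
proof (cases "minimal_prime P")
  case True
  then show ?thesis using G1_ext_van_minimal[OF noeth G1 _ A] by blast
next
  case False
  have pl: "prime_loc P" using noeth prime by unfold_locales
  interpret prime_loc P by (rule pl)
  obtain x where x: "loc_regular_seq P x 1"
    using S2_regular_seq[OF S2 prime height_not_minimal[OF prime False]] by auto
  have nzd: "\<exists>s. s \<notin> P \<and> s * a = 0" if "x 0 * a = 0" for a
  proof -
    have "loc_mem P (ideal_gen x 0) (x 0 * a)"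
      using that one_notin unfolding loc_mem_def ideal_gen_def by (intro exI[of _ 1]) simp
    then have "loc_mem P (ideal_gen x 0) a" using x by (simp add: loc_regular_seq_def)
    then show ?thesis by (auto simp: loc_mem_def ideal_gen_def)
  qed
  show ?thesis
  proof (rule height_one_ext_van[OF pl _ _ nzd _ _ A])
    show "gorenstein_at P" using G1 prime ht unfolding cond_G1_def by blast
    show "x 0 \<in> P" using x by (simp add: loc_regular_seq_def)
    show "q = P" if q: "is_prime_ideal q" "x 0 \<in> q" "q \<subseteq> P" for q
    proof (rule ccontr)
      assume "q \<noteq> P"
      then have min: "minimal_prime q" using minimal_below_height_one[OF prime ht q(1)] q by blast
      interpret q: prime_loc q using noeth q by unfold_locales
      \<comment> \<open>A minimal prime q is the annihilator of some y. If x_0 in q kills y,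
        regularity gives s outside P killing y, so s lies in q and hence in P.\<close>
      have "{0} \<subseteq> q" using ideal_zero[OF q.P_ideal] by blast
      then obtain y where y: "is_prime_ideal (colon {0} y)" "colon {0} y \<subseteq> q"
        using q.colon_prime_exists[OF ideal_trivial] by blast
      then have eq: "colon {0} y = q" using min unfolding minimal_prime_def by blast
      then have "x 0 * y = 0" using q by (auto simp: colon_def)
      then obtain s where "s \<notin> P" "s * y = 0" using nzd by blast
      then show False using eq q by (auto simp: colon_def)
    qed
    show "ext_van q 0 B L" if "is_prime_ideal q" "q \<subset> P" "finite B" "submod L" "L \<subseteq> vec_on B"
      for q B and L :: "(nat \<Rightarrow> 'a) set"
      using G1_ext_van_minimal[OF noeth G1 minimal_below_height_one[OF prime ht that(1,2)] that(3-5)] .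
  qed
qed

section \<open>Alternating forms on dual modules\<close>

lemma alt_cong: "\<Phi> \<in> alt_forms K n \<Longrightarrow> (\<And>i. i < n \<Longrightarrow> f i = g i) \<Longrightarrow> \<Phi> f = \<Phi> g"
  unfolding alt_forms_def by blast

lemma alt_add:
  assumes "\<Phi> \<in> alt_forms K n" "\<And>j. j < n \<Longrightarrow> f j \<in> dual_on K" "i < n" "u \<in> dual_on K" "v \<in> dual_on K"
  shows "\<Phi> (f(i := (\<lambda>x. u x + v x))) = \<Phi> (f(i := u)) + \<Phi> (f(i := v))"
  using assms unfolding alt_forms_def by blast

lemma alt_scale:
  assumes "\<Phi> \<in> alt_forms K n" "\<And>j. j < n \<Longrightarrow> f j \<in> dual_on K" "i < n" "u \<in> dual_on K"
  shows "\<Phi> (f(i := (\<lambda>x. r * u x))) = r * \<Phi> (f(i := u))"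
  using assms unfolding alt_forms_def by blast

lemma alt_equal:
  assumes "\<Phi> \<in> alt_forms K n" "\<And>j. j < n \<Longrightarrow> f j \<in> dual_on K" "i < n" "j < n" "i \<noteq> j" "f i = f j"
  shows "\<Phi> f = 0"
  using assms unfolding alt_forms_def by blast

lemma alt_formsI:
  assumes "\<And>f g. (\<And>i. i < n \<Longrightarrow> f i = g i) \<Longrightarrow> \<Phi> f = \<Phi> g"
    and "\<And>f i u v. (\<And>j. j < n \<Longrightarrow> f j \<in> dual_on K) \<Longrightarrow> i < n \<Longrightarrow> u \<in> dual_on K \<Longrightarrow> v \<in> dual_on K \<Longrightarrow>
      \<Phi> (f(i := (\<lambda>x. u x + v x))) = \<Phi> (f(i := u)) + \<Phi> (f(i := v))"
    and "\<And>f i u r. (\<And>j. j < n \<Longrightarrow> f j \<in> dual_on K) \<Longrightarrow> i < n \<Longrightarrow> u \<in> dual_on K \<Longrightarrow>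
      \<Phi> (f(i := (\<lambda>x. r * u x))) = r * \<Phi> (f(i := u))"
    and "\<And>f i j. (\<And>k. k < n \<Longrightarrow> f k \<in> dual_on K) \<Longrightarrow> i < j \<Longrightarrow> j < n \<Longrightarrow> f i = f j \<Longrightarrow> \<Phi> f = 0"
  shows "\<Phi> \<in> alt_forms K n"
  unfolding alt_forms_def
proof (rule CollectI, intro conjI allI impI, goal_cases)
  case (4 f i j)
  then show ?case using assms(4)[of f i j] assms(4)[of f j i] by (cases "i < j") auto
qed (use assms(1-3) in blast)+

lemma dual_add: "u \<in> dual_on K \<Longrightarrow> v \<in> dual_on K \<Longrightarrow> (\<lambda>x. u x + v x) \<in> dual_on K"
  unfolding dual_on_def by (auto simp: algebra_simps)

lemma dual_scale: "u \<in> dual_on K \<Longrightarrow> (\<lambda>x. r * u x) \<in> dual_on K"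
  unfolding dual_on_def by (auto simp: algebra_simps)

lemma dual_outside: "u \<in> dual_on K \<Longrightarrow> x \<notin> K \<Longrightarrow> u x = 0"
  unfolding dual_on_def by blast

lemma dual_lin:
  assumes "submod K" "u \<in> dual_on K" shows "lin_on K u"
  unfolding lin_on_def
proof (intro allI ballI)
  fix r x y assume x: "x \<in> K" and y: "y \<in> K"
  have "u (\<lambda>j. r * x j + y j) = u (\<lambda>j. r * x j) + u y"
    using assms submod_scale[OF assms(1) x, of r] y by (simp add: dual_on_def)
  then show "u (\<lambda>j. r * x j + y j) = r * u x + u y"
    using assms x by (simp add: dual_on_def)
qed

lemma lin_dual:
  assumes "submod K" "lin_on K u" shows "(\<lambda>x. if x \<in> K then u x else 0) \<in> dual_on K"
  using assms unfolding dual_on_def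
  by (simp add: lin_add lin_scale submod_add submod_scale)

lemma alt_swap:
  assumes \<Phi>: "\<Phi> \<in> alt_forms K n" and f: "\<And>j. j < n \<Longrightarrow> f j \<in> dual_on K"
    and ij: "i < n" "j < n" "i \<noteq> j" and uv: "u \<in> dual_on K" "v \<in> dual_on K"
  shows "\<Phi> (f(i := u, j := v)) = - \<Phi> (f(i := v, j := u))"
proof -
  define w where "w = (\<lambda>x. u x + v x)"
  have w: "w \<in> dual_on K" unfolding w_def by (rule dual_add[OF uv])
  have d: "(f(a := b)) k \<in> dual_on K" if "b \<in> dual_on K" "k < n" for a b k using f that by simp
  have *: "\<Phi> (f(i := a, j := a)) = 0" if "a \<in> dual_on K" for a
    using f that ij by (intro alt_equal[OF \<Phi> _ ij]) auto
  have 1: "\<Phi> (f(i := a, j := w)) = \<Phi> (f(i := a, j := u)) + \<Phi> (f(i := a, j := v))"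
    if "a \<in> dual_on K" for a
    unfolding w_def by (rule alt_add[OF \<Phi> d[OF that] ij(2) uv])
  have "\<Phi> ((f(j := w))(i := (\<lambda>x. u x + v x))) = \<Phi> ((f(j := w))(i := u)) + \<Phi> ((f(j := w))(i := v))"
    by (rule alt_add[OF \<Phi> d[OF w] ij(1) uv])
  then have "0 = \<Phi> (f(i := u, j := w)) + \<Phi> (f(i := v, j := w))"
    using *[OF w] ij(3) by (simp add: fun_upd_twist w_def[symmetric])
  then show ?thesis
    using 1 uv *[OF uv(1)] *[OF uv(2)] by (simp add: eq_neg_iff_add_eq_0)
qed

text \<open>Used with k one less than the number of slots: the last slot stays fixed, and the factor
  is r^n instead of r^(n+1).\<close>

lemma alt_scale_many:
  assumes \<Phi>: "\<Phi> \<in> alt_forms K n" and f: "\<And>j. j < n \<Longrightarrow> f j \<in> dual_on K" and "k \<le> n"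
  shows "\<Phi> (\<lambda>i. if i < k then (\<lambda>x. r * f i x) else f i) = r ^ k * \<Phi> f"
  using \<open>k \<le> n\<close>
proof (induction k)
  case (Suc k)
  let ?g = "\<lambda>i. if i < k then (\<lambda>x. r * f i x) else f i"
  have g: "?g j \<in> dual_on K" if "j < n" for j using f[OF that] by (simp add: dual_scale)
  have e1: "(\<lambda>i. if i < Suc k then (\<lambda>x. r * f i x) else f i) = ?g(k := (\<lambda>x. r * f k x))"
    by (auto simp: fun_eq_iff less_Suc_eq)
  have e2: "\<Phi> (?g(k := (\<lambda>x. r * f k x))) = r * \<Phi> (?g(k := f k))"
    using Suc.prems f by (intro alt_scale[OF \<Phi> g]) auto
  have e3: "?g(k := f k) = ?g" by (auto simp: fun_eq_iff)
  show ?case unfolding e1 e2 e3 using Suc by (simp add: mult.assoc)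
qed simp

text \<open>The restrictions to K of the dual basis vectors of R^n, at which
  \<open>char_of_pres\<close> evaluates.\<close>

definition coord_on :: "(nat \<Rightarrow> 'a::comm_ring_1) set \<Rightarrow> nat \<Rightarrow> (nat \<Rightarrow> 'a) \<Rightarrow> 'a" where
  "coord_on K = (\<lambda>i x. if x \<in> K then x i else 0)"

lemma coord_dual: "submod K \<Longrightarrow> coord_on K i \<in> dual_on K"
  unfolding coord_on_def by (rule lin_dual) (simp_all add: lin_on_def)

section \<open>Dropping the last generator\<close>

locale alt_drop =
  fixes K :: "(nat \<Rightarrow> 'a::comm_ring_1) set" and n :: nat and \<Phi>
  assumes noeth: "noetherian_ring TYPE('a)" and G1: "cond_G1 TYPE('a)" and S2: "cond_S2 TYPE('a)"
    and subK: "submod K" and Kvec: "K \<subseteq> vec_on {..<Suc n}" and \<Phi>: "\<Phi> \<in> alt_forms K (Suc n)"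
begin

sublocale split_pres "{..<n}" "{n}" K
  using subK Kvec by unfold_locales (auto simp: lessThan_Suc)

abbreviation "K' \<equiv> K \<inter> vec_on {..<n}"

text \<open>One multiplier r serves all slots. The last slot holds the coordinate of the generator
  to be dropped, which vanishes on K'.\<close>

definition lifts :: "'a \<Rightarrow> (nat \<Rightarrow> (nat \<Rightarrow> 'a) \<Rightarrow> 'a) \<Rightarrow> (nat \<Rightarrow> (nat \<Rightarrow> 'a) \<Rightarrow> 'a) \<Rightarrow> bool" where
  "lifts r f F \<longleftrightarrow> (\<forall>i<n. F i \<in> dual_on K \<and> (\<forall>v\<in>K'. F i v = r * f i v)) \<and> F n = coord_on K n"

lemma lifts_dual: "lifts r f F \<Longrightarrow> j < Suc n \<Longrightarrow> F j \<in> dual_on K"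
  using coord_dual[OF subK] by (auto simp: lifts_def less_Suc_eq)

text \<open>The i-th slot factors through the ideal L of last coordinates. At a minimal prime
  Ext^1(R/L, R) vanishes, so a multiple of that slot is a multiple of the last coordinate, and the
  form has two proportional arguments.\<close>

lemma form_vanishes:
  assumes F: "\<And>j. j < Suc n \<Longrightarrow> F j \<in> dual_on K" "F n = coord_on K n" and i: "i < n"
    and zero: "\<And>v. v \<in> K' \<Longrightarrow> F i v = 0"
  shows "\<Phi> F = 0"
proof (rule S2_zero[OF noeth S2])
  fix q :: "'a set" assume q: "minimal_prime q"
  have Fi: "F i \<in> dual_on K" using F i by simp
  obtain G where G: "lin_on (restr {n} ` K) G" "\<And>v. v \<in> K \<Longrightarrow> G (restr {n} v) = F i v"
    using lin_factor[OF dual_lin[OF subK Fi] zero] by blast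
  have "ext_van q 0 {n} (restr {n} ` K)"
    by (rule G1_ext_van_minimal[OF noeth G1 q]) (auto simp: restr_vec submod_restr_image[OF subK])
  then have "\<exists>s c. s \<notin> q \<and> (\<forall>w\<in>restr {n} ` K. s * G w = (\<Sum>a\<in>{n}. c a * w a))"
    using G(1) by simp
  then obtain s c where s: "s \<notin> q" "\<And>w. w \<in> restr {n} ` K \<Longrightarrow> s * G w = c n * w n" by auto
  have "s * F i v = c n * coord_on K n v" for v
  proof (cases "v \<in> K")
    case True
    then show ?thesis using s(2)[of "restr {n} v"] G(2)[OF True] by (simp add: coord_on_def restr_def)
  qed (use dual_outside[OF Fi] in \<open>simp add: coord_on_def\<close>)
  then have eq: "(\<lambda>x. s * F i x) = (\<lambda>x. c n * coord_on K n x)" by blast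
  have "s * \<Phi> (F(i := F i)) = \<Phi> (F(i := (\<lambda>x. s * F i x)))"
    using i by (intro alt_scale[OF \<Phi> F(1) _ Fi, symmetric]) auto
  also have "\<dots> = c n * \<Phi> (F(i := coord_on K n))"
    unfolding eq using i by (intro alt_scale[OF \<Phi> F(1) _ coord_dual[OF subK]]) auto
  also have "\<Phi> (F(i := coord_on K n)) = 0"
    using F i coord_dual[OF subK] by (intro alt_equal[OF \<Phi>, of _ i n]) auto
  finally show "\<exists>s. s \<notin> q \<and> s * \<Phi> F = 0" using s(1) by auto
qed

text \<open>The entries of F are exchanged for those of G one at a time; each exchange alters the
  value by a form with a slot that vanishes on K'.\<close>

lemma lifts_unique:
  assumes F: "lifts r f F" and G: "lifts r f G"
  shows "\<Phi> F = \<Phi> G"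
proof -
  define H where "H k = (\<lambda>i. if i < k then G i else F i)" for k
  have "\<Phi> (H k) = \<Phi> F" if "k \<le> n" for k
    using that
  proof (induction k)
    case (Suc k)
    then have k: "k < n" by simp
    have H: "H k j \<in> dual_on K" if "j < Suc n" for j
      using lifts_dual[OF F that] lifts_dual[OF G that] by (simp add: H_def)
    define d where "d = (\<lambda>x. F k x + (-1) * G k x)"
    have d: "d \<in> dual_on K" unfolding d_def
      using lifts_dual[OF F, of k] lifts_dual[OF G, of k] k by (intro dual_add dual_scale) auto
    have "\<Phi> ((H k)(k := (\<lambda>x. d x + G k x))) = \<Phi> ((H k)(k := d)) + \<Phi> ((H k)(k := G k))"
      using k lifts_dual[OF G, of k] by (intro alt_add[OF \<Phi> H _ d]) auto
    moreover have "(H k)(k := (\<lambda>x. d x + G k x)) = H k"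
      by (auto simp: fun_eq_iff d_def H_def)
    moreover have "(H k)(k := G k) = H (Suc k)"
      by (auto simp: fun_eq_iff H_def less_Suc_eq)
    moreover have "\<Phi> ((H k)(k := d)) = 0"
    proof (rule form_vanishes[OF _ _ k])
      show "((H k)(k := d)) j \<in> dual_on K" if "j < Suc n" for j using H[OF that] d by simp
      show "((H k)(k := d)) n = coord_on K n" using F k by (simp add: H_def lifts_def)
      show "((H k)(k := d)) k v = 0" if "v \<in> K'" for v
        using F G k that by (simp add: d_def lifts_def)
    qed
    ultimately show ?case using Suc by simp
  qed (simp add: H_def)
  then have "\<Phi> F = \<Phi> (H n)" by simp
  also have "\<dots> = \<Phi> G"
  proof (rule alt_cong[OF \<Phi>])
    show "H n i = G i" if "i < Suc n" for i
      using that F G by (cases "i = n") (auto simp: H_def lifts_def)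
  qed
  finally show ?thesis .
qed

lemma lifts_scale:
  assumes F: "lifts r f F"
  obtains G where "lifts (r' * r) f G" "\<Phi> G = r' ^ n * \<Phi> F"
proof
  let ?G = "\<lambda>i. if i < n then (\<lambda>x. r' * F i x) else F i"
  show "lifts (r' * r) f ?G"
    using F by (auto simp: lifts_def mult.assoc intro: dual_scale)
  show "\<Phi> ?G = r' ^ n * \<Phi> F"
    by (rule alt_scale_many[OF \<Phi> lifts_dual[OF F]]) auto
qed

text \<open>The vanishing of Ext^2(R/L, R) at P extends each f_i up to a factor s_i.\<close>

lemma lifts_exist:
  assumes f: "\<And>i. i < n \<Longrightarrow> f i \<in> dual_on K'" and P: "is_prime_ideal P" "height P \<le> 1"
  obtains r F where "r \<notin> P" "lifts r f F"
proof -
  interpret prime_loc P using noeth P by unfold_locales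
  have ext: "ext_van P 1 {n} (restr {n} ` K)"
    by (rule G1_S2_ext_van[OF noeth G1 S2 P]) (auto simp: restr_vec submod_restr_image[OF subK])
  have "\<exists>s F. s \<notin> P \<and> lin_on K F \<and> (\<forall>v\<in>K'. F v = s * f i v)" if "i < n" for i
  proof -
    obtain C k where "gens C k (restr {n} ` K)" "ext_van P 0 C (rel C k)"
      using ext unfolding One_nat_def ext_van.simps(2) by blast
    then show ?thesis
      by (rule extend_functional[OF split_pres_axioms _ _ dual_lin[OF subX f[OF that]]])
  qed
  then have "\<forall>i. \<exists>s F. i < n \<longrightarrow> s \<notin> P \<and> lin_on K F \<and> (\<forall>v\<in>K'. F v = s * f i v)" by blast
  then obtain s F where sF: "\<And>i. i < n \<Longrightarrow> s i \<notin> P \<and> lin_on K (F i) \<and> (\<forall>v\<in>K'. F i v = s i * f i v)"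
    by metis
  \<comment> \<open>The common multiplier; slot i is scaled by the product of the other s_j.\<close>
  define r where "r = prod s {..<n}"
  define G where "G i = (if i = n then coord_on K n
    else (\<lambda>x. prod s ({..<n} - {i}) * (if x \<in> K then F i x else 0)))" for i
  have "r \<notin> P" unfolding r_def using sF by (intro notin_prod) auto
  moreover have "lifts r f G"
    unfolding lifts_def
  proof (intro conjI allI impI ballI)
    fix i assume i: "i < n"
    show "G i \<in> dual_on K"
      using i sF lin_dual[OF subK] by (auto simp: G_def intro!: dual_scale)
    fix v assume v: "v \<in> K'"
    have "r = s i * prod s ({..<n} - {i})" unfolding r_def using i by (simp add: prod.remove)
    then show "G i v = r * f i v" using i v sF by (simp add: G_def ac_simps)
  qed (simp add: G_def)
  ultimately show ?thesis using that by blast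
qed

text \<open>The element c plays the role of the fraction \<Phi>(F)/r^n for all lifts
  simultaneously.\<close>

definition is_value :: "(nat \<Rightarrow> (nat \<Rightarrow> 'a) \<Rightarrow> 'a) \<Rightarrow> 'a \<Rightarrow> bool" where
  "is_value f c \<longleftrightarrow> (\<forall>r F. lifts r f F \<longrightarrow> \<Phi> F = r ^ n * c)"

text \<open>Lifts for r and r' are compared by scaling both to r r', where uniqueness gives the
  compatibility required by \<open>S2_glue\<close> with exponent n.\<close>

lemma is_value_exists:
  assumes f: "\<And>i. i < n \<Longrightarrow> f i \<in> dual_on K'"
  shows "\<exists>c. is_value f c"
proof -
  define I where "I = {r. \<exists>F. lifts r f F}"
  define \<phi> where "\<phi> r = \<Phi> (SOME F. lifts r f F)" for r
  have \<phi>: "\<Phi> F = \<phi> r" if "lifts r f F" for r F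
    unfolding \<phi>_def by (rule lifts_unique[OF that someI[of "lifts r f", OF that]])
  obtain c where c: "\<And>r. r \<in> I \<Longrightarrow> \<phi> r = r ^ n * c"
  proof (rule S2_glue[OF noeth S2])
    show "\<exists>r\<in>I. r \<notin> P" if "is_prime_ideal P" "height P \<le> 1" for P
      using lifts_exist[of f P] f that unfolding I_def by blast
    fix r r' assume "r \<in> I" "r' \<in> I"
    then obtain F F' where F: "lifts r f F" "lifts r' f F'" unfolding I_def by blast
    obtain G where G: "lifts (r' * r) f G" "\<Phi> G = r' ^ n * \<Phi> F" by (rule lifts_scale[OF F(1)])
    obtain G' where G': "lifts (r * r') f G'" "\<Phi> G' = r ^ n * \<Phi> F'" by (rule lifts_scale[OF F(2)])
    show "r ^ n * \<phi> r' = r' ^ n * \<phi> r"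
      using lifts_unique[OF G(1), of G'] G G' \<phi>[OF F(1)] \<phi>[OF F(2)] by (simp add: mult.commute)
  qed blast
  have "is_value f c"
    unfolding is_value_def
  proof (intro allI impI)
    fix r F assume F: "lifts r f F"
    then have "r \<in> I" by (auto simp: I_def)
    then show "\<Phi> F = r ^ n * c" using c \<phi>[OF F] by simp
  qed
  then show ?thesis ..
qed

text \<open>Identities between values need only be checked after multiplication by r^n, with r a
  multiplier from \<open>lifts_exist\<close>.\<close>

lemma zero_by_powers:
  assumes "\<And>P. is_prime_ideal P \<Longrightarrow> height P \<le> 1 \<Longrightarrow> \<exists>r. r \<notin> P \<and> r ^ n * z = 0"
  shows "(z :: 'a) = 0"
proof (rule S2_zero[OF noeth S2])
  fix q :: "'a set" assume q: "minimal_prime q"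
  then have prime: "is_prime_ideal q" by (simp add: minimal_prime_def)
  then obtain r where "r \<notin> q" "r ^ n * z = 0" using assms[OF prime] height_minimal[OF q] by auto
  then show "\<exists>s. s \<notin> q \<and> s * z = 0" using prime_power[OF prime] by blast
qed

definition drop_form :: "(nat \<Rightarrow> (nat \<Rightarrow> 'a) \<Rightarrow> 'a) \<Rightarrow> 'a" where
  "drop_form f = (SOME c. is_value f c)"

lemma drop_form_value:
  assumes "\<And>i. i < n \<Longrightarrow> f i \<in> dual_on K'" and "lifts r f F"
  shows "\<Phi> F = r ^ n * drop_form f"
  using is_value_exists[of f] assms someI_ex[of "is_value f"] unfolding drop_form_def is_value_def by blast

text \<open>Each rule holds for \<Phi> on suitable lifts and descends by
  \<open>zero_by_powers\<close>.\<close>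

lemma drop_form_alt: "drop_form \<in> alt_forms K' n"
proof (rule alt_formsI)
  fix f g :: "nat \<Rightarrow> (nat \<Rightarrow> 'a) \<Rightarrow> 'a" assume "\<And>i. i < n \<Longrightarrow> f i = g i"
  \<comment> \<open>Equal predicates make \<open>SOME\<close> choose equal values, also for families
    outside the dual, which \<open>alt_forms\<close> includes in this clause.\<close>
  then have "lifts r f F \<longleftrightarrow> lifts r g F" for r F by (simp add: lifts_def)
  then show "drop_form f = drop_form g" by (simp add: drop_form_def is_value_def)
next
  fix f :: "nat \<Rightarrow> (nat \<Rightarrow> 'a) \<Rightarrow> 'a" and i u v
  assume f: "\<And>j. j < n \<Longrightarrow> f j \<in> dual_on K'" and i: "i < n" and u: "u \<in> dual_on K'" and v: "v \<in> dual_on K'"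
  let ?w = "\<lambda>x. u x + v x"
  have fu: "(f(i := w)) j \<in> dual_on K'" if "w \<in> dual_on K'" "j < n" for w j using f that by simp
  have "drop_form (f(i := ?w)) - drop_form (f(i := u)) - drop_form (f(i := v)) = 0"
  proof (rule zero_by_powers)
    fix P :: "'a set" assume P: "is_prime_ideal P" "height P \<le> 1"
    obtain r1 F1 where 1: "r1 \<notin> P" "lifts r1 (f(i := u)) F1" by (rule lifts_exist[OF fu[OF u] P])
    obtain r2 F2 where 2: "r2 \<notin> P" "lifts r2 (f(i := v)) F2" by (rule lifts_exist[OF fu[OF v] P])
    define r where "r = r2 * r1"
    have r: "r \<notin> P" using 1(1) 2(1) P(1) unfolding r_def is_prime_ideal_def by blast
    obtain F where F: "lifts r (f(i := u)) F" using lifts_scale[OF 1(2), of r2] unfolding r_def by blast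
    obtain G where G: "lifts r (f(i := v)) G" using lifts_scale[OF 2(2), of r1] unfolding r_def by (metis mult.commute)
    have Fi: "F i \<in> dual_on K" "G i \<in> dual_on K" using F G i by (auto simp: lifts_def)
    \<comment> \<open>The families for u and v agree away from slot i, so the other entries of F
      serve for both; additivity needs lifts that differ in one slot only.\<close>
    have "lifts r (f(i := v)) (F(i := G i))"
      using F G i by (auto simp: lifts_def)
    then have a: "\<Phi> (F(i := G i)) = r ^ n * drop_form (f(i := v))" by (rule drop_form_value[of "f(i := v)", rotated]) (rule fu[OF v])
    have b: "\<Phi> (F(i := F i)) = r ^ n * drop_form (f(i := u))" using drop_form_value[OF fu[OF u] F] by simp
    have "lifts r (f(i := ?w)) (F(i := (\<lambda>x. F i x + G i x)))"
      using F G i dual_add[OF Fi] by (auto simp: lifts_def distrib_left)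
    then have c: "\<Phi> (F(i := (\<lambda>x. F i x + G i x))) = r ^ n * drop_form (f(i := ?w))"
      by (rule drop_form_value[of "f(i := ?w)", rotated]) (rule fu[OF dual_add[OF u v]])
    have "\<Phi> (F(i := (\<lambda>x. F i x + G i x))) = \<Phi> (F(i := F i)) + \<Phi> (F(i := G i))"
      using i by (intro alt_add[OF \<Phi> lifts_dual[OF F] _ Fi]) auto
    then show "\<exists>r. r \<notin> P \<and>
        r ^ n * (drop_form (f(i := ?w)) - drop_form (f(i := u)) - drop_form (f(i := v))) = 0"
      using a b c r by (intro exI[of _ r]) (simp add: right_diff_distrib)
  qed
  then show "drop_form (f(i := ?w)) = drop_form (f(i := u)) + drop_form (f(i := v))"
    by (simp add: algebra_simps)
next
  fix f :: "nat \<Rightarrow> (nat \<Rightarrow> 'a) \<Rightarrow> 'a" and i u a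
  assume f: "\<And>j. j < n \<Longrightarrow> f j \<in> dual_on K'" and i: "i < n" and u: "u \<in> dual_on K'"
  have fu: "(f(i := w)) j \<in> dual_on K'" if "w \<in> dual_on K'" "j < n" for w j using f that by simp
  have "drop_form (f(i := (\<lambda>x. a * u x))) - a * drop_form (f(i := u)) = 0"
  proof (rule zero_by_powers)
    fix P :: "'a set" assume P: "is_prime_ideal P" "height P \<le> 1"
    obtain r F where r: "r \<notin> P" and F: "lifts r (f(i := u)) F" by (rule lifts_exist[OF fu[OF u] P])
    have Fi: "F i \<in> dual_on K" using F i by (auto simp: lifts_def)
    have b: "\<Phi> (F(i := F i)) = r ^ n * drop_form (f(i := u))" using drop_form_value[OF fu[OF u] F] by simp
    have "lifts r (f(i := (\<lambda>x. a * u x))) (F(i := (\<lambda>x. a * F i x)))"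
      using F i dual_scale[OF Fi] by (auto simp: lifts_def mult.left_commute)
    then have c: "\<Phi> (F(i := (\<lambda>x. a * F i x))) = r ^ n * drop_form (f(i := (\<lambda>x. a * u x)))"
      by (rule drop_form_value[of "f(i := (\<lambda>x. a * u x))", rotated]) (rule fu[OF dual_scale[OF u]])
    have "\<Phi> (F(i := (\<lambda>x. a * F i x))) = a * \<Phi> (F(i := F i))"
      using i by (intro alt_scale[OF \<Phi> lifts_dual[OF F] _ Fi]) auto
    then show "\<exists>r. r \<notin> P \<and> r ^ n * (drop_form (f(i := (\<lambda>x. a * u x))) - a * drop_form (f(i := u))) = 0"
      using b c r by (intro exI[of _ r]) (simp add: right_diff_distrib mult.left_commute)
  qed
  then show "drop_form (f(i := (\<lambda>x. a * u x))) = a * drop_form (f(i := u))" by simp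
next
  fix f :: "nat \<Rightarrow> (nat \<Rightarrow> 'a) \<Rightarrow> 'a" and i j
  assume f: "\<And>j. j < n \<Longrightarrow> f j \<in> dual_on K'" and ij: "i < j" "j < n" "f i = f j"
  show "drop_form f = 0"
  proof (rule zero_by_powers)
    fix P :: "'a set" assume P: "is_prime_ideal P" "height P \<le> 1"
    obtain r F where r: "r \<notin> P" and F: "lifts r f F" by (rule lifts_exist[OF f P])
    \<comment> \<open>As f_i = f_j, the lift of f_i may be used twice, and then \<Phi>
      vanishes.\<close>
    have F': "lifts r f (F(j := F i))" using F ij by (auto simp: lifts_def)
    have "\<Phi> (F(j := F i)) = 0"
      by (rule alt_equal[OF \<Phi> lifts_dual[OF F'], where i = i and j = j]) (use ij in auto)
    then show "\<exists>r. r \<notin> P \<and> r ^ n * drop_form f = 0"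
      using drop_form_value[OF f F'] r by auto
  qed
qed

lemma drop_form_coord: "drop_form (coord_on K') = \<Phi> (coord_on K)"
proof -
  have "lifts 1 (coord_on K') (coord_on K)"
    using coord_dual[OF subK] by (auto simp: lifts_def coord_on_def)
  then show ?thesis
    using drop_form_value[OF coord_dual[OF subX]] by simp
qed

end

section \<open>Prepending a redundant generator\<close>

text \<open>K splits as R \<sigma> plus a copy of K', and the new form is the wedge of \<sigma> with
  \<Phi>.\<close>

lemma alt_forms_prepend:
  fixes K K' :: "(nat \<Rightarrow> 'a::comm_ring_1) set"
  assumes \<Phi>: "\<Phi> \<in> alt_forms K' n" and subK: "submod K" and \<sigma>: "\<sigma> \<in> K" "\<sigma> 0 = 1"
    and K': "K' = {v. case_nat 0 v \<in> K}"
  obtains \<Psi> where "\<Psi> \<in> alt_forms K (Suc n)" "\<Psi> (coord_on K) = \<Phi> (coord_on K')"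
proof -
  have shift_comb: "case_nat 0 (\<lambda>j. r * x j + y j) = (\<lambda>j. r * case_nat 0 x j + case_nat 0 y j)"
    for r :: 'a and x y
    by (auto simp: fun_eq_iff split: nat.split)
  have subK': "submod K'"
  proof -
    have "case_nat 0 (\<lambda>_. 0) = (\<lambda>_. 0 :: 'a)" by (auto simp: fun_eq_iff split: nat.split)
    then show ?thesis
      using subK unfolding K' submod_def by (simp add: shift_comb)
  qed
  define \<rho> where "\<rho> F = (\<lambda>v. if v \<in> K' then F (case_nat 0 v) else 0)" for F :: "(nat \<Rightarrow> 'a) \<Rightarrow> 'a"
  have \<rho>_dual: "\<rho> F \<in> dual_on K'" if "F \<in> dual_on K" for F
    unfolding \<rho>_def
  proof (rule lin_dual[OF subK'])
    show "lin_on K' (\<lambda>v. F (case_nat 0 v))"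
      using dual_lin[OF subK that] unfolding lin_on_def K' by (simp add: shift_comb)
  qed
  have \<rho>_add: "\<rho> (\<lambda>x. u x + v x) = (\<lambda>x. \<rho> u x + \<rho> v x)" for u v
    by (auto simp: \<rho>_def)
  have \<rho>_scale: "\<rho> (\<lambda>x. r * u x) = (\<lambda>x. r * \<rho> u x)" for r u
    by (auto simp: \<rho>_def)
  define T where "T F = (\<lambda>i. \<rho> (F (Suc i)))" for F :: "nat \<Rightarrow> (nat \<Rightarrow> 'a) \<Rightarrow> 'a"
  have T_dual: "T F j \<in> dual_on K'" if "\<And>j. j < Suc n \<Longrightarrow> F j \<in> dual_on K" "j < n" for F j
    using that by (simp add: T_def \<rho>_dual)
  \<comment> \<open>Contraction with \<sigma>, expanded along its argument. Putting F_0 into the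
    vacated slot j instead of at the front absorbs the alternating sign, which leaves the same minus
    sign in every term.\<close>
  define \<Psi> where "\<Psi> F = F 0 \<sigma> * \<Phi> (T F) - (\<Sum>j<n. F (Suc j) \<sigma> * \<Phi> ((T F)(j := \<rho> (F 0))))" for F
  have \<Psi>_0: "\<Psi> (F(0 := w)) = w \<sigma> * \<Phi> (T F) - (\<Sum>j<n. F (Suc j) \<sigma> * \<Phi> ((T F)(j := \<rho> w)))" for F w
    by (simp add: \<Psi>_def T_def)
  \<comment> \<open>Slot k + 1 enters the first term through \<Phi>, the term j = k through its
    value at \<sigma>, and all remaining terms again through \<Phi>.\<close>
  have \<Psi>_Suc: "\<Psi> (F(Suc k := w)) = F 0 \<sigma> * \<Phi> ((T F)(k := \<rho> w)) - (w \<sigma> * \<Phi> ((T F)(k := \<rho> (F 0))) +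
      (\<Sum>j\<in>{..<n} - {k}. F (Suc j) \<sigma> * \<Phi> ((T F)(j := \<rho> (F 0), k := \<rho> w))))"
    if k: "k < n" for F k w
  proof -
    have TF: "T (F(Suc k := w)) = (T F)(k := \<rho> w)"
      by (auto simp: T_def fun_eq_iff)
    have "(\<Sum>j\<in>{..<n} - {k}. (F(Suc k := w)) (Suc j) \<sigma> * \<Phi> ((T F)(k := \<rho> w, j := \<rho> (F 0)))) =
        (\<Sum>j\<in>{..<n} - {k}. F (Suc j) \<sigma> * \<Phi> ((T F)(j := \<rho> (F 0), k := \<rho> w)))"
      by (intro sum.cong) (auto simp: fun_upd_twist)
    then show ?thesis
      unfolding \<Psi>_def TF using k by (simp add: sum.remove[of "{..<n}" k])
  qed
  have "\<Psi> \<in> alt_forms K (Suc n)"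
  proof (rule alt_formsI)
    fix f g :: "nat \<Rightarrow> (nat \<Rightarrow> 'a) \<Rightarrow> 'a" assume eq: "\<And>i. i < Suc n \<Longrightarrow> f i = g i"
    have "\<Phi> (T f) = \<Phi> (T g)" "\<And>j w. \<Phi> ((T f)(j := w)) = \<Phi> ((T g)(j := w))"
      by (rule alt_cong[OF \<Phi>]; simp add: T_def eq)+
    then show "\<Psi> f = \<Psi> g" by (simp add: \<Psi>_def eq)
  next
    fix f :: "nat \<Rightarrow> (nat \<Rightarrow> 'a) \<Rightarrow> 'a" and i u v
    assume f: "\<And>j. j < Suc n \<Longrightarrow> f j \<in> dual_on K" and i: "i < Suc n"
      and u: "u \<in> dual_on K" and v: "v \<in> dual_on K"
    let ?w = "\<lambda>x. u x + v x"
    have Tu: "((T f)(j := \<rho> w)) l \<in> dual_on K'" if "w \<in> dual_on K" "l < n" for w j l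
      using T_dual[OF f] that \<rho>_dual by simp
    show "\<Psi> (f(i := ?w)) = \<Psi> (f(i := u)) + \<Psi> (f(i := v))"
    proof (cases i)
      case 0
      have "\<Phi> ((T f)(j := \<rho> ?w)) = \<Phi> ((T f)(j := \<rho> u)) + \<Phi> ((T f)(j := \<rho> v))" if "j < n" for j
        unfolding \<rho>_add by (rule alt_add[OF \<Phi> T_dual[OF f] that \<rho>_dual[OF u] \<rho>_dual[OF v]])
      then show ?thesis unfolding 0 \<Psi>_0
        by (simp add: distrib_left distrib_right sum.distrib)
    next
      case (Suc k)
      then have k: "k < n" using i by simp
      have a: "\<Phi> ((T f)(k := \<rho> ?w)) = \<Phi> ((T f)(k := \<rho> u)) + \<Phi> ((T f)(k := \<rho> v))"
        unfolding \<rho>_add by (rule alt_add[OF \<Phi> T_dual[OF f] k \<rho>_dual[OF u] \<rho>_dual[OF v]])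
      have b: "\<Phi> ((T f)(j := \<rho> (f 0), k := \<rho> ?w)) =
          \<Phi> ((T f)(j := \<rho> (f 0), k := \<rho> u)) + \<Phi> ((T f)(j := \<rho> (f 0), k := \<rho> v))" for j
        unfolding \<rho>_add by (rule alt_add[OF \<Phi> Tu[OF f] k \<rho>_dual[OF u] \<rho>_dual[OF v]]) simp_all
      show ?thesis unfolding Suc \<Psi>_Suc[OF k] a b
        by (simp add: distrib_left distrib_right sum.distrib)
    qed
  next
    fix f :: "nat \<Rightarrow> (nat \<Rightarrow> 'a) \<Rightarrow> 'a" and i u r
    assume f: "\<And>j. j < Suc n \<Longrightarrow> f j \<in> dual_on K" and i: "i < Suc n" and u: "u \<in> dual_on K"
    let ?w = "\<lambda>x. r * u x"
    have Tu: "((T f)(j := \<rho> w)) l \<in> dual_on K'" if "w \<in> dual_on K" "l < n" for w j l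
      using T_dual[OF f] that \<rho>_dual by simp
    show "\<Psi> (f(i := ?w)) = r * \<Psi> (f(i := u))"
    proof (cases i)
      case 0
      have "\<Phi> ((T f)(j := \<rho> ?w)) = r * \<Phi> ((T f)(j := \<rho> u))" if "j < n" for j
        unfolding \<rho>_scale by (rule alt_scale[OF \<Phi> T_dual[OF f] that \<rho>_dual[OF u]])
      then show ?thesis unfolding 0 \<Psi>_0
        by (simp add: right_diff_distrib sum_distrib_left ac_simps)
    next
      case (Suc k)
      then have k: "k < n" using i by simp
      have a: "\<Phi> ((T f)(k := \<rho> ?w)) = r * \<Phi> ((T f)(k := \<rho> u))"
        unfolding \<rho>_scale by (rule alt_scale[OF \<Phi> T_dual[OF f] k \<rho>_dual[OF u]])
      have b: "\<Phi> ((T f)(j := \<rho> (f 0), k := \<rho> ?w)) = r * \<Phi> ((T f)(j := \<rho> (f 0), k := \<rho> u))" for j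
        unfolding \<rho>_scale by (rule alt_scale[OF \<Phi> Tu[OF f] k \<rho>_dual[OF u]]) simp_all
      show ?thesis unfolding Suc \<Psi>_Suc[OF k] a b
        by (simp add: right_diff_distrib distrib_left sum_distrib_left ac_simps)
    qed
  next
    fix f :: "nat \<Rightarrow> (nat \<Rightarrow> 'a) \<Rightarrow> 'a" and i j
    assume f: "\<And>j. j < Suc n \<Longrightarrow> f j \<in> dual_on K" and ij: "i < j" "j < Suc n" "f i = f j"
    have f0: "f 0 \<in> dual_on K" using f by simp
    have Tu: "((T f)(j := \<rho> (f 0))) l \<in> dual_on K'" if "l < n" for j l
      using T_dual[OF f] that \<rho>_dual[OF f0] by simp
    obtain b where b: "j = Suc b" "b < n" using ij by (cases j) auto
    show "\<Psi> f = 0"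
    proof (cases i)
      case 0
      \<comment> \<open>The term with index b cancels the leading one; every other term contains
        this functional twice.\<close>
      then have Tb: "T f b = \<rho> (f 0)" using ij(3) b by (simp add: T_def)
      have z: "f (Suc l) \<sigma> * \<Phi> ((T f)(l := \<rho> (f 0))) = 0" if "l < n" "l \<noteq> b" for l
      proof -
        have "\<Phi> ((T f)(l := \<rho> (f 0))) = 0"
          by (rule alt_equal[OF \<Phi> Tu, where i = l and j = b]) (use that b Tb in auto)
        then show ?thesis by simp
      qed
      have Tb': "(T f)(b := \<rho> (f 0)) = T f" using Tb by auto
      have sum: "(\<Sum>l<n. f (Suc l) \<sigma> * \<Phi> ((T f)(l := \<rho> (f 0)))) = f (Suc b) \<sigma> * \<Phi> (T f)"
        using b z Tb' by (simp add: sum.remove[of "{..<n}" b])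
      show ?thesis unfolding \<Psi>_def sum using 0 ij(3) b by simp
    next
      case (Suc a)
      then have ab: "a < n" "a \<noteq> b" "T f a = T f b" using ij b by (auto simp: T_def)
      have Tf: "T f l \<in> dual_on K'" if "l < n" for l
        using T_dual[OF f that] .
      have T0: "\<Phi> (T f) = 0"
        by (rule alt_equal[OF \<Phi> Tf, where i = a and j = b]) (use ab b in auto)
      have z: "f (Suc l) \<sigma> * \<Phi> ((T f)(l := \<rho> (f 0))) = 0" if "l < n" "l \<noteq> a" "l \<noteq> b" for l
      proof -
        have "\<Phi> ((T f)(l := \<rho> (f 0))) = 0"
          by (rule alt_equal[OF \<Phi> Tu, where i = a and j = b]) (use that b ab in auto)
        then show ?thesis by simp
      qed
      \<comment> \<open>Only the terms that replace one of the two equal slots survive, and these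
        are opposite by antisymmetry.\<close>
      have sum: "(\<Sum>l<n. f (Suc l) \<sigma> * \<Phi> ((T f)(l := \<rho> (f 0)))) =
          f (Suc a) \<sigma> * \<Phi> ((T f)(a := \<rho> (f 0))) + f (Suc b) \<sigma> * \<Phi> ((T f)(b := \<rho> (f 0)))"
      proof -
        have "(\<Sum>l<n. f (Suc l) \<sigma> * \<Phi> ((T f)(l := \<rho> (f 0)))) =
            (\<Sum>l\<in>{a, b}. f (Suc l) \<sigma> * \<Phi> ((T f)(l := \<rho> (f 0))))"
          using b ab z by (intro sum.mono_neutral_right) auto
        then show ?thesis using ab by simp
      qed
      have swap: "\<Phi> ((T f)(a := \<rho> (f 0))) = - \<Phi> ((T f)(b := \<rho> (f 0)))"
      proof -
        have "(T f)(a := \<rho> (f 0), b := T f b) = (T f)(a := \<rho> (f 0))"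
          and "(T f)(a := T f b, b := \<rho> (f 0)) = (T f)(b := \<rho> (f 0))"
          using ab by (auto simp: fun_eq_iff)
        moreover have "\<Phi> ((T f)(a := \<rho> (f 0), b := T f b)) = - \<Phi> ((T f)(a := T f b, b := \<rho> (f 0)))"
          by (rule alt_swap[OF \<Phi>]) (use Tf ab b \<rho>_dual[OF f0] in auto)
        ultimately show ?thesis by simp
      qed
      show ?thesis unfolding \<Psi>_def sum T0 swap using ij(3) b Suc by simp
    qed
  qed
  moreover have "\<Psi> (coord_on K) = \<Phi> (coord_on K')"
  proof -
    have T: "T (coord_on K) = coord_on K'"
      by (auto simp: T_def \<rho>_def coord_on_def K' fun_eq_iff)
    \<comment> \<open>Coordinate 0 vanishes on the shifted copy of K'; written as 0 times a
      functional, it kills the sum by homogeneity, and only the leading term with \<sigma>_0 = 1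
      remains.\<close>
    have \<rho>0: "\<rho> (coord_on K 0) = (\<lambda>x. 0 * coord_on K' 0 x)"
      by (auto simp: \<rho>_def coord_on_def fun_eq_iff)
    have "\<Phi> ((coord_on K')(j := \<rho> (coord_on K 0))) = 0" if "j < n" for j
      unfolding \<rho>0 using alt_scale[OF \<Phi> coord_dual[OF subK'] that coord_dual[OF subK'], where r = 0]
      by simp
    then show ?thesis using \<sigma> by (simp add: \<Psi>_def T) (simp add: coord_on_def)
  qed
  ultimately show ?thesis using that by blast
qed

section \<open>Presentations\<close>

lemma char_of_pres_coord:
  "char_of_pres scale n g =
    {\<Phi> (coord_on (relmod scale n g)) | \<Phi>. \<Phi> \<in> alt_forms (relmod scale n g) n}"
  by (simp add: char_of_pres_def coord_on_def Let_def)

lemma char_of_pres_cong: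
  assumes "\<And>i. i < n \<Longrightarrow> g i = h i"
  shows "char_of_pres scale n g = char_of_pres scale n h"
proof -
  have "relmod scale n g = relmod scale n h" using assms by (simp add: relmod_def)
  then show ?thesis by (simp add: char_of_pres_coord)
qed

context module
begin

lemma span_image_combination:
  assumes "z \<in> span (g ` {..<n::nat})"
  obtains c where "z = (\<Sum>i<n. scale (c i) (g i))"
proof -
  have "g i \<in> range (\<lambda>c. \<Sum>i<n. scale (c i) (g i))" if "i < n" for i
  proof -
    have "(\<Sum>k<n. scale (if k = i then 1 else 0) (g k)) = (\<Sum>k<n. if k = i then g k else 0)"
      by (intro sum.cong) auto
    also have "\<dots> = g i" using that by simp
    finally show ?thesis by (intro range_eqI[of _ _ "\<lambda>k. if k = i then 1 else 0"]) simp
  qed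
  moreover have "subspace (range (\<lambda>c. \<Sum>i<n. scale (c i) (g i)))"
  proof (rule subspaceI)
    show "0 \<in> range (\<lambda>c. \<Sum>i<n. scale (c i) (g i))"
      by (intro range_eqI[of _ _ "\<lambda>_. 0"]) simp
    fix x assume "x \<in> range (\<lambda>c. \<Sum>i<n. scale (c i) (g i))"
    then obtain c where c: "x = (\<Sum>i<n. scale (c i) (g i))" by blast
    show "scale r x \<in> range (\<lambda>c. \<Sum>i<n. scale (c i) (g i))" for r
      by (intro range_eqI[of _ _ "\<lambda>i. r * c i"]) (simp add: c scale_sum_right)
    fix y assume "y \<in> range (\<lambda>c. \<Sum>i<n. scale (c i) (g i))"
    then obtain d where d: "y = (\<Sum>i<n. scale (d i) (g i))" by blast
    show "x + y \<in> range (\<lambda>c. \<Sum>i<n. scale (c i) (g i))"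
      by (intro range_eqI[of _ _ "\<lambda>i. c i + d i"]) (simp add: c d scale_left_distrib sum.distrib)
  qed
  ultimately have "span (g ` {..<n}) \<subseteq> range (\<lambda>c. \<Sum>i<n. scale (c i) (g i))"
    by (intro span_minimal) auto
  then show ?thesis using assms that by blast
qed

lemma combination_comb:
  "(\<Sum>i<n. scale (r * x i + y i) (g i)) = scale r (\<Sum>i<n. scale (x i) (g i)) + (\<Sum>i<n. scale (y i) (g i))"
  for n :: nat
  by (simp add: scale_left_distrib sum.distrib scale_sum_right)

lemma submod_relmod: "submod (relmod scale n g)"
  using submod_vec[of "{..<n}"]
  by (simp add: relmod_def vecs_vec_on submod_def combination_comb) blast

lemma char_drop:
  assumes "noetherian_ring TYPE('a)" "cond_G1 TYPE('a)" "cond_S2 TYPE('a)"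
  shows "char_of_pres scale (Suc n) g \<subseteq> char_of_pres scale n g"
proof
  fix a assume "a \<in> char_of_pres scale (Suc n) g"
  then obtain \<Phi> where form: "\<Phi> \<in> alt_forms (relmod scale (Suc n) g) (Suc n)"
    "a = \<Phi> (coord_on (relmod scale (Suc n) g))" unfolding char_of_pres_coord by blast
  interpret alt_drop "relmod scale (Suc n) g" n \<Phi>
  proof
    show "relmod scale (Suc n) g \<subseteq> vec_on {..<Suc n}"
      unfolding relmod_def vecs_vec_on by blast
  qed (fact assms submod_relmod form)+
  have "relmod scale (Suc n) g \<inter> vec_on {..<n} = relmod scale n g"
    by (auto simp: relmod_def vecs_vec_on vec_on_def)
  then show "a \<in> char_of_pres scale n g"
    unfolding char_of_pres_coord using drop_form_alt drop_form_coord form(2) by (auto intro!: exI[of _ drop_form])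
qed

lemma char_prepend:
  assumes "z \<in> span (g ` {..<n})"
  shows "char_of_pres scale n g \<subseteq> char_of_pres scale (Suc n) (case_nat z g)"
proof
  fix a assume "a \<in> char_of_pres scale n g"
  then obtain \<Phi> where \<Phi>: "\<Phi> \<in> alt_forms (relmod scale n g) n"
    "a = \<Phi> (coord_on (relmod scale n g))" unfolding char_of_pres_coord by blast
  obtain c where c: "z = (\<Sum>i<n. scale (c i) (g i))"
    using span_image_combination[OF assms] by blast
  let ?K = "relmod scale (Suc n) (case_nat z g)"
  \<comment> \<open>The relation expressing z by the other generators, with coefficient 1 at
    z.\<close>
  let ?\<sigma> = "case_nat 1 (\<lambda>i. if i < n then - c i else 0)"
  have "(\<Sum>i<n. scale (if i < n then - c i else 0) (g i)) = - z"
    unfolding c sum_negf[symmetric] by (intro sum.cong) auto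
  then have "(\<Sum>i<Suc n. scale (?\<sigma> i) (case_nat z g i)) = 0"
    unfolding sum.lessThan_Suc_shift by simp
  moreover have "?\<sigma> \<in> vecs (Suc n)"
    by (auto simp: vecs_def split: nat.split)
  ultimately have \<sigma>: "?\<sigma> \<in> ?K"
    unfolding relmod_def by blast
  have rel: "relmod scale n g = {v. case_nat 0 v \<in> ?K}"
  proof -
    have "(\<forall>j\<ge>Suc n. case_nat 0 v j = 0) \<longleftrightarrow> (\<forall>j\<ge>n. v j = 0)" for v :: "nat \<Rightarrow> 'a"
      by (auto split: nat.split dest: Suc_le_D)
    then show ?thesis
      unfolding relmod_def vecs_def sum.lessThan_Suc_shift by simp
  qed
  obtain \<Psi> where "\<Psi> \<in> alt_forms ?K (Suc n)" "\<Psi> (coord_on ?K) = \<Phi> (coord_on (relmod scale n g))"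
    by (rule alt_forms_prepend[OF \<Phi>(1) submod_relmod \<sigma> nat.case(1) rel])
  then show "a \<in> char_of_pres scale (Suc n) (case_nat z g)"
    unfolding char_of_pres_coord \<Phi>(2) by (intro CollectI exI[of _ \<Psi>]) simp
qed

text \<open>The list g is prepended to h one element at a time, each being redundant, and then h is
  dropped from the end. No particular presentations are singled out, so the choices made by
  \<open>char_mod\<close> are harmless.\<close>

lemma char_of_pres_mono:
  assumes ring: "noetherian_ring TYPE('a)" "cond_G1 TYPE('a)" "cond_S2 TYPE('a)"
    and sub: "g ` {..<n} \<subseteq> span (h ` {..<m})"
  shows "char_of_pres scale m h \<subseteq> char_of_pres scale n g"
proof -
  define app where "app xs = (\<lambda>i. if i < length xs then xs ! i else h (i - length xs))" for xs
  have "char_of_pres scale m h \<subseteq> char_of_pres scale (length xs + m) (app xs)"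
    if "set xs \<subseteq> span (h ` {..<m})" for xs
    using that
  proof (induction xs)
    case Nil
    then show ?case by (simp add: app_def)
  next
    case (Cons x xs)
    have "h i \<in> app xs ` {..<length xs + m}" if "i < m" for i
      using that by (intro image_eqI[of _ _ "length xs + i"]) (auto simp: app_def)
    then have "span (h ` {..<m}) \<subseteq> span (app xs ` {..<length xs + m})"
      by (intro span_mono) auto
    then have "char_of_pres scale (length xs + m) (app xs) \<subseteq>
        char_of_pres scale (Suc (length xs + m)) (case_nat x (app xs))"
      using Cons.prems by (intro char_prepend) auto
    moreover have "case_nat x (app xs) = app (x # xs)"
      by (auto simp: app_def fun_eq_iff split: nat.split)
    ultimately show ?case using Cons by simp
  qed
  moreover have "char_of_pres scale (k + l) f \<subseteq> char_of_pres scale k f" for k l f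
  proof (induction l)
    case (Suc l)
    then show ?case using char_drop[OF ring, of "k + l" f] by simp
  qed simp
  moreover define xs where "xs = map g [0..<n]"
  moreover have "char_of_pres scale n (app xs) = char_of_pres scale n g"
    by (rule char_of_pres_cong) (simp add: app_def xs_def)
  moreover have "set xs \<subseteq> span (h ` {..<m})" using sub by (auto simp: xs_def)
  ultimately show ?thesis by (metis diff_zero length_map length_upt order_trans)
qed

lemma fin_gen_presentation:
  assumes "fin_gen scale S" shows "\<exists>n g. presentation scale S n g"
proof -
  obtain F where F: "finite F" "F \<subseteq> S" "span F = S" using assms unfolding fin_gen_def by blast
  obtain xs where xs: "set xs = F" using finite_list[OF F(1)] by blast
  \<comment> \<open>A generator 0 is added because a presentation needs n > 0 even when F is
    empty.\<close>
  have img: "(!) (0 # xs) ` {..<Suc (length xs)} = insert 0 F"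
    using nth_image[of "length (0 # xs)" "0 # xs"] xs by (simp add: lessThan_atLeast0)
  have "0 \<in> S" using F(3) span_zero by blast
  then have "(!) (0 # xs) ` {..<Suc (length xs)} \<subseteq> S"
    unfolding img using F by blast
  moreover have "span ((!) (0 # xs) ` {..<Suc (length xs)}) = S"
  proof -
    have "span (insert 0 F) \<subseteq> span F"
      using span_zero span_superset by (intro span_minimal subspace_span) auto
    then show ?thesis unfolding img using F(3) span_mono[of F "insert 0 F"] by blast
  qed
  ultimately have "presentation scale S (Suc (length xs)) ((!) (0 # xs))"
    unfolding presentation_def by blast
  then show ?thesis by blast
qed

text \<open>The preimage of N in R^n is finitely generated, and its generators map to generators of
  N.\<close>

lemma submodule_fin_gen:
  assumes noeth: "noetherian_ring TYPE('a)" and M: "presentation scale M n g"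
    and N: "subspace N" "N \<subseteq> M"
  shows "fin_gen scale N"
proof -
  let ?s = "\<lambda>x. \<Sum>i<n. scale (x i) (g i)"
  define R where "R = {x \<in> vec_on {..<n}. ?s x \<in> N}"
  have "submod R"
    using submod_vec[of "{..<n}"] N(1)
    by (simp add: R_def submod_def combination_comb subspace_0 subspace_add subspace_scale) blast
  then obtain C h where g: "gens C h R"
    using submod_fin_gen[OF noeth, of "{..<n}" R] by (auto simp: R_def)
  define F where "F = (\<lambda>c. ?s (h c)) ` C"
  have FN: "F \<subseteq> N" using gens_in[OF g] by (auto simp: F_def R_def)
  have "v \<in> span F" if v: "v \<in> N" for v
  proof -
    have "v \<in> span (g ` {..<n})" using v N M by (auto simp: presentation_def)
    then obtain c where c: "v = ?s c" by (rule span_image_combination)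
    then have c': "v = ?s (restr {..<n} c)" by (simp add: restr_def)
    then have "restr {..<n} c \<in> R" using v by (simp add: R_def restr_vec)
    then obtain y where y: "restr {..<n} c = lc C y h" using g unfolding gens_def by blast
    have "v = (\<Sum>i<n. \<Sum>k\<in>C. scale (y k) (scale (h k i) (g i)))"
      unfolding c' y by (simp add: lc_def scale_sum_left)
    also have "\<dots> = (\<Sum>k\<in>C. scale (y k) (?s (h k)))"
      by (subst sum.swap) (simp add: scale_sum_right)
    also have "\<dots> \<in> span F"
      by (intro span_sum span_scale span_base) (simp add: F_def)
    finally show ?thesis .
  qed
  moreover have "span F \<subseteq> N" by (rule span_minimal[OF FN N(1)])
  ultimately have "span F = N" by blast
  moreover have "finite F" using gens_finite[OF g] by (simp add: F_def)
  ultimately show ?thesis using FN unfolding fin_gen_def by blast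
qed

end

lemma char_mod_presentation:
  assumes "\<exists>n g. presentation scale S n g"
  obtains n g where "presentation scale S n g" "char_mod scale S = char_of_pres scale n g"
proof -
  have "\<exists>I n g. presentation scale S n g \<and> I = char_of_pres scale n g" using assms by blast
  from someI_ex[OF this] show ?thesis using that unfolding char_mod_def by blast
qed

theorem theoremC10:
  fixes scale :: "'a::comm_ring_1 \<Rightarrow> 'm::ab_group_add \<Rightarrow> 'm"
    and M N :: "'m set"
  assumes "noetherian_ring TYPE('a)"
    and "cond_G1 TYPE('a)"
    and "cond_S2 TYPE('a)"
    and "module scale"
    and "module.subspace scale M"
    and "fin_gen scale M"
    and "module.subspace scale N"
    and "N \<subseteq> M"
  shows "char_mod scale M \<subseteq> char_mod scale N"
proof -
  interpret module scale by fact
  obtain m h where M: "presentation scale M m h" "char_mod scale M = char_of_pres scale m h"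
    using char_mod_presentation fin_gen_presentation[OF assms(6)] by blast
  have "fin_gen scale N"
    by (rule submodule_fin_gen[OF assms(1) M(1) assms(7,8)])
  then obtain n g where N: "presentation scale N n g" "char_mod scale N = char_of_pres scale n g"
    using char_mod_presentation fin_gen_presentation by blast
  have "g ` {..<n} \<subseteq> span (h ` {..<m})"
    using M(1) N(1) assms(8) unfolding presentation_def by auto
  then show ?thesis
    unfolding M(2) N(2) by (rule char_of_pres_mono[OF assms(1-3)])
qed

end
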